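(* Let $A$ and $B$ be finite-dimensional local $k$-algebras, $X$ a finite-dimensional $(A,B)$-bimodule on which $k$ acts centrally, and $\Lambda=\begin{pmatrix}A&X\\0&B\end{pmatrix}$, $P_1=[A\ X]$, $P_2=[0\ B]$. (a) $\Sigma(\Lambda)$ contains $\operatorname{cone}\{(0,-1),(1,-r)\}$ for $r:=t(X)_B=\dim_{B/J_B}(X/XJ_B)$. (b) $\Sigma(\Lambda)$ contains $\operatorname{cone}\{(1,0),(\ell,-1)\}$ for $\ell:=t_A(X)=\dim_{A/J_A}(X/J_AX)$. (c) Let $g_1,\dots,g_r$ be a minimal set of generators of the right $B$-module $X$ and $g:=[g_1\ \cdots\ g_r]\in M_{1,r}(X)$. Then $\mu_1^+(\Lambda[1])=P_g\oplus P_2[1]$, a basic 2-term silting complex. (d) Let $h_1,\dots,h_\ell$ be a minimal set of generators of the left $A$-module $X$ and $h:=(h_1,\dots,h_\ell)^{T}\in M_{\ell,1}(X)$. Then $\mu_2^-(\Lambda)=P_1\oplus P_h$, a basic 2-term silting complex.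
   Context: $k$ a field; $t(X)_B$ (resp. $t_A(X)$) is the minimal number of generators of $X$ as right $B$- (resp. left $A$-) module. For $x\in M_{s,t}(X)$ ($s\times t$ matrices over $X$), $P_x$ is the 2-term complex $P_2^{\oplus t}\xrightarrow{x(\cdot)}P_1^{\oplus s}$ in degrees $-1,0$. $g$-fan $\Sigma(\Lambda)$: set of cones $\operatorname{cone}\{[T_i]\}$ for basic 2-term presilting complexes $T=\bigoplus T_i$ (presilting: $\operatorname{Hom}(T,T[\ell])=0$ for $\ell>0$; $[T]=[T^0]-[T^{-1}]$), in $\mathbb{R}^2$ via $[P_1]\mapsto(1,0)$, $[P_2]\mapsto(0,1)$. A 2-term presilting complex with two non-isomorphic indecomposable summands is silting. For basic 2-term silting complexes, $T\ge U$ iff $\operatorname{Hom}(T,U[\ell])=0$ for $\ell>0$. For basic 2-term silting $T=T_1\oplus T_2$ the mutation at $T_i$ is the unique other basic 2-term silting complex $T'_i\oplus T_j$ ($j\ne i$, $T'_i\not\cong T_i$), denoted $\mu_i^+(T)$ if it is $>T$ and $\mu_i^-(T)$ if $<T$. For $\Lambda[1]=P_1[1]\oplus P_2[1]$ and $\Lambda=P_1\oplus P_2$ the index $i$ refers to the summand $P_i[1]$, resp. $P_i$. *)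

theory Defs
  imports "HOL-Analysis.Analysis"
begin

definition k_alg :: "('k::field \<Rightarrow> 'a::ring_1) \<Rightarrow> bool" where
  "k_alg \<iota> \<longleftrightarrow> (\<forall>c d. \<iota> (c + d) = \<iota> c + \<iota> d) \<and> (\<forall>c d. \<iota> (c * d) = \<iota> c * \<iota> d)
      \<and> \<iota> 1 = 1 \<and> (\<forall>c a. \<iota> c * a = a * \<iota> c)"

definition fin_dim_k :: "('k \<Rightarrow> 'v::comm_monoid_add \<Rightarrow> 'v) \<Rightarrow> bool" where
  "fin_dim_k sc \<longleftrightarrow> (\<exists>S. finite S \<and> (\<forall>v. \<exists>c. v = (\<Sum>s\<in>S. sc (c s) s)))"

definition two_sided_unit :: "'a::ring_1 \<Rightarrow> bool" where
  "two_sided_unit x \<longleftrightarrow> (\<exists>y. x * y = 1 \<and> y * x = 1)"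

text \<open>Local ring: the non-units form an ideal (equivalently, are closed under addition).\<close>
definition loc_ring :: "'a::ring_1 itself \<Rightarrow> bool" where
  "loc_ring _ \<longleftrightarrow> (\<forall>x y::'a. \<not> two_sided_unit x \<longrightarrow> \<not> two_sided_unit y \<longrightarrow> \<not> two_sided_unit (x + y))"

definition bimod :: "('a::ring_1 \<Rightarrow> 'x::ab_group_add \<Rightarrow> 'x) \<Rightarrow> ('x \<Rightarrow> 'b::ring_1 \<Rightarrow> 'x) \<Rightarrow> bool" where
  "bimod la ra \<longleftrightarrow>
     (\<forall>a a' x. la (a * a') x = la a (la a' x)) \<and> (\<forall>x. la 1 x = x) \<and>
     (\<forall>a a' x. la (a + a') x = la a x + la a' x) \<and> (\<forall>a x y. la a (x + y) = la a x + la a y) \<and>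
     (\<forall>x b b'. ra x (b * b') = ra (ra x b) b') \<and> (\<forall>x. ra x 1 = x) \<and>
     (\<forall>x b b'. ra x (b + b') = ra x b + ra x b') \<and> (\<forall>x y b. ra (x + y) b = ra x b + ra y b) \<and>
     (\<forall>a x b. la a (ra x b) = ra (la a x) b)"

definition right_gen :: "('x::ab_group_add \<Rightarrow> 'b \<Rightarrow> 'x) \<Rightarrow> (nat \<Rightarrow> 'x) \<Rightarrow> nat \<Rightarrow> bool" where
  "right_gen ra g n \<longleftrightarrow> (\<forall>x. \<exists>b. x = (\<Sum>i<n. ra (g i) (b i)))"

definition left_gen :: "('a \<Rightarrow> 'x::ab_group_add \<Rightarrow> 'x) \<Rightarrow> (nat \<Rightarrow> 'x) \<Rightarrow> nat \<Rightarrow> bool" where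
  "left_gen la h n \<longleftrightarrow> (\<forall>x. \<exists>a. x = (\<Sum>i<n. la (a i) (h i)))"

definition rgen_num :: "('x::ab_group_add \<Rightarrow> 'b \<Rightarrow> 'x) \<Rightarrow> nat" where
  "rgen_num ra = (LEAST n. \<exists>g. right_gen ra g n)"

definition lgen_num :: "('a \<Rightarrow> 'x::ab_group_add \<Rightarrow> 'x) \<Rightarrow> nat" where
  "lgen_num la = (LEAST n. \<exists>h. left_gen la h n)"

text \<open>A morphism P1^p (+) P2^q -> P1^p' (+) P2^q' is a block matrix
  [[alpha, xi],[0, beta]] with alpha a p'xp matrix over A (=Hom(P1,P1)), xi a p'xq matrix
  over X (=Hom(P2,P1)), beta a q'xq matrix over B (=Hom(P2,P2)); Hom(P1,P2)=0.
  Matrices are functions nat => nat => _, only entries within bounds matter.\<close>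
record ('a, 'x, 'b) bm =
  mA :: "nat \<Rightarrow> nat \<Rightarrow> 'a"
  mX :: "nat \<Rightarrow> nat \<Rightarrow> 'x"
  mB :: "nat \<Rightarrow> nat \<Rightarrow> 'b"

text \<open>Composition N o M, where the middle object is P1^pm (+) P2^qm.\<close>
definition bcomp :: "('a::ring_1 \<Rightarrow> 'x::ab_group_add \<Rightarrow> 'x) \<Rightarrow> ('x \<Rightarrow> 'b::ring_1 \<Rightarrow> 'x) \<Rightarrow> nat \<Rightarrow> nat
    \<Rightarrow> ('a, 'x, 'b) bm \<Rightarrow> ('a, 'x, 'b) bm \<Rightarrow> ('a, 'x, 'b) bm" where
  "bcomp la ra pm qm N M =
     \<lparr>mA = (\<lambda>i j. \<Sum>k<pm. mA N i k * mA M k j),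
      mX = (\<lambda>i j. (\<Sum>k<pm. la (mA N i k) (mX M k j)) + (\<Sum>k<qm. ra (mX N i k) (mB M k j))),
      mB = (\<lambda>i j. \<Sum>k<qm. mB N i k * mB M k j)\<rparr>"

definition badd :: "('a::ring_1, 'x::ab_group_add, 'b::ring_1) bm \<Rightarrow> ('a, 'x, 'b) bm \<Rightarrow> ('a, 'x, 'b) bm" where
  "badd M N = \<lparr>mA = (\<lambda>i j. mA M i j + mA N i j), mX = (\<lambda>i j. mX M i j + mX N i j),
               mB = (\<lambda>i j. mB M i j + mB N i j)\<rparr>"

definition bsub :: "('a::ring_1, 'x::ab_group_add, 'b::ring_1) bm \<Rightarrow> ('a, 'x, 'b) bm \<Rightarrow> ('a, 'x, 'b) bm" where
  "bsub M N = \<lparr>mA = (\<lambda>i j. mA M i j - mA N i j), mX = (\<lambda>i j. mX M i j - mX N i j),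
               mB = (\<lambda>i j. mB M i j - mB N i j)\<rparr>"

definition bid :: "('a::ring_1, 'x::ab_group_add, 'b::ring_1) bm" where
  "bid = \<lparr>mA = (\<lambda>i j. if i = j then 1 else 0), mX = (\<lambda>i j. 0), mB = (\<lambda>i j. if i = j then 1 else 0)\<rparr>"

definition bzero :: "('a::zero, 'x::zero, 'b::zero) bm" where
  "bzero = \<lparr>mA = (\<lambda>i j. 0), mX = (\<lambda>i j. 0), mB = (\<lambda>i j. 0)\<rparr>"

definition beq :: "nat \<Rightarrow> nat \<Rightarrow> nat \<Rightarrow> nat \<Rightarrow> ('a, 'x, 'b) bm \<Rightarrow> ('a, 'x, 'b) bm \<Rightarrow> bool" where
  "beq ps qs pt qt M N \<longleftrightarrow>
     (\<forall>i<pt. \<forall>j<ps. mA M i j = mA N i j) \<and> (\<forall>i<pt. \<forall>j<qs. mX M i j = mX N i j) \<and>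
     (\<forall>i<qt. \<forall>j<qs. mB M i j = mB N i j)"

text \<open>Block-diagonal sum of M: (ps,qs)->(pt,qt) and N, reordered so that the
  P1-summands come first.\<close>
definition bdiag :: "nat \<Rightarrow> nat \<Rightarrow> nat \<Rightarrow> nat \<Rightarrow> ('a::zero, 'x::zero, 'b::zero) bm \<Rightarrow> ('a, 'x, 'b) bm \<Rightarrow> ('a, 'x, 'b) bm" where
  "bdiag ps qs pt qt M N =
     \<lparr>mA = (\<lambda>i j. if i < pt \<and> j < ps then mA M i j else if pt \<le> i \<and> ps \<le> j then mA N (i - pt) (j - ps) else 0),
      mX = (\<lambda>i j. if i < pt \<and> j < qs then mX M i j else if pt \<le> i \<and> qs \<le> j then mX N (i - pt) (j - qs) else 0),
      mB = (\<lambda>i j. if i < qt \<and> j < qs then mB M i j else if qt \<le> i \<and> qs \<le> j then mB N (i - qt) (j - qs) else 0)\<rparr>"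

text \<open>A 2-term complex T^{-1} -> T^0 with T^{-1} = P1^p1 (+) P2^q1 (degree -1),
  T^0 = P1^p0 (+) P2^q0 (degree 0), differential dd.\<close>
record ('a, 'x, 'b) cx =
  p1 :: nat
  q1 :: nat
  p0 :: nat
  q0 :: nat
  dd :: "('a, 'x, 'b) bm"

definition chain_map :: "('a::ring_1 \<Rightarrow> 'x::ab_group_add \<Rightarrow> 'x) \<Rightarrow> ('x \<Rightarrow> 'b::ring_1 \<Rightarrow> 'x) \<Rightarrow>
    ('a, 'x, 'b) cx \<Rightarrow> ('a, 'x, 'b) cx \<Rightarrow> ('a, 'x, 'b) bm \<Rightarrow> ('a, 'x, 'b) bm \<Rightarrow> bool" where
  "chain_map la ra T U f1 f0 \<longleftrightarrow>
     beq (p1 T) (q1 T) (p0 U) (q0 U) (bcomp la ra (p0 T) (q0 T) f0 (dd T)) (bcomp la ra (p1 U) (q1 U) (dd U) f1)"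

definition nullhtp :: "('a::ring_1 \<Rightarrow> 'x::ab_group_add \<Rightarrow> 'x) \<Rightarrow> ('x \<Rightarrow> 'b::ring_1 \<Rightarrow> 'x) \<Rightarrow>
    ('a, 'x, 'b) cx \<Rightarrow> ('a, 'x, 'b) cx \<Rightarrow> ('a, 'x, 'b) bm \<Rightarrow> ('a, 'x, 'b) bm \<Rightarrow> bool" where
  "nullhtp la ra T U f1 f0 \<longleftrightarrow> (\<exists>h.
     beq (p1 T) (q1 T) (p1 U) (q1 U) f1 (bcomp la ra (p0 T) (q0 T) h (dd T)) \<and>
     beq (p0 T) (q0 T) (p0 U) (q0 U) f0 (bcomp la ra (p1 U) (q1 U) (dd U) h))"

definition hiso :: "('a::ring_1 \<Rightarrow> 'x::ab_group_add \<Rightarrow> 'x) \<Rightarrow> ('x \<Rightarrow> 'b::ring_1 \<Rightarrow> 'x) \<Rightarrow>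
    ('a, 'x, 'b) cx \<Rightarrow> ('a, 'x, 'b) cx \<Rightarrow> bool" where
  "hiso la ra T U \<longleftrightarrow> (\<exists>f1 f0 g1 g0.
     chain_map la ra T U f1 f0 \<and> chain_map la ra U T g1 g0 \<and>
     nullhtp la ra T T (bsub (bcomp la ra (p1 U) (q1 U) g1 f1) bid) (bsub (bcomp la ra (p0 U) (q0 U) g0 f0) bid) \<and>
     nullhtp la ra U U (bsub (bcomp la ra (p1 T) (q1 T) f1 g1) bid) (bsub (bcomp la ra (p0 T) (q0 T) f0 g0) bid))"

text \<open>Hom(T, U[1]) = 0 in K^b(proj Lambda): every map T^{-1} -> U^0 is null-homotopic
  (for 2-term complexes Hom(T,U[l]) = 0 automatically for l >= 2).\<close>
definition hom1_zero :: "('a::ring_1 \<Rightarrow> 'x::ab_group_add \<Rightarrow> 'x) \<Rightarrow> ('x \<Rightarrow> 'b::ring_1 \<Rightarrow> 'x) \<Rightarrow>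
    ('a, 'x, 'b) cx \<Rightarrow> ('a, 'x, 'b) cx \<Rightarrow> bool" where
  "hom1_zero la ra T U \<longleftrightarrow> (\<forall>\<phi>. \<exists>a b.
     beq (p1 T) (q1 T) (p0 U) (q0 U) \<phi>
       (badd (bcomp la ra (p1 U) (q1 U) (dd U) a) (bcomp la ra (p0 T) (q0 T) b (dd T))))"

definition presilting :: "('a::ring_1 \<Rightarrow> 'x::ab_group_add \<Rightarrow> 'x) \<Rightarrow> ('x \<Rightarrow> 'b::ring_1 \<Rightarrow> 'x) \<Rightarrow>
    ('a, 'x, 'b) cx \<Rightarrow> bool" where
  "presilting la ra T \<longleftrightarrow> hom1_zero la ra T T"

definition dsum :: "('a::zero, 'x::zero, 'b::zero) cx \<Rightarrow> ('a, 'x, 'b) cx \<Rightarrow> ('a, 'x, 'b) cx" where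
  "dsum T U = \<lparr>p1 = p1 T + p1 U, q1 = q1 T + q1 U, p0 = p0 T + p0 U, q0 = q0 T + q0 U,
               dd = bdiag (p1 T) (q1 T) (p0 T) (q0 T) (dd T) (dd U)\<rparr>"

definition zcx :: "('a::zero, 'x::zero, 'b::zero) cx" where
  "zcx = \<lparr>p1 = 0, q1 = 0, p0 = 0, q0 = 0, dd = bzero\<rparr>"

definition dsum_list :: "('a::zero, 'x::zero, 'b::zero) cx list \<Rightarrow> ('a, 'x, 'b) cx" where
  "dsum_list Ts = foldr dsum Ts zcx"

definition indec :: "('a::ring_1 \<Rightarrow> 'x::ab_group_add \<Rightarrow> 'x) \<Rightarrow> ('x \<Rightarrow> 'b::ring_1 \<Rightarrow> 'x) \<Rightarrow>
    ('a, 'x, 'b) cx \<Rightarrow> bool" where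
  "indec la ra T \<longleftrightarrow> \<not> hiso la ra T zcx \<and>
     (\<forall>U V. hiso la ra T (dsum U V) \<longrightarrow> hiso la ra U zcx \<or> hiso la ra V zcx)"

definition basic_presilting :: "('a::ring_1 \<Rightarrow> 'x::ab_group_add \<Rightarrow> 'x) \<Rightarrow> ('x \<Rightarrow> 'b::ring_1 \<Rightarrow> 'x) \<Rightarrow>
    ('a, 'x, 'b) cx list \<Rightarrow> bool" where
  "basic_presilting la ra Ts \<longleftrightarrow> (\<forall>T\<in>set Ts. indec la ra T) \<and>
     (\<forall>i<length Ts. \<forall>j<length Ts. i \<noteq> j \<longrightarrow> \<not> hiso la ra (Ts ! i) (Ts ! j)) \<and>
     presilting la ra (dsum_list Ts)"

text \<open>g-vector [T] = [T^0] - [T^{-1}], with [P1] = (1,0), [P2] = (0,1).\<close>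
definition gvec :: "('a, 'x, 'b) cx \<Rightarrow> real \<times> real" where
  "gvec T = (real (p0 T) - real (p1 T), real (q0 T) - real (q1 T))"

definition gfan :: "('a::ring_1 \<Rightarrow> 'x::ab_group_add \<Rightarrow> 'x) \<Rightarrow> ('x \<Rightarrow> 'b::ring_1 \<Rightarrow> 'x) \<Rightarrow> (real \<times> real) set set" where
  "gfan la ra = {cone hull (gvec ` set Ts) | Ts. basic_presilting la ra Ts}"

text \<open>Basic 2-term silting complex T1 (+) T2 (Lambda has 2 simple modules).\<close>
definition silting2 :: "('a::ring_1 \<Rightarrow> 'x::ab_group_add \<Rightarrow> 'x) \<Rightarrow> ('x \<Rightarrow> 'b::ring_1 \<Rightarrow> 'x) \<Rightarrow>
    ('a, 'x, 'b) cx \<Rightarrow> ('a, 'x, 'b) cx \<Rightarrow> bool" where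
  "silting2 la ra T1 T2 \<longleftrightarrow> basic_presilting la ra [T1, T2]"

definition sgt :: "('a::ring_1 \<Rightarrow> 'x::ab_group_add \<Rightarrow> 'x) \<Rightarrow> ('x \<Rightarrow> 'b::ring_1 \<Rightarrow> 'x) \<Rightarrow>
    ('a, 'x, 'b) cx \<Rightarrow> ('a, 'x, 'b) cx \<Rightarrow> bool" where
  "sgt la ra T U \<longleftrightarrow> hom1_zero la ra T U \<and> \<not> hiso la ra T U"

definition mut_ok :: "('a::ring_1 \<Rightarrow> 'x::ab_group_add \<Rightarrow> 'x) \<Rightarrow> ('x \<Rightarrow> 'b::ring_1 \<Rightarrow> 'x) \<Rightarrow>
    ('a, 'x, 'b) cx \<Rightarrow> ('a, 'x, 'b) cx \<Rightarrow> nat \<Rightarrow> ('a, 'x, 'b) cx \<Rightarrow> bool" where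
  "mut_ok la ra T1 T2 i U \<longleftrightarrow>
     (if i = 1 then silting2 la ra U T2 \<and> \<not> hiso la ra U T1 \<and>
          (\<forall>V. silting2 la ra V T2 \<and> \<not> hiso la ra V T1 \<longrightarrow> hiso la ra V U)
      else silting2 la ra T1 U \<and> \<not> hiso la ra U T2 \<and>
          (\<forall>V. silting2 la ra T1 V \<and> \<not> hiso la ra V T2 \<longrightarrow> hiso la ra V U))"

definition mut_cx :: "('a::zero, 'x::zero, 'b::zero) cx \<Rightarrow> ('a, 'x, 'b) cx \<Rightarrow> nat \<Rightarrow> ('a, 'x, 'b) cx \<Rightarrow> ('a, 'x, 'b) cx" where
  "mut_cx T1 T2 i U = (if i = 1 then dsum U T2 else dsum T1 U)"

definition mu_plus :: "('a::ring_1 \<Rightarrow> 'x::ab_group_add \<Rightarrow> 'x) \<Rightarrow> ('x \<Rightarrow> 'b::ring_1 \<Rightarrow> 'x) \<Rightarrow>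
    ('a, 'x, 'b) cx \<Rightarrow> ('a, 'x, 'b) cx \<Rightarrow> nat \<Rightarrow> ('a, 'x, 'b) cx \<Rightarrow> bool" where
  "mu_plus la ra T1 T2 i U \<longleftrightarrow> mut_ok la ra T1 T2 i U \<and> sgt la ra (mut_cx T1 T2 i U) (dsum T1 T2)"

definition mu_minus :: "('a::ring_1 \<Rightarrow> 'x::ab_group_add \<Rightarrow> 'x) \<Rightarrow> ('x \<Rightarrow> 'b::ring_1 \<Rightarrow> 'x) \<Rightarrow>
    ('a, 'x, 'b) cx \<Rightarrow> ('a, 'x, 'b) cx \<Rightarrow> nat \<Rightarrow> ('a, 'x, 'b) cx \<Rightarrow> bool" where
  "mu_minus la ra T1 T2 i U \<longleftrightarrow> mut_ok la ra T1 T2 i U \<and> sgt la ra (dsum T1 T2) (mut_cx T1 T2 i U)"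

text \<open>P1, P2 in degree 0 and P1[1], P2[1] (in degree -1).\<close>
definition P1cx :: "('a::zero, 'x::zero, 'b::zero) cx" where
  "P1cx = \<lparr>p1 = 0, q1 = 0, p0 = 1, q0 = 0, dd = bzero\<rparr>"
definition P2cx :: "('a::zero, 'x::zero, 'b::zero) cx" where
  "P2cx = \<lparr>p1 = 0, q1 = 0, p0 = 0, q0 = 1, dd = bzero\<rparr>"
definition P1sh :: "('a::zero, 'x::zero, 'b::zero) cx" where
  "P1sh = \<lparr>p1 = 1, q1 = 0, p0 = 0, q0 = 0, dd = bzero\<rparr>"
definition P2sh :: "('a::zero, 'x::zero, 'b::zero) cx" where
  "P2sh = \<lparr>p1 = 0, q1 = 1, p0 = 0, q0 = 0, dd = bzero\<rparr>"

text \<open>P_x for x in M_{s,t}(X): P2^t --x(.)--> P1^s.\<close>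
definition Px :: "nat \<Rightarrow> nat \<Rightarrow> (nat \<Rightarrow> nat \<Rightarrow> 'x) \<Rightarrow> ('a::zero, 'x::zero, 'b::zero) cx" where
  "Px s t x = \<lparr>p1 = 0, q1 = t, p0 = s, q0 = 0,
               dd = \<lparr>mA = (\<lambda>i j. 0), mX = x, mB = (\<lambda>i j. 0)\<rparr>\<rparr>"

end

theory Submission
  imports Defs
begin

(* Two facts about the local algebras A and B drive everything: a matrix over a local ring is
   equivalent to diag(I, N) with N radical, and a relation among minimal generators of X has only
   radical coefficients.  The first shows that every two-term complex is homotopy equivalent to one
   whose A- and B-blocks of the differential are radical.  If V is indecomposable, V (+) P2[1] is
   silting and V is not P1[1], this forces V = P_xi for a matrix xi over X whose columns generate
   X^c; the second fact, together with indecomposability, shrinks xi to one row of minimal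
   generators, so V = P_g.  The same facts make P_g indecomposable and P_g (+) P2[1] presilting,
   which gives (a) through the g-vectors (1, -r) and (0, -1), and (c) since P_g (+) P2[1] lies above
   P1[1] (+) P2[1].  Parts (b) and (d) are the duals for P_h. *)

section \<open>Local rings\<close>

abbreviation nonunit :: "'r::ring_1 \<Rightarrow> bool" where "nonunit x \<equiv> \<not> two_sided_unit x"

locale local_ring = fixes T :: "'r::ring_1 itself" assumes loc: "loc_ring TYPE('r)"
begin

lemma nonunit_add: "nonunit (x::'r) \<Longrightarrow> nonunit y \<Longrightarrow> nonunit (x + y)"
  using loc unfolding loc_ring_def by blast

lemma two_sided_unit_one[simp]: "two_sided_unit (1::'r)"
  unfolding two_sided_unit_def by auto

lemma nonunit_zero[simp]: "nonunit (0::'r)"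
  unfolding two_sided_unit_def by auto

lemma unit_idempotent_eq_one: assumes "two_sided_unit (e::'r)" "e * e = e" shows "e = 1"
proof -
  obtain z where z: "e * z = 1" "z * e = 1" using assms(1) unfolding two_sided_unit_def by blast
  have "z * (e * e) = z * e" using assms(2) by simp
  hence "(z * e) * e = z * e" by (simp add: mult.assoc)
  thus ?thesis using z by simp
qed

text \<open>\<open>y x\<close> is idempotent, and of an idempotent \<open>e\<close> and \<open>1 - e\<close> one is a unit.\<close>
lemma two_sided_unit_if_right_inverse: assumes "(x::'r) * y = 1" shows "two_sided_unit x"
proof (rule ccontr)
  assume nx: "nonunit x"
  define e where "e = y * x"
  have ee: "e * e = e" unfolding e_def by (metis assms mult.assoc mult_1_left)
  have ne: "nonunit e"
  proof
    assume "two_sided_unit e"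
    then have "e = 1" using ee by (rule unit_idempotent_eq_one)
    with assms nx show False unfolding e_def two_sided_unit_def by blast
  qed
  have ee2: "(1 - e) * (1 - e) = 1 - e" using ee by (simp add: algebra_simps)
  have n1e: "nonunit (1 - e)"
  proof
    assume "two_sided_unit (1 - e)"
    with ee2 have "1 - e = 1" using unit_idempotent_eq_one by blast
    hence "e = 0" by simp
    hence "x = 0" unfolding e_def by (metis assms mult.assoc mult_1_left mult_zero_right)
    with assms show False by simp
  qed
  from nonunit_add[OF ne n1e] show False by simp
qed

lemma two_sided_unit_if_left_inverse: assumes "(x::'r) * y = 1" shows "two_sided_unit y"
proof -
  obtain z where z: "x * z = 1" "z * x = 1" using two_sided_unit_if_right_inverse[OF assms] unfolding two_sided_unit_def by blast
  have "y = z" by (metis assms z(2) mult.assoc mult_1_left mult_1_right)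
  thus ?thesis using z unfolding two_sided_unit_def by blast
qed

lemma nonunit_mult_left: "nonunit (x::'r) \<Longrightarrow> nonunit (x * y)"
  unfolding two_sided_unit_def
  by (metis mult.assoc two_sided_unit_if_right_inverse two_sided_unit_def)

lemma nonunit_mult_right: "nonunit (y::'r) \<Longrightarrow> nonunit (x * y)"
  unfolding two_sided_unit_def
  by (metis mult.assoc two_sided_unit_if_left_inverse two_sided_unit_def)

lemma nonunit_uminus: "nonunit (x::'r) \<Longrightarrow> nonunit (- x)"
  by (metis mult_minus1 nonunit_mult_right)

lemma nonunit_diff: "nonunit (x::'r) \<Longrightarrow> nonunit y \<Longrightarrow> nonunit (x - y)"
  using nonunit_add nonunit_uminus by (metis diff_conv_add_uminus)

lemma nonunit_sum: "(\<And>k. k \<in> S \<Longrightarrow> nonunit (f k :: 'r)) \<Longrightarrow> nonunit (sum f S)"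
proof (induction S rule: infinite_finite_induct)
  case (insert x F)
  then show ?case using nonunit_add[of "f x" "sum f F"] by simp
qed auto

lemma idempotent_zero_or_one: assumes ee: "(e::'r) * e = e" shows "e = 0 \<or> e = 1"
proof (cases "two_sided_unit e")
  case True then show ?thesis using unit_idempotent_eq_one ee by blast
next
  case False
  have "(1 - e) * (1 - e) = 1 - e" using ee by (simp add: algebra_simps)
  moreover have "two_sided_unit (1 - e)" using nonunit_add[OF False, of "1 - e"] by auto
  ultimately have "1 - e = 1" using unit_idempotent_eq_one by blast
  thus ?thesis by simp
qed

definition unit_inv :: "'r \<Rightarrow> 'r" where "unit_inv x = (SOME y. x * y = 1 \<and> y * x = 1)"

lemma unit_inv_inverse: "two_sided_unit x \<Longrightarrow> x * unit_inv x = 1 \<and> unit_inv x * x = 1"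
  unfolding unit_inv_def two_sided_unit_def by (rule someI_ex)
end

section \<open>Matrices over a ring\<close>

lemma sum_lessThan_add: "(\<Sum>k<(a::nat)+b. f k) = (\<Sum>k<a. f k) + (\<Sum>k<b. f (a+k))"
  by (induction b) (simp_all add: add.assoc)

lemma sum_lessThan_split: "(a::nat) \<le> n \<Longrightarrow> (\<Sum>k<n. f k) = (\<Sum>k<a. f k) + (\<Sum>k<n-a. f (a+k))"
  using sum_lessThan_add[of f a "n-a"] by (simp add: le_add_diff_inverse)

lemma if01_mult[simp]: "(if P then 1 else 0) * (x::'r::semiring_1) = (if P then x else 0)" by simp
lemma mult_if01[simp]: "(x::'r::semiring_1) * (if P then 1 else 0) = (if P then x else 0)" by simp

lemma sum_delta_shift: "(\<Sum>k<(n::nat). if i = k + c then f k else 0) = (if c \<le> i \<and> i < n + c then f (i - c) else (0::'a::comm_monoid_add))"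
proof -
  have e: "(i = k + c) = (k = i - c \<and> c \<le> i)" for k by arith
  have "(\<Sum>k<n. if i = k + c then f k else 0) = (\<Sum>k<n. if k = i - c then (if c \<le> i then f k else 0) else 0)"
    unfolding e by (rule sum.cong) auto
  also have "\<dots> = (if c \<le> i \<and> i < n + c then f (i - c) else 0)" by (subst sum.delta, simp, auto)
  finally show ?thesis .
qed

definition skip_idx :: "nat \<Rightarrow> nat \<Rightarrow> nat" where "skip_idx i k = (if k < i then k else Suc k)"

lemma sum_remove_skip_idx:
  assumes "i < n"
  shows "(\<Sum>k<n. f k) = f i + (\<Sum>k<n - 1. f (skip_idx i k))"
proof -
  have img: "skip_idx i ` {..<n - 1} = {..<n} - {i}"
  proof
    show "skip_idx i ` {..<n - 1} \<subseteq> {..<n} - {i}" using assms by (auto simp: skip_idx_def)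
    show "{..<n} - {i} \<subseteq> skip_idx i ` {..<n - 1}"
    proof
      fix k assume k: "k \<in> {..<n} - {i}"
      show "k \<in> skip_idx i ` {..<n - 1}"
      proof (cases "k < i")
        case True then show ?thesis using k assms by (intro image_eqI[of _ _ k]) (auto simp: skip_idx_def)
      next
        case False then show ?thesis using k assms by (intro image_eqI[of _ _ "k - 1"]) (auto simp: skip_idx_def)
      qed
    qed
  qed
  have inj: "inj_on (skip_idx i) {..<n - 1}" unfolding inj_on_def skip_idx_def by auto
  have "(\<Sum>k<n. f k) = f i + (\<Sum>k\<in>{..<n} - {i}. f k)"
    using assms by (subst sum.remove[of _ i]) auto
  also have "(\<Sum>k\<in>{..<n} - {i}. f k) = (\<Sum>k<n - 1. f (skip_idx i k))"
    unfolding img[symmetric] by (subst sum.reindex[OF inj]) simp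
  finally show ?thesis .
qed

lemma sum_if_lt: "(r::nat) \<le> b \<Longrightarrow> (\<Sum>l<b. if l < r then f l else 0) = (\<Sum>l<r. f l)"
  by (subst sum_lessThan_split[of r b]) auto

definition mm :: "nat \<Rightarrow> (nat \<Rightarrow> nat \<Rightarrow> 'r::semiring_0) \<Rightarrow> (nat \<Rightarrow> nat \<Rightarrow> 'r) \<Rightarrow> nat \<Rightarrow> nat \<Rightarrow> 'r" where
  "mm n M N = (\<lambda>i j. \<Sum>k<n. M i k * N k j)"

definition mI :: "nat \<Rightarrow> nat \<Rightarrow> 'r::{zero,one}" where
  "mI = (\<lambda>i j. if i = j then 1 else 0)"

definition eqm :: "nat \<Rightarrow> nat \<Rightarrow> (nat \<Rightarrow> nat \<Rightarrow> 'r) \<Rightarrow> (nat \<Rightarrow> nat \<Rightarrow> 'r) \<Rightarrow> bool" where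
  "eqm m n M N \<longleftrightarrow> (\<forall>i<m. \<forall>j<n. M i j = N i j)"

definition invp :: "nat \<Rightarrow> (nat \<Rightarrow> nat \<Rightarrow> 'r::semiring_1) \<Rightarrow> (nat \<Rightarrow> nat \<Rightarrow> 'r) \<Rightarrow> bool" where
  "invp n P P' \<longleftrightarrow> eqm n n (mm n P P') mI \<and> eqm n n (mm n P' P) mI"

lemma mm_assoc: "mm n (mm m A B) C = mm m A (mm n B C)"
  unfolding mm_def
  by (auto simp: sum_distrib_left sum_distrib_right mult.assoc intro!: ext sum.swap)

lemma mm_I_left: "i < m \<Longrightarrow> mm m mI M i j = (M i j :: 'r::semiring_1)"
  unfolding mm_def mI_def by simp

lemma mm_I_right: "j < n \<Longrightarrow> mm n M mI i j = (M i j :: 'r::semiring_1)"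
  unfolding mm_def mI_def by simp

lemma eqm_refl[simp]: "eqm m n M M" unfolding eqm_def by simp
lemma eqm_sym: "eqm m n M N \<Longrightarrow> eqm m n N M" unfolding eqm_def by simp
lemma eqm_trans: "eqm m n M N \<Longrightarrow> eqm m n N K \<Longrightarrow> eqm m n M K" unfolding eqm_def by simp

lemma mm_cong: "eqm m k A A' \<Longrightarrow> eqm k n B B' \<Longrightarrow> eqm m n (mm k A B) (mm k A' B')"
  unfolding eqm_def mm_def by simp

lemma mm_cong_pt: "(\<And>k. k < n \<Longrightarrow> A i k = A' i k) \<Longrightarrow> (\<And>k. k < n \<Longrightarrow> B k j = B' k j)
   \<Longrightarrow> mm n A B i j = mm n A' B' i j"
  unfolding mm_def by simp

lemma eqm_I_left: "eqm m n (mm m mI M) (M::_\<Rightarrow>_\<Rightarrow>'r::semiring_1)"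
  unfolding eqm_def by (simp add: mm_I_left)
lemma eqm_I_right: "eqm m n (mm n M mI) (M::_\<Rightarrow>_\<Rightarrow>'r::semiring_1)"
  unfolding eqm_def by (simp add: mm_I_right)

lemma eqm_mm_left_mI: "eqm m m A mI \<Longrightarrow> eqm m n (mm m A M) (M::_\<Rightarrow>_\<Rightarrow>'r::semiring_1)"
  by (rule eqm_trans[OF mm_cong[OF _ eqm_refl] eqm_I_left])
lemma eqm_mm_right_mI: "eqm n n A mI \<Longrightarrow> eqm m n (mm n M A) (M::_\<Rightarrow>_\<Rightarrow>'r::semiring_1)"
  by (rule eqm_trans[OF mm_cong[OF eqm_refl] eqm_I_right])

lemma mm_add_left: "mm n (\<lambda>i j. A i j + B i j) C = (\<lambda>i j. mm n A C i j + mm n B C i j)"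
  unfolding mm_def by (simp add: distrib_right sum.distrib)
lemma mm_add_right: "mm n A (\<lambda>i j. B i j + C i j) = (\<lambda>i j. mm n A B i j + mm n A C i j)"
  unfolding mm_def by (simp add: distrib_left sum.distrib)
lemma mm_diff_left: "mm n (\<lambda>i j. A i j - B i j) C = (\<lambda>i j. mm n A C i j - mm n B C i j :: 'r::ring)"
  unfolding mm_def by (simp add: left_diff_distrib sum_subtractf)
lemma mm_diff_right: "mm n A (\<lambda>i j. B i j - C i j) = (\<lambda>i j. mm n A B i j - mm n A C i j :: 'r::ring)"
  unfolding mm_def by (simp add: right_diff_distrib sum_subtractf)

lemma invp_sym: "invp n P P' \<Longrightarrow> invp n P' P" unfolding invp_def by simp

lemma invp_I: "invp n mI (mI :: _ \<Rightarrow> _ \<Rightarrow> 'r::semiring_1)"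
  unfolding invp_def eqm_def by (simp add: mm_I_left)

lemma invp_mm: assumes "invp n P P'" "invp n Q Q'"
  shows "invp n (mm n P Q) (mm n Q' (P'::_\<Rightarrow>_\<Rightarrow>'r::semiring_1))"
proof -
  have 1: "eqm n n (mm n (mm n P Q) (mm n Q' P')) mI"
  proof -
    have "mm n (mm n P Q) (mm n Q' P') = mm n P (mm n (mm n Q Q') P')" by (simp add: mm_assoc)
    moreover have "eqm n n (mm n P (mm n (mm n Q Q') P')) (mm n P (mm n mI P'))"
      using assms unfolding invp_def by (intro mm_cong mm_cong eqm_refl) auto
    moreover have "eqm n n (mm n P (mm n mI P')) (mm n P P')"
      by (intro mm_cong eqm_refl eqm_I_left)
    ultimately show ?thesis using assms unfolding invp_def by (metis eqm_trans)
  qed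
  have 2: "eqm n n (mm n (mm n Q' P') (mm n P Q)) mI"
  proof -
    have "mm n (mm n Q' P') (mm n P Q) = mm n Q' (mm n (mm n P' P) Q)" by (simp add: mm_assoc)
    moreover have "eqm n n (mm n Q' (mm n (mm n P' P) Q)) (mm n Q' (mm n mI Q))"
      using assms unfolding invp_def by (intro mm_cong mm_cong eqm_refl) auto
    moreover have "eqm n n (mm n Q' (mm n mI Q)) (mm n Q' Q)"
      by (intro mm_cong eqm_refl eqm_I_left)
    ultimately show ?thesis using assms unfolding invp_def by (metis eqm_trans)
  qed
  show ?thesis using 1 2 unfolding invp_def by simp
qed

text \<open>\<open>border A\<close> is the block matrix \<open>diag(1, A)\<close>.\<close>
definition border :: "(nat \<Rightarrow> nat \<Rightarrow> 'r::{zero,one}) \<Rightarrow> nat \<Rightarrow> nat \<Rightarrow> 'r" where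
  "border A = (\<lambda>i j. if i = 0 then (if j = 0 then 1 else 0) else if j = 0 then 0 else A (i - 1) (j - 1))"

lemma mm_border: "mm (Suc n) (border A) (border B) = border (mm n A (B::_\<Rightarrow>_\<Rightarrow>'r::semiring_1))"
  unfolding mm_def by (rule ext, rule ext, subst sum.lessThan_Suc_shift) (simp add: border_def)

lemma eqm_border: "eqm m n A B \<Longrightarrow> eqm (Suc m) (Suc n) (border A) (border B)"
  unfolding eqm_def border_def by auto

lemma border_mI: "border mI = (mI :: _ \<Rightarrow> _ \<Rightarrow> 'r::{zero,one})"
  unfolding border_def mI_def by (auto intro!: ext)

lemma invp_border: "invp n P P' \<Longrightarrow> invp (Suc n) (border P) (border (P'::_\<Rightarrow>_\<Rightarrow>'r::semiring_1))"
  unfolding invp_def by (metis mm_border eqm_border border_mI)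

definition swap_idx :: "nat \<Rightarrow> nat \<Rightarrow> nat \<Rightarrow> nat" where
  "swap_idx a b i = (if i = a then b else if i = b then a else i)"

lemma swap_idx_swap_idx[simp]: "swap_idx a b (swap_idx a b i) = i" unfolding swap_idx_def by auto
lemma swap_idx_less: "a < n \<Longrightarrow> b < n \<Longrightarrow> i < n \<Longrightarrow> swap_idx a b i < n" unfolding swap_idx_def by auto
lemma swap_idx_eq_iff: "(j = swap_idx a b k) = (k = swap_idx a b j)" unfolding swap_idx_def by auto

definition swap_mat :: "nat \<Rightarrow> nat \<Rightarrow> nat \<Rightarrow> nat \<Rightarrow> 'r::{zero,one}" where
  "swap_mat a b = (\<lambda>i k. if k = swap_idx a b i then 1 else 0)"

lemma swap_mat_left: "a < m \<Longrightarrow> b < m \<Longrightarrow> i < m \<Longrightarrow> mm m (swap_mat a b) M i j = (M (swap_idx a b i) j :: 'r::semiring_1)"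
  unfolding mm_def swap_mat_def by (simp add: swap_idx_less)

lemma swap_mat_right: "a < n \<Longrightarrow> b < n \<Longrightarrow> j < n \<Longrightarrow> mm n M (swap_mat a b) i j = (M i (swap_idx a b j) :: 'r::semiring_1)"
proof -
  assume as: "a < n" "b < n" "j < n"
  have "mm n M (swap_mat a b) i j = (\<Sum>k<n. M i k * (if k = swap_idx a b j then 1 else 0))"
    unfolding mm_def swap_mat_def by (intro sum.cong refl) (metis swap_idx_eq_iff)
  also have "\<dots> = M i (swap_idx a b j)" using as by (simp add: swap_idx_less)
  finally show ?thesis .
qed

lemma invp_swap_mat: "a < n \<Longrightarrow> b < n \<Longrightarrow> invp n (swap_mat a b) (swap_mat a b :: _ \<Rightarrow> _ \<Rightarrow> 'r::semiring_1)"
  unfolding invp_def eqm_def by (simp add: swap_mat_left swap_idx_less) (simp add: swap_mat_def mI_def)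

section \<open>Matrices over a local ring\<close>

context local_ring begin

lemma pivot_elimination:
  fixes M :: "nat \<Rightarrow> nat \<Rightarrow> 'r"
  assumes u: "two_sided_unit (M 0 0)"
    and schur: "\<And>i j. M' i j = M (Suc i) (Suc j) - M (Suc i) 0 * unit_inv (M 0 0) * M 0 (Suc j)"
  shows "\<exists>L L' R R'. invp (Suc m) L L' \<and> invp (Suc n) R R' \<and>
    eqm (Suc m) (Suc n) (mm (Suc n) (mm (Suc m) L M) R) (border M')"
proof -
  define w where "w = unit_inv (M 0 0)"
  have wu: "w * M 0 0 = 1" "M 0 0 * w = 1" using unit_inv_inverse[OF u] unfolding w_def by auto
  define L :: "nat \<Rightarrow> nat \<Rightarrow> 'r" where "L = (\<lambda>i j. if i = 0 then (if j = 0 then w else 0)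
      else if j = 0 then - (M i 0 * w) else mI i j)"
  define L' :: "nat \<Rightarrow> nat \<Rightarrow> 'r" where "L' = (\<lambda>i j. if i = 0 then (if j = 0 then M 0 0 else 0)
      else if j = 0 then M i 0 else mI i j)"
  define R :: "nat \<Rightarrow> nat \<Rightarrow> 'r" where "R = (\<lambda>i j. if i = 0 then (if j = 0 then 1 else - (w * M 0 j))
      else mI i j)"
  define R' :: "nat \<Rightarrow> nat \<Rightarrow> 'r" where "R' = (\<lambda>i j. if i = 0 then (if j = 0 then 1 else w * M 0 j)
      else mI i j)"
  have "invp (Suc m) L L'"
  proof -
    have "mm (Suc m) L L' i j = mI i j" if "i < Suc m" "j < Suc m" for i j
      unfolding mm_def
      apply (subst sum.lessThan_Suc_shift)
      using that wu by (cases i; cases j) (simp_all add: L_def L'_def mI_def mult.assoc)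
    moreover have "mm (Suc m) L' L i j = mI i j" if "i < Suc m" "j < Suc m" for i j
      unfolding mm_def
      apply (subst sum.lessThan_Suc_shift)
      using that wu by (cases i; cases j) (simp_all add: L_def L'_def mI_def mult.assoc sum_negf)
    ultimately show ?thesis unfolding invp_def eqm_def by auto
  qed
  moreover have "invp (Suc n) R R'"
  proof -
    have "mm (Suc n) R R' i j = mI i j \<and> mm (Suc n) R' R i j = mI i j"
      if "i < Suc n" "j < Suc n" for i j
      unfolding mm_def
      apply (subst (1 2) sum.lessThan_Suc_shift)
      using that by (cases i; cases j) (simp_all add: R_def R'_def mI_def)
    then show ?thesis unfolding invp_def eqm_def by auto
  qed
  moreover have "eqm (Suc m) (Suc n) (mm (Suc n) (mm (Suc m) L M) R) (border M')"
  proof -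
    define LM where "LM = mm (Suc m) L M"
    have LM0: "LM 0 j = w * M 0 j" for j
      unfolding LM_def mm_def by (subst sum.lessThan_Suc_shift) (simp add: L_def mI_def)
    have LMS: "LM (Suc i) j = M (Suc i) j - M (Suc i) 0 * w * M 0 j" if "i < m" for i j
      unfolding LM_def mm_def using that by (subst sum.lessThan_Suc_shift) (simp add: L_def mI_def)
    have "mm (Suc n) LM R i j = border M' i j"
      if "i < Suc m" "j < Suc n" for i j
      unfolding mm_def
      apply (subst sum.lessThan_Suc_shift)
      using that wu by (cases i; cases j) (simp_all add: LM0 LMS R_def mI_def border_def mult.assoc schur w_def)
    then show ?thesis unfolding LM_def eqm_def by auto
  qed
  ultimately show ?thesis by blast
qed

lemma local_matrix_normal_form:
  fixes M :: "nat \<Rightarrow> nat \<Rightarrow> 'r"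
  shows "\<exists>k P P' Q Q'. k \<le> m \<and> k \<le> n \<and> invp m P P' \<and> invp n Q Q' \<and>
    (\<forall>i<m. \<forall>j<n. (i < k \<or> j < k \<longrightarrow> mm n (mm m P M) Q i j = mI i j) \<and>
                   (k \<le> i \<and> k \<le> j \<longrightarrow> nonunit (mm n (mm m P M) Q i j)))"
proof (induction m arbitrary: n M)
  case 0
  show ?case by (rule exI[of _ 0], intro exI[of _ mI]) (simp add: invp_I)
next
  case (Suc m)
  show ?case
  proof (cases "\<forall>i<Suc m. \<forall>j<n. nonunit (M i j)")
    case True
    show ?thesis by (rule exI[of _ 0], intro exI[of _ mI]) (simp add: invp_I mm_I_left mm_I_right True)
  next
    case False
    then obtain i0 j0 where ij0: "i0 < Suc m" "j0 < n" "two_sided_unit (M i0 j0)" by blast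
    then obtain n' where n: "n = Suc n'" by (cases n) auto
    define Srow :: "nat \<Rightarrow> nat \<Rightarrow> 'r" where "Srow = swap_mat 0 i0"
    define Scol :: "nat \<Rightarrow> nat \<Rightarrow> 'r" where "Scol = swap_mat 0 j0"
    define M1 where "M1 = mm n (mm (Suc m) Srow M) Scol"
    have M1: "M1 i j = M (swap_idx 0 i0 i) (swap_idx 0 j0 j)" if "i < Suc m" "j < n" for i j
      unfolding M1_def Srow_def Scol_def using that ij0 by (simp add: swap_mat_left swap_mat_right)
    have u: "two_sided_unit (M1 0 0)" using M1[of 0 0] ij0 n by (simp add: swap_idx_def)
    define M' where "M' = (\<lambda>i j. M1 (Suc i) (Suc j) - M1 (Suc i) 0 * unit_inv (M1 0 0) * M1 0 (Suc j))"
    have "\<exists>L L' R R'. invp (Suc m) L L' \<and> invp (Suc n') R R' \<and>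
        eqm (Suc m) (Suc n') (mm (Suc n') (mm (Suc m) L M1) R) (border M')"
      by (rule pivot_elimination[of M1, OF u]) (simp add: M'_def)
    then obtain L L' R R' where LR: "invp (Suc m) L L'" "invp (Suc n') R R'"
      "eqm (Suc m) (Suc n') (mm (Suc n') (mm (Suc m) L M1) R) (border M')"
      by blast
    obtain k' P1 P1' Q1 Q1' where IH: "k' \<le> m" "k' \<le> n'" "invp m P1 P1'" "invp n' Q1 Q1'"
      "\<forall>i<m. \<forall>j<n'. (i < k' \<or> j < k' \<longrightarrow> mm n' (mm m P1 M') Q1 i j = mI i j) \<and>
                   (k' \<le> i \<and> k' \<le> j \<longrightarrow> nonunit (mm n' (mm m P1 M') Q1 i j))"
      using Suc.IH[of n' M'] by blast
    define P where "P = mm (Suc m) (border P1) (mm (Suc m) L Srow)"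
    define P' where "P' = mm (Suc m) (mm (Suc m) Srow L') (border P1')"
    define Q where "Q = mm n (mm n Scol R) (border Q1)"
    define Q' where "Q' = mm n (border Q1') (mm n R' Scol)"
    have iSrow: "invp (Suc m) Srow Srow" and iScol: "invp (Suc n') Scol Scol"
      unfolding Srow_def Scol_def using ij0 n by (auto intro: invp_swap_mat)
    have iP: "invp (Suc m) P P'" unfolding P_def P'_def by (intro invp_mm invp_border IH(3) LR(1) iSrow)
    have iQ: "invp n Q Q'" unfolding Q_def Q'_def n by (intro invp_mm invp_border IH(4) LR(2) iScol)
    define X where "X = mm n' (mm m P1 M') Q1"
    have "mm n (mm (Suc m) P M) Q = mm n (mm (Suc m) (border P1) (mm (Suc n') (mm (Suc m) L M1) R)) (border Q1)"
      unfolding P_def Q_def M1_def n by (simp only: mm_assoc)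
    moreover have "eqm (Suc m) n \<dots> (mm n (mm (Suc m) (border P1) (border M')) (border Q1))"
      unfolding n by (rule mm_cong[OF mm_cong[OF eqm_refl LR(3)] eqm_refl])
    moreover have "mm n (mm (Suc m) (border P1) (border M')) (border Q1) = border X"
      unfolding X_def n by (simp only: mm_border)
    ultimately have RX: "eqm (Suc m) n (mm n (mm (Suc m) P M) Q) (border X)" by simp
    have "\<forall>i<Suc m. \<forall>j<n. (i < Suc k' \<or> j < Suc k' \<longrightarrow> mm n (mm (Suc m) P M) Q i j = mI i j) \<and>
        (Suc k' \<le> i \<and> Suc k' \<le> j \<longrightarrow> nonunit (mm n (mm (Suc m) P M) Q i j))"
    proof (intro allI impI)
      fix i j assume ij: "i < Suc m" "j < n"
      have e: "mm n (mm (Suc m) P M) Q i j = border X i j" using RX ij unfolding eqm_def by auto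
      show "(i < Suc k' \<or> j < Suc k' \<longrightarrow> mm n (mm (Suc m) P M) Q i j = mI i j) \<and>
        (Suc k' \<le> i \<and> Suc k' \<le> j \<longrightarrow> nonunit (mm n (mm (Suc m) P M) Q i j))"
      proof (cases "i = 0 \<or> j = 0")
        case True
        then show ?thesis unfolding e by (auto simp: border_def mI_def)
      next
        case False
        then obtain i' j' where ij': "i = Suc i'" "j = Suc j'" by (metis not0_implies_Suc)
        then have "i' < m" "j' < n'" using ij n by auto
        then show ?thesis using IH(5) e unfolding ij' X_def by (auto simp: border_def mI_def)
      qed
    qed
    then show ?thesis using IH(1,2) n iP iQ
      by (intro exI[of _ "Suc k'"] exI[of _ P] exI[of _ P'] exI[of _ Q] exI[of _ Q'] conjI) auto
  qed
qed

lemma nonunit_mm_row: "(\<And>k. k < n \<Longrightarrow> nonunit (M i k :: 'r)) \<Longrightarrow> nonunit (mm n M N i j)"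
  unfolding mm_def by (intro nonunit_sum nonunit_mult_left) auto

lemma nonunit_mm_col: "(\<And>k. k < n \<Longrightarrow> nonunit (N k j :: 'r)) \<Longrightarrow> nonunit (mm n M N i j)"
  unfolding mm_def by (intro nonunit_sum nonunit_mult_right) auto

lemma invp_cong: "eqm n n Q Q2 \<Longrightarrow> invp n Q2 W \<Longrightarrow> invp n Q (W :: _ \<Rightarrow> _ \<Rightarrow> 'r)"
  unfolding invp_def by (meson eqm_trans mm_cong eqm_refl)

lemma invp_no_nonunit_row:
  assumes "invp n A (B :: _ \<Rightarrow> _ \<Rightarrow> 'r)" "i < n" "\<And>k. k < n \<Longrightarrow> nonunit (A i k)"
  shows False
proof -
  have "mm n A B i i = 1" using assms(1,2) unfolding invp_def eqm_def mI_def by auto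
  moreover have "nonunit (mm n A B i i)" using assms(3) by (rule nonunit_mm_row)
  ultimately show False by simp
qed

lemma invp_no_nonunit_col:
  assumes "invp n A (B :: _ \<Rightarrow> _ \<Rightarrow> 'r)" "j < n" "\<And>k. k < n \<Longrightarrow> nonunit (B k j)"
  shows False
proof -
  have "mm n A B j j = 1" using assms(1,2) unfolding invp_def eqm_def mI_def by auto
  moreover have "nonunit (mm n A B j j)" using assms(3) by (rule nonunit_mm_col)
  ultimately show False by simp
qed

lemma invp_if_nonunit_diff_mI:
  assumes "\<And>i j. i < n \<Longrightarrow> j < n \<Longrightarrow> nonunit (Q i j - mI i j :: 'r)"
  shows "\<exists>W. invp n Q W"
proof -
  obtain k P P' R R' where G: "k \<le> n" "invp n P P'" "invp n R R'"
    "\<forall>i<n. \<forall>j<n. (i < k \<or> j < k \<longrightarrow> mm n (mm n P Q) R i j = mI i j) \<and>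
                   (k \<le> i \<and> k \<le> j \<longrightarrow> nonunit (mm n (mm n P Q) R i j))"
    using local_matrix_normal_form[of n n Q] by blast
  define N where "N = (\<lambda>i j. Q i j - mI i j)"
  have QN: "Q = (\<lambda>i j. mI i j + N i j)" unfolding N_def by simp
  have kn: "k = n"
  proof (rule ccontr)
    assume "k \<noteq> n"
    with G(1) have k: "k < n" "n - 1 < n" "k \<le> n - 1" by auto
    have rowJ: "nonunit (mm n (mm n P mI) R (n - 1) j)" if "j < n" for j
    proof -
      have "mm n (mm n P Q) R (n-1) j = mm n (mm n P mI) R (n-1) j + mm n (mm n P N) R (n-1) j"
        unfolding QN by (simp add: mm_add_right mm_add_left)
      moreover have "nonunit (mm n (mm n P Q) R (n-1) j)"
      proof (cases "j < k")
        case True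
        then have "mm n (mm n P Q) R (n-1) j = mI (n-1) j" using G(4) k that by auto
        then show ?thesis using True k by (simp add: mI_def)
      next
        case False then show ?thesis using G(4) k that by auto
      qed
      moreover have "nonunit (mm n (mm n P N) R (n-1) j)"
        by (intro nonunit_mm_row nonunit_mm_col) (use assms in \<open>auto simp: N_def\<close>)
      ultimately show ?thesis by (metis add_diff_cancel_right' nonunit_diff)
    qed
    have "invp n (mm n (mm n P mI) R) (mm n R' P')"
      using invp_mm[OF G(2) G(3)] by (rule invp_cong[rotated]) (intro mm_cong eqm_refl eqm_I_right)
    from invp_no_nonunit_row[OF this k(2) rowJ] show False .
  qed
  have PQR: "eqm n n (mm n (mm n P Q) R) mI" using G(4) kn unfolding eqm_def by auto
  have "eqm n n Q (mm n P' R')"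
  proof -
    have "eqm n n Q (mm n (mm n mI Q) mI)" by (meson eqm_I_left eqm_I_right eqm_sym eqm_trans mm_cong eqm_refl)
    moreover have "eqm n n (mm n (mm n mI Q) mI) (mm n (mm n (mm n P' P) Q) (mm n R R'))"
      using G(2,3) unfolding invp_def by (intro mm_cong eqm_refl) (auto simp: eqm_sym)
    moreover have "mm n (mm n (mm n P' P) Q) (mm n R R') = mm n P' (mm n (mm n (mm n P Q) R) R')"
      by (simp only: mm_assoc)
    moreover have "eqm n n (mm n P' (mm n (mm n (mm n P Q) R) R')) (mm n P' (mm n mI R'))"
      by (intro mm_cong eqm_refl PQR)
    moreover have "eqm n n (mm n P' (mm n mI R')) (mm n P' R')"
      by (intro mm_cong eqm_refl eqm_I_left)
    ultimately show ?thesis by (metis eqm_trans)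
  qed
  moreover have "invp n (mm n P' R') (mm n R P)"
    using invp_mm[OF invp_sym[OF G(2)] invp_sym[OF G(3)]] .
  ultimately show ?thesis using invp_cong by blast
qed

lemma idempotent_nonunit_matrix_zero:
  assumes J: "\<And>i j. i < n \<Longrightarrow> j < n \<Longrightarrow> nonunit (E i j :: 'r)"
    and idem: "eqm n n (mm n E E) E"
  shows "eqm n n E (\<lambda>i j. 0)"
proof -
  define F where "F = (\<lambda>i j. mI i j - E i j)"
  have "\<exists>W. invp n F W"
    using J by (intro invp_if_nonunit_diff_mI) (simp add: F_def nonunit_uminus)
  then obtain W where W: "invp n F W" by blast
  have EF: "eqm n n (mm n E F) (\<lambda>i j. 0)"
    using idem unfolding F_def eqm_def by (simp add: mm_diff_right mm_I_right)
  have "eqm n n E (mm n (mm n E F) W)"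
  proof -
    have "eqm n n E (mm n E mI)" by (simp add: eqm_I_right eqm_sym)
    moreover have "eqm n n (mm n E mI) (mm n E (mm n F W))"
      using W unfolding invp_def by (intro mm_cong eqm_refl) (auto simp: eqm_sym)
    ultimately show ?thesis by (simp add: mm_assoc eqm_trans)
  qed
  moreover have "eqm n n (mm n (mm n E F) W) (mm n (\<lambda>i j. 0) W)"
    by (intro mm_cong EF eqm_refl)
  moreover have "mm n (\<lambda>i j. 0) W = (\<lambda>i j. 0)" unfolding mm_def by simp
  ultimately show ?thesis by (metis eqm_trans)
qed

lemma idempotent_complement:
  assumes "eqm n n (mm n E E) (E :: _ \<Rightarrow> _ \<Rightarrow> 'r)"
  shows "eqm n n (mm n (\<lambda>i j. mI i j - E i j) (\<lambda>i j. mI i j - E i j)) (\<lambda>i j. mI i j - E i j)"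
  using assms unfolding eqm_def by (simp add: mm_diff_left mm_diff_right mm_I_left mm_I_right)

lemma normal_form_rank_rows:
  assumes k: "k \<le> m"
    and R: "\<forall>i<m. \<forall>j<n. (i < k \<or> j < k \<longrightarrow> R i j = mI i j) \<and> (k \<le> i \<and> k \<le> j \<longrightarrow> nonunit (R i j :: 'r))"
    and inv: "invp m (mm n R X) Y"
  shows "k = m"
proof (rule ccontr)
  assume "k \<noteq> m"
  with k have last: "m - 1 < m" "k \<le> m - 1" by auto
  have "nonunit (R (m - 1) j)" if "j < n" for j
    using R last that by (cases "j < k") (auto simp: mI_def)
  then have "nonunit (mm n R X (m - 1) l)" for l by (rule nonunit_mm_row)
  with invp_no_nonunit_row[OF inv last(1)] show False by blast
qed

lemma normal_form_rank_cols:
  assumes k: "k \<le> n"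
    and R: "\<forall>i<m. \<forall>j<n. (i < k \<or> j < k \<longrightarrow> R i j = mI i j) \<and> (k \<le> i \<and> k \<le> j \<longrightarrow> nonunit (R i j :: 'r))"
    and inv: "invp n (mm m X R) Y"
  shows "k = n"
proof (rule ccontr)
  assume "k \<noteq> n"
  with k have last: "n - 1 < n" "k \<le> n - 1" by auto
  have "nonunit (R i (n - 1))" if "i < m" for i
    using R last that by (cases "i < k") (auto simp: mI_def)
  then have "nonunit (mm m X R l (n - 1))" for l by (rule nonunit_mm_col)
  with invp_no_nonunit_col[OF invp_sym[OF inv] last(1)] show False by blast
qed

lemma right_invertible_normal_form:
  fixes F :: "nat \<Rightarrow> nat \<Rightarrow> 'r"
  assumes inv: "invp r (mm b F F') W"
  shows "\<exists>Q Q' P P'. r \<le> b \<and> invp b Q Q' \<and> invp r P P' \<and>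
    (\<forall>i<r. \<forall>j<b. mm b F Q i j = (if j < r then P' i j else 0))"
proof -
  obtain k P P' Q Q' where G: "k \<le> r" "k \<le> b" "invp r P P'" "invp b Q Q'"
    "\<forall>i<r. \<forall>j<b. (i < k \<or> j < k \<longrightarrow> mm b (mm r P F) Q i j = mI i j) \<and>
         (k \<le> i \<and> k \<le> j \<longrightarrow> nonunit (mm b (mm r P F) Q i j))"
    using local_matrix_normal_form[of r b F] by blast
  define R where "R = mm b (mm r P F) Q"
  have QQ': "eqm b r (mm b Q (mm b Q' Y)) Y" for Y
    using eqm_mm_left_mI[of b "mm b Q Q'" r Y] G(4) by (simp add: invp_def mm_assoc)
  have "eqm r r (mm b R (mm r (mm b Q' F') P')) (mm r (mm r P (mm b F F')) P')"
    unfolding R_def mm_assoc by (rule mm_cong[OF eqm_refl mm_cong[OF eqm_refl QQ']])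
  then have "invp r (mm b R (mm r (mm b Q' F') P')) (mm r P (mm r W P'))"
    using invp_cong invp_mm[OF invp_mm[OF G(3) inv] invp_sym[OF G(3)]] by blast
  then have kr: "k = r" using normal_form_rank_rows[OF G(1)] G(5) unfolding R_def by blast
  have "mm b F Q i j = (if j < r then P' i j else 0)" if "i < r" "j < b" for i j
  proof -
    have "eqm r b (mm r (mm r P' P) (mm b F Q)) (mm b F Q)"
      by (rule eqm_mm_left_mI) (use G(3) in \<open>simp add: invp_def\<close>)
    then have "eqm r b (mm b F Q) (mm r P' R)" unfolding R_def by (simp add: mm_assoc eqm_sym)
    then have "mm b F Q i j = mm r P' R i j" using that unfolding eqm_def by blast
    also have "\<dots> = mm r P' mI i j" by (rule mm_cong_pt) (use that G(5) kr in \<open>auto simp: R_def\<close>)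
    finally show ?thesis by (simp add: mm_def mI_def)
  qed
  then show ?thesis using G(2-4) kr by blast
qed

lemma left_invertible_normal_form:
  fixes F :: "nat \<Rightarrow> nat \<Rightarrow> 'r"
  assumes inv: "invp l (mm c F' F) W"
  shows "\<exists>P P' Q Q'. l \<le> c \<and> invp c P P' \<and> invp l Q Q' \<and>
    (\<forall>i<c. \<forall>j<l. mm c P F i j = (if i < l then Q' i j else 0))"
proof -
  obtain k P P' Q Q' where G: "k \<le> c" "k \<le> l" "invp c P P'" "invp l Q Q'"
    "\<forall>i<c. \<forall>j<l. (i < k \<or> j < k \<longrightarrow> mm l (mm c P F) Q i j = mI i j) \<and>
         (k \<le> i \<and> k \<le> j \<longrightarrow> nonunit (mm l (mm c P F) Q i j))"
    using local_matrix_normal_form[of c l F] by blast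
  define R where "R = mm l (mm c P F) Q"
  have P'P: "eqm c l (mm c P' (mm c P Y)) Y" for Y
    using eqm_mm_left_mI[of c "mm c P' P" l Y] G(3) by (simp add: invp_def mm_assoc)
  have "eqm l l (mm c (mm c (mm l Q' F') P') R) (mm l Q' (mm l (mm c F' F) Q))"
    unfolding R_def mm_assoc by (rule mm_cong[OF eqm_refl mm_cong[OF eqm_refl P'P]])
  then have "invp l (mm c (mm c (mm l Q' F') P') R) (mm l (mm l Q' W) Q)"
    using invp_cong invp_sym[OF invp_mm[OF invp_mm[OF invp_sym[OF G(4)] invp_sym[OF inv]] G(4)]] by blast
  then have kl: "k = l" using normal_form_rank_cols[OF G(2)] G(5) unfolding R_def by blast
  have "mm c P F i j = (if i < l then Q' i j else 0)" if "i < c" "j < l" for i j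
  proof -
    have "eqm c l (mm l (mm c P F) (mm l Q Q')) (mm c P F)"
      by (rule eqm_mm_right_mI) (use G(4) in \<open>simp add: invp_def\<close>)
    then have "eqm c l (mm c P F) (mm l R Q')" unfolding R_def by (simp add: mm_assoc eqm_sym)
    then have "mm c P F i j = mm l R Q' i j" using that unfolding eqm_def by blast
    also have "\<dots> = mm l mI Q' i j" by (rule mm_cong_pt) (use that G(5) kl in \<open>auto simp: R_def\<close>)
    finally show ?thesis by (simp add: mm_def mI_def)
  qed
  then show ?thesis using G(1,3,4) kl by blast
qed


lemma right_inverse_top_block_invp:
  fixes F :: "nat \<Rightarrow> nat \<Rightarrow> 'r"
  assumes W: "invp r (mm b F F') W" and rb: "r \<le> b" and Q: "invp b Q Q'" and P: "invp r P P'"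
    and FQ: "\<forall>i<r. \<forall>j<b. mm b F Q i j = (if j < r then P' i j else 0)"
  shows "invp r (mm b Q' F') (mm r W P')"
proof -
  define S where "S = mm b Q' F'"
  have QQ'F': "eqm b r (mm b (mm b Q Q') F') F'"
    by (rule eqm_mm_left_mI) (use Q in \<open>simp add: invp_def\<close>)
  have "eqm r r (mm b (mm b F Q) S) (mm b F F')"
    unfolding S_def mm_assoc by (rule mm_cong[OF eqm_refl QQ'F'[unfolded mm_assoc]])
  moreover have "mm b (mm b F Q) S i l = mm r P' S i l" if "i < r" for i l
  proof -
    have "mm b (mm b F Q) S i l = (\<Sum>m<b. if m < r then P' i m * S m l else 0)"
      unfolding mm_def[of b "mm b F Q"] by (rule sum.cong) (use FQ that in auto)
    then show ?thesis using rb by (simp add: sum_if_lt mm_def)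
  qed
  ultimately have P'S: "eqm r r (mm r P' S) (mm b F F')" unfolding eqm_def by auto
  have "eqm r r (mm r P (mm r P' S)) S"
    using eqm_mm_left_mI[of r "mm r P P'" r S] P by (simp add: invp_def mm_assoc)
  moreover have "eqm r r (mm r P (mm r P' S)) (mm r P (mm b F F'))" by (rule mm_cong[OF eqm_refl P'S])
  ultimately have "eqm r r S (mm r P (mm b F F'))" by (meson eqm_sym eqm_trans)
  then show ?thesis unfolding S_def using invp_cong invp_mm[OF P W] by blast
qed

lemma left_inverse_left_block_invp:
  fixes F :: "nat \<Rightarrow> nat \<Rightarrow> 'r"
  assumes W: "invp l (mm c F' F) W" and lc: "l \<le> c" and P: "invp c P P'" and Q: "invp l Q Q'"
    and PF: "\<forall>i<c. \<forall>j<l. mm c P F i j = (if i < l then Q' i j else 0)"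
  shows "invp l (mm c F' P') (mm l Q' W)"
proof -
  define S where "S = mm c F' P'"
  have F'P'P: "eqm l c (mm c F' (mm c P' P)) F'"
    by (rule eqm_mm_right_mI) (use P in \<open>simp add: invp_def\<close>)
  have "eqm l l (mm c S (mm c P F)) (mm c F' F)"
    unfolding S_def mm_assoc[symmetric] by (rule mm_cong[OF F'P'P[folded mm_assoc] eqm_refl])
  moreover have "mm c S (mm c P F) i j = mm l S Q' i j" if "j < l" for i j
  proof -
    have "mm c S (mm c P F) i j = (\<Sum>m<c. if m < l then S i m * Q' m j else 0)"
      unfolding mm_def[of c S] by (rule sum.cong) (use PF that in auto)
    then show ?thesis using lc by (simp add: sum_if_lt mm_def)
  qed
  ultimately have SQ': "eqm l l (mm l S Q') (mm c F' F)" unfolding eqm_def by auto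
  have "eqm l l (mm l (mm l S Q') Q) S"
    using eqm_mm_right_mI[of l "mm l Q' Q" l S] Q by (simp add: invp_def mm_assoc)
  moreover have "eqm l l (mm l (mm l S Q') Q) (mm l (mm c F' F) Q)" by (rule mm_cong[OF SQ' eqm_refl])
  ultimately have "eqm l l S (mm l (mm c F' F) Q)" by (meson eqm_sym eqm_trans)
  then show ?thesis unfolding S_def using invp_cong invp_mm[OF W Q] by blast
qed

end

lemma Px_simps[simp]: "p1 (Px s t x) = 0" "q1 (Px s t x) = t" "p0 (Px s t x) = s" "q0 (Px s t x) = 0"
  "mX (dd (Px s t x)) = x"
  unfolding Px_def by simp_all

lemma P_simps[simp]: "p1 P1sh = 1" "q1 P1sh = 0" "p0 P1sh = 0" "q0 P1sh = 0"
  "p1 P2sh = 0" "q1 P2sh = 1" "p0 P2sh = 0" "q0 P2sh = 0"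
  "p1 P1cx = 0" "q1 P1cx = 0" "p0 P1cx = 1" "q0 P1cx = 0"
  "p1 P2cx = 0" "q1 P2cx = 0" "p0 P2cx = 0" "q0 P2cx = 1"
  "p1 zcx = 0" "q1 zcx = 0" "p0 zcx = 0" "q0 zcx = 0"
  unfolding P1sh_def P2sh_def P1cx_def P2cx_def zcx_def by simp_all

lemma dsum_simps[simp]: "p1 (dsum T U) = p1 T + p1 U" "q1 (dsum T U) = q1 T + q1 U"
  "p0 (dsum T U) = p0 T + p0 U" "q0 (dsum T U) = q0 T + q0 U"
  unfolding dsum_def by simp_all

lemma rgen_num_attained: "\<exists>g n. right_gen ra g n \<Longrightarrow> \<exists>g. right_gen ra g (rgen_num ra)"
  using LeastI_ex[of "\<lambda>n. \<exists>g. right_gen ra g n"] unfolding rgen_num_def by blast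

lemma lgen_num_attained: "\<exists>h n. left_gen la h n \<Longrightarrow> \<exists>h. left_gen la h (lgen_num la)"
  using LeastI_ex[of "\<lambda>n. \<exists>h. left_gen la h n"] unfolding lgen_num_def by blast

section \<open>Two-term complexes over the triangular algebra\<close>

locale local_bimodule = A: local_ring TA + B: local_ring TB
  for TA :: "'a::ring_1 itself" and TB :: "'b::ring_1 itself" +
  fixes la :: "'a \<Rightarrow> 'x::ab_group_add \<Rightarrow> 'x" and ra :: "'x \<Rightarrow> 'b \<Rightarrow> 'x"
  assumes bm: "bimod la ra"
begin

lemma la_mult: "la (a * a') x = la a (la a' x)" using bm unfolding bimod_def by metis
lemma la_one[simp]: "la 1 x = x" using bm unfolding bimod_def by metis
lemma la_add_l: "la (a + a') x = la a x + la a' x" using bm unfolding bimod_def by metis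
lemma la_add_r: "la a (x + y) = la a x + la a y" using bm unfolding bimod_def by metis
lemma ra_mult: "ra x (b * b') = ra (ra x b) b'" using bm unfolding bimod_def by metis
lemma ra_one[simp]: "ra x 1 = x" using bm unfolding bimod_def by metis
lemma ra_add_r: "ra x (b + b') = ra x b + ra x b'" using bm unfolding bimod_def by metis
lemma ra_add_l: "ra (x + y) b = ra x b + ra y b" using bm unfolding bimod_def by metis
lemma la_ra: "la a (ra x b) = ra (la a x) b" using bm unfolding bimod_def by metis

lemma la_zero_l[simp]: "la 0 x = 0" using la_add_l[of 0 0 x] by simp
lemma la_zero_r[simp]: "la a 0 = 0" using la_add_r[of a 0 0] by simp
lemma ra_zero_l[simp]: "ra 0 b = 0" using ra_add_l[of 0 0 b] by simp
lemma ra_zero_r[simp]: "ra x 0 = 0" using ra_add_r[of x 0 0] by simp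
lemma la_neg_l: "la (- a) x = - la a x"
  by (metis la_add_l[of a "-a" x] add.right_inverse add_eq_0_iff la_zero_l la_zero_r ra_zero_l ra_zero_r)
lemma la_neg_r: "la a (- x) = - la a x"
  by (metis la_add_r[of a x "-x"] add.right_inverse add_eq_0_iff la_zero_l la_zero_r ra_zero_l ra_zero_r)
lemma ra_neg_l: "ra (- x) b = - ra x b"
  by (metis ra_add_l[of x "-x" b] add.right_inverse add_eq_0_iff la_zero_l la_zero_r ra_zero_l ra_zero_r)
lemma ra_neg_r: "ra x (- b) = - ra x b"
  by (metis ra_add_r[of x b "-b"] add.right_inverse add_eq_0_iff la_zero_l la_zero_r ra_zero_l ra_zero_r)
lemma la_diff_l: "la (a - a') x = la a x - la a' x" by (simp only: diff_conv_add_uminus la_add_l la_neg_l)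
lemma la_diff_r: "la a (x - y) = la a x - la a y" by (simp only: diff_conv_add_uminus la_add_r la_neg_r)
lemma ra_diff_l: "ra (x - y) b = ra x b - ra y b" by (simp only: diff_conv_add_uminus ra_add_l ra_neg_l)
lemma ra_diff_r: "ra x (b - b') = ra x b - ra x b'" by (simp only: diff_conv_add_uminus ra_add_r ra_neg_r)

lemma la_sum_l: "la (sum f S) x = (\<Sum>k\<in>S. la (f k) x)"
  using sum_comp_morphism[of "\<lambda>a. la a x" f S] by (simp add: la_add_l o_def)
lemma la_sum_r: "la a (sum f S) = (\<Sum>k\<in>S. la a (f k))"
  using sum_comp_morphism[of "\<lambda>x. la a x" f S] by (simp add: la_add_r o_def)
lemma ra_sum_l: "ra (sum f S) b = (\<Sum>k\<in>S. ra (f k) b)"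
  using sum_comp_morphism[of "\<lambda>x. ra x b" f S] by (simp add: ra_add_l o_def)
lemma ra_sum_r: "ra x (sum f S) = (\<Sum>k\<in>S. ra x (f k))"
  using sum_comp_morphism[of "\<lambda>b. ra x b" f S] by (simp add: ra_add_r o_def)

lemma la_if01[simp]: "la (if P then 1 else 0) x = (if P then x else 0)" by simp
lemma ra_if01[simp]: "ra x (if P then 1 else 0) = (if P then x else 0)" by simp

lemmas lra_simps = la_add_l la_add_r ra_add_l ra_add_r la_sum_l la_sum_r ra_sum_l ra_sum_r
  la_mult ra_mult la_ra la_diff_l la_diff_r ra_diff_l ra_diff_r la_neg_l la_neg_r ra_neg_l ra_neg_r

abbreviation comp where "comp \<equiv> bcomp la ra"

lemma comp_simps:
  "mA (comp p q N M) i j = (\<Sum>k<p. mA N i k * mA M k j)"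
  "mX (comp p q N M) i j = (\<Sum>k<p. la (mA N i k) (mX M k j)) + (\<Sum>k<q. ra (mX N i k) (mB M k j))"
  "mB (comp p q N M) i j = (\<Sum>k<q. mB N i k * mB M k j)"
  unfolding bcomp_def by simp_all

lemma bm_eqI: "mA M = mA N \<Longrightarrow> mX M = mX N \<Longrightarrow> mB M = mB N \<Longrightarrow> (M::('a,'x,'b) bm) = N"
  by (cases M, cases N) simp

lemma comp_assoc: "comp pm qm (comp pn qn N M) L = comp pn qn N (comp pm qm M L)"
proof (rule bm_eqI; rule ext; rule ext)
  fix i j
  show "mA (comp pm qm (comp pn qn N M) L) i j = mA (comp pn qn N (comp pm qm M L)) i j"
    unfolding comp_simps by (simp add: sum_distrib_left sum_distrib_right mult.assoc) (rule sum.swap)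
  show "mB (comp pm qm (comp pn qn N M) L) i j = mB (comp pn qn N (comp pm qm M L)) i j"
    unfolding comp_simps by (simp add: sum_distrib_left sum_distrib_right mult.assoc) (rule sum.swap)
  have 1: "(\<Sum>k<pm. \<Sum>l<pn. la (mA N i l) (la (mA M l k) (mX L k j))) =
           (\<Sum>l<pn. \<Sum>k<pm. la (mA N i l) (la (mA M l k) (mX L k j)))" by (rule sum.swap)
  have 2: "(\<Sum>k<qm. \<Sum>l<pn. ra (la (mA N i l) (mX M l k)) (mB L k j)) =
           (\<Sum>l<pn. \<Sum>k<qm. ra (la (mA N i l) (mX M l k)) (mB L k j))" by (rule sum.swap)
  have 3: "(\<Sum>k<qm. \<Sum>l<qn. ra (ra (mX N i l) (mB M l k)) (mB L k j)) =
           (\<Sum>l<qn. \<Sum>k<qm. ra (ra (mX N i l) (mB M l k)) (mB L k j))" by (rule sum.swap)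
  show "mX (comp pm qm (comp pn qn N M) L) i j = mX (comp pn qn N (comp pm qm M L)) i j"
    unfolding comp_simps by (simp add: lra_simps sum.distrib 1 2 3 add.assoc)
qed

lemma comp_badd_l: "comp p q (badd N N') M = badd (comp p q N M) (comp p q N' M)"
  by (rule bm_eqI; rule ext; rule ext) (simp_all add: comp_simps badd_def lra_simps distrib_right sum.distrib ac_simps)
lemma comp_badd_r: "comp p q N (badd M M') = badd (comp p q N M) (comp p q N M')"
  by (rule bm_eqI; rule ext; rule ext) (simp_all add: comp_simps badd_def lra_simps distrib_left sum.distrib ac_simps)
lemma comp_bsub_l: "comp p q (bsub N N') M = bsub (comp p q N M) (comp p q N' M)"
  by (rule bm_eqI; rule ext; rule ext) (simp_all add: comp_simps bsub_def lra_simps left_diff_distrib sum_subtractf)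
lemma comp_bsub_r: "comp p q N (bsub M M') = bsub (comp p q N M) (comp p q N M')"
  by (rule bm_eqI; rule ext; rule ext) (simp_all add: comp_simps bsub_def lra_simps right_diff_distrib sum_subtractf)
lemma comp_bzero_l[simp]: "comp p q bzero M = bzero"
  by (rule bm_eqI; rule ext; rule ext) (simp_all add: comp_simps bzero_def)
lemma comp_bzero_r[simp]: "comp p q N bzero = bzero"
  by (rule bm_eqI; rule ext; rule ext) (simp_all add: comp_simps bzero_def)

lemma beq_refl[simp]: "beq ps qs pt qt M M" unfolding beq_def by simp
lemma beq_sym: "beq ps qs pt qt M N \<Longrightarrow> beq ps qs pt qt N M" unfolding beq_def by simp
lemma beq_trans: "beq ps qs pt qt M N \<Longrightarrow> beq ps qs pt qt N K \<Longrightarrow> beq ps qs pt qt M K"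
  unfolding beq_def by simp
lemma beq_badd: "beq ps qs pt qt M M' \<Longrightarrow> beq ps qs pt qt N N' \<Longrightarrow> beq ps qs pt qt (badd M N) (badd M' N')"
  unfolding beq_def badd_def by simp
lemma beq_bsub: "beq ps qs pt qt M M' \<Longrightarrow> beq ps qs pt qt N N' \<Longrightarrow> beq ps qs pt qt (bsub M N) (bsub M' N')"
  unfolding beq_def bsub_def by simp

lemma comp_cong: "beq pm qm pt qt N N' \<Longrightarrow> beq ps qs pm qm M M' \<Longrightarrow>
   beq ps qs pt qt (comp pm qm N M) (comp pm qm N' M')"
  unfolding beq_def by (simp add: comp_simps)

lemma comp_bid_l: "beq ps qs pt qt (comp pt qt bid M) M"
  unfolding beq_def by (simp add: comp_simps bid_def)
lemma comp_bid_r: "beq ps qs pt qt (comp ps qs M bid) M"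
  unfolding beq_def by (simp add: comp_simps bid_def)

lemma bsub_self: "bsub M M = bzero" unfolding bsub_def bzero_def by simp
lemma badd_bzero: "badd M bzero = M" unfolding badd_def bzero_def by simp
lemma bzero_badd: "badd bzero M = M" unfolding badd_def bzero_def by simp

section \<open>Homotopy calculus\<close>

declare beq_trans[trans]

abbreviation chain where "chain \<equiv> chain_map la ra"
abbreviation nhtp where "nhtp \<equiv> nullhtp la ra"

lemma cong_l: "beq ps qs pm qm M M' \<Longrightarrow> beq ps qs pt qt (comp pm qm N M) (comp pm qm N M')"
  by (rule comp_cong[OF beq_refl])
lemma cong_r: "beq pm qm pt qt N N' \<Longrightarrow> beq ps qs pt qt (comp pm qm N M) (comp pm qm N' M)"
  by (rule comp_cong[OF _ beq_refl])

lemma chain_comp: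
  assumes f: "chain T U f1 f0" and g: "chain U W g1 g0"
  shows "chain T W (comp (p1 U) (q1 U) g1 f1) (comp (p0 U) (q0 U) g0 f0)"
proof -
  have f': "beq (p1 T) (q1 T) (p0 U) (q0 U) (comp (p0 T) (q0 T) f0 (dd T)) (comp (p1 U) (q1 U) (dd U) f1)"
    using f unfolding chain_map_def .
  have g': "beq (p1 U) (q1 U) (p0 W) (q0 W) (comp (p0 U) (q0 U) g0 (dd U)) (comp (p1 W) (q1 W) (dd W) g1)"
    using g unfolding chain_map_def .
  have "comp (p0 T) (q0 T) (comp (p0 U) (q0 U) g0 f0) (dd T) = comp (p0 U) (q0 U) g0 (comp (p0 T) (q0 T) f0 (dd T))"
    by (rule comp_assoc)
  also have "beq (p1 T) (q1 T) (p0 W) (q0 W) \<dots> (comp (p0 U) (q0 U) g0 (comp (p1 U) (q1 U) (dd U) f1))"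
    by (rule cong_l[OF f'])
  also have "comp (p0 U) (q0 U) g0 (comp (p1 U) (q1 U) (dd U) f1) = comp (p1 U) (q1 U) (comp (p0 U) (q0 U) g0 (dd U)) f1"
    by (rule comp_assoc[symmetric])
  also have "beq (p1 T) (q1 T) (p0 W) (q0 W) \<dots> (comp (p1 U) (q1 U) (comp (p1 W) (q1 W) (dd W) g1) f1)"
    by (rule cong_r[OF g'])
  also have "comp (p1 U) (q1 U) (comp (p1 W) (q1 W) (dd W) g1) f1 = comp (p1 W) (q1 W) (dd W) (comp (p1 U) (q1 U) g1 f1)"
    by (rule comp_assoc)
  finally show ?thesis unfolding chain_map_def .
qed

lemma nhtpE:
  assumes "nhtp T U f1 f0"
  obtains h where "beq (p1 T) (q1 T) (p1 U) (q1 U) f1 (comp (p0 T) (q0 T) h (dd T))"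
    "beq (p0 T) (q0 T) (p0 U) (q0 U) f0 (comp (p1 U) (q1 U) (dd U) h)"
  using assms unfolding nullhtp_def by blast

lemma nhtpI:
  "beq (p1 T) (q1 T) (p1 U) (q1 U) f1 (comp (p0 T) (q0 T) h (dd T)) \<Longrightarrow>
   beq (p0 T) (q0 T) (p0 U) (q0 U) f0 (comp (p1 U) (q1 U) (dd U) h) \<Longrightarrow> nhtp T U f1 f0"
  unfolding nullhtp_def by blast

lemma nhtp_comp_l:
  assumes n: "nhtp T U f1 f0" and g: "chain U W g1 g0"
  shows "nhtp T W (comp (p1 U) (q1 U) g1 f1) (comp (p0 U) (q0 U) g0 f0)"
proof -
  obtain h where h: "beq (p1 T) (q1 T) (p1 U) (q1 U) f1 (comp (p0 T) (q0 T) h (dd T))"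
    "beq (p0 T) (q0 T) (p0 U) (q0 U) f0 (comp (p1 U) (q1 U) (dd U) h)"
    using n by (rule nhtpE)
  have g': "beq (p1 U) (q1 U) (p0 W) (q0 W) (comp (p0 U) (q0 U) g0 (dd U)) (comp (p1 W) (q1 W) (dd W) g1)"
    using g unfolding chain_map_def .
  have "beq (p1 T) (q1 T) (p1 W) (q1 W) (comp (p1 U) (q1 U) g1 f1) (comp (p1 U) (q1 U) g1 (comp (p0 T) (q0 T) h (dd T)))"
    by (rule cong_l[OF h(1)])
  also have "comp (p1 U) (q1 U) g1 (comp (p0 T) (q0 T) h (dd T)) = comp (p0 T) (q0 T) (comp (p1 U) (q1 U) g1 h) (dd T)"
    by (rule comp_assoc[symmetric])
  finally have 1: "beq (p1 T) (q1 T) (p1 W) (q1 W) (comp (p1 U) (q1 U) g1 f1) (comp (p0 T) (q0 T) (comp (p1 U) (q1 U) g1 h) (dd T))" .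
  have "beq (p0 T) (q0 T) (p0 W) (q0 W) (comp (p0 U) (q0 U) g0 f0) (comp (p0 U) (q0 U) g0 (comp (p1 U) (q1 U) (dd U) h))"
    by (rule cong_l[OF h(2)])
  also have "comp (p0 U) (q0 U) g0 (comp (p1 U) (q1 U) (dd U) h) = comp (p1 U) (q1 U) (comp (p0 U) (q0 U) g0 (dd U)) h"
    by (rule comp_assoc[symmetric])
  also have "beq (p0 T) (q0 T) (p0 W) (q0 W) \<dots> (comp (p1 U) (q1 U) (comp (p1 W) (q1 W) (dd W) g1) h)"
    by (rule cong_r[OF g'])
  also have "comp (p1 U) (q1 U) (comp (p1 W) (q1 W) (dd W) g1) h = comp (p1 W) (q1 W) (dd W) (comp (p1 U) (q1 U) g1 h)"
    by (rule comp_assoc)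
  finally have 2: "beq (p0 T) (q0 T) (p0 W) (q0 W) (comp (p0 U) (q0 U) g0 f0) (comp (p1 W) (q1 W) (dd W) (comp (p1 U) (q1 U) g1 h))" .
  show ?thesis using 1 2 by (rule nhtpI)
qed

lemma nhtp_comp_r:
  assumes n: "nhtp T U f1 f0" and e: "chain S T e1 e0"
  shows "nhtp S U (comp (p1 T) (q1 T) f1 e1) (comp (p0 T) (q0 T) f0 e0)"
proof -
  obtain h where h: "beq (p1 T) (q1 T) (p1 U) (q1 U) f1 (comp (p0 T) (q0 T) h (dd T))"
    "beq (p0 T) (q0 T) (p0 U) (q0 U) f0 (comp (p1 U) (q1 U) (dd U) h)"
    using n by (rule nhtpE)
  have e': "beq (p1 S) (q1 S) (p0 T) (q0 T) (comp (p1 T) (q1 T) (dd T) e1) (comp (p0 S) (q0 S) e0 (dd S))"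
    using e unfolding chain_map_def by (rule beq_sym)
  have "beq (p1 S) (q1 S) (p1 U) (q1 U) (comp (p1 T) (q1 T) f1 e1) (comp (p1 T) (q1 T) (comp (p0 T) (q0 T) h (dd T)) e1)"
    by (rule cong_r[OF h(1)])
  also have "comp (p1 T) (q1 T) (comp (p0 T) (q0 T) h (dd T)) e1 = comp (p0 T) (q0 T) h (comp (p1 T) (q1 T) (dd T) e1)"
    by (rule comp_assoc)
  also have "beq (p1 S) (q1 S) (p1 U) (q1 U) \<dots> (comp (p0 T) (q0 T) h (comp (p0 S) (q0 S) e0 (dd S)))"
    by (rule cong_l[OF e'])
  also have "comp (p0 T) (q0 T) h (comp (p0 S) (q0 S) e0 (dd S)) = comp (p0 S) (q0 S) (comp (p0 T) (q0 T) h e0) (dd S)"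
    by (rule comp_assoc[symmetric])
  finally have 1: "beq (p1 S) (q1 S) (p1 U) (q1 U) (comp (p1 T) (q1 T) f1 e1) (comp (p0 S) (q0 S) (comp (p0 T) (q0 T) h e0) (dd S))" .
  have "beq (p0 S) (q0 S) (p0 U) (q0 U) (comp (p0 T) (q0 T) f0 e0) (comp (p0 T) (q0 T) (comp (p1 U) (q1 U) (dd U) h) e0)"
    by (rule cong_r[OF h(2)])
  also have "comp (p0 T) (q0 T) (comp (p1 U) (q1 U) (dd U) h) e0 = comp (p1 U) (q1 U) (dd U) (comp (p0 T) (q0 T) h e0)"
    by (rule comp_assoc)
  finally have 2: "beq (p0 S) (q0 S) (p0 U) (q0 U) (comp (p0 T) (q0 T) f0 e0) (comp (p1 U) (q1 U) (dd U) (comp (p0 T) (q0 T) h e0))" .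
  show ?thesis using 1 2 by (rule nhtpI)
qed

lemma nhtp_beq:
  assumes "nhtp T U f1 f0" "beq (p1 T) (q1 T) (p1 U) (q1 U) f1 g1" "beq (p0 T) (q0 T) (p0 U) (q0 U) f0 g0"
  shows "nhtp T U g1 g0"
proof -
  obtain h where h: "beq (p1 T) (q1 T) (p1 U) (q1 U) f1 (comp (p0 T) (q0 T) h (dd T))"
    "beq (p0 T) (q0 T) (p0 U) (q0 U) f0 (comp (p1 U) (q1 U) (dd U) h)"
    using assms(1) by (rule nhtpE)
  show ?thesis
    by (rule nhtpI[of _ _ _ h]) (rule beq_trans[OF beq_sym[OF assms(2)] h(1)], rule beq_trans[OF beq_sym[OF assms(3)] h(2)])
qed

lemma nhtp_badd:
  assumes "nhtp T U f1 f0" "nhtp T U g1 g0"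
  shows "nhtp T U (badd f1 g1) (badd f0 g0)"
proof -
  obtain h where h: "beq (p1 T) (q1 T) (p1 U) (q1 U) f1 (comp (p0 T) (q0 T) h (dd T))"
    "beq (p0 T) (q0 T) (p0 U) (q0 U) f0 (comp (p1 U) (q1 U) (dd U) h)"
    using assms(1) by (rule nhtpE)
  obtain h' where h': "beq (p1 T) (q1 T) (p1 U) (q1 U) g1 (comp (p0 T) (q0 T) h' (dd T))"
    "beq (p0 T) (q0 T) (p0 U) (q0 U) g0 (comp (p1 U) (q1 U) (dd U) h')"
    using assms(2) by (rule nhtpE)
  show ?thesis
    by (rule nhtpI[of _ _ _ "badd h h'"]) (simp_all only: comp_badd_l comp_badd_r beq_badd h h')
qed

lemma nhtp_bsub:
  assumes "nhtp T U f1 f0" "nhtp T U g1 g0"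
  shows "nhtp T U (bsub f1 g1) (bsub f0 g0)"
proof -
  obtain h where h: "beq (p1 T) (q1 T) (p1 U) (q1 U) f1 (comp (p0 T) (q0 T) h (dd T))"
    "beq (p0 T) (q0 T) (p0 U) (q0 U) f0 (comp (p1 U) (q1 U) (dd U) h)"
    using assms(1) by (rule nhtpE)
  obtain h' where h': "beq (p1 T) (q1 T) (p1 U) (q1 U) g1 (comp (p0 T) (q0 T) h' (dd T))"
    "beq (p0 T) (q0 T) (p0 U) (q0 U) g0 (comp (p1 U) (q1 U) (dd U) h')"
    using assms(2) by (rule nhtpE)
  show ?thesis
    by (rule nhtpI[of _ _ _ "bsub h h'"]) (simp_all only: comp_bsub_l comp_bsub_r beq_bsub h h')
qed

lemma nhtp_zero: "nhtp T U bzero bzero"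
  by (rule nhtpI[of _ _ _ bzero]) simp_all

lemma chain_bid: "chain T T bid bid"
  unfolding chain_map_def by (rule beq_trans[OF comp_bid_l beq_sym[OF comp_bid_r]])

lemma hiso_refl: "hiso la ra T T"
proof -
  have z: "nhtp T T (bsub bid bid) (bsub bid bid)" by (simp only: bsub_self nhtp_zero)
  have "nhtp T T (bsub (comp (p1 T) (q1 T) bid bid) bid) (bsub (comp (p0 T) (q0 T) bid bid) bid)"
    by (rule nhtp_beq[OF z]) (rule beq_bsub[OF beq_sym[OF comp_bid_l] beq_refl])+
  then show ?thesis unfolding hiso_def using chain_bid by blast
qed

lemma hiso_sym: "hiso la ra T U \<Longrightarrow> hiso la ra U T"
  unfolding hiso_def by blast

abbreviation c1 :: "('a,'x,'b) cx \<Rightarrow> ('a,'x,'b) bm \<Rightarrow> ('a,'x,'b) bm \<Rightarrow> ('a,'x,'b) bm" where "c1 T \<equiv> comp (p1 T) (q1 T)"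
abbreviation c0 :: "('a,'x,'b) cx \<Rightarrow> ('a,'x,'b) bm \<Rightarrow> ('a,'x,'b) bm \<Rightarrow> ('a,'x,'b) bm" where "c0 T \<equiv> comp (p0 T) (q0 T)"
abbreviation beq1 :: "('a,'x,'b) cx \<Rightarrow> ('a,'x,'b) cx \<Rightarrow> ('a,'x,'b) bm \<Rightarrow> ('a,'x,'b) bm \<Rightarrow> bool" where "beq1 T U \<equiv> beq (p1 T) (q1 T) (p1 U) (q1 U)"
abbreviation beq0 :: "('a,'x,'b) cx \<Rightarrow> ('a,'x,'b) cx \<Rightarrow> ('a,'x,'b) bm \<Rightarrow> ('a,'x,'b) bm \<Rightarrow> bool" where "beq0 T U \<equiv> beq (p0 T) (q0 T) (p0 U) (q0 U)"
abbreviation beqd :: "('a,'x,'b) cx \<Rightarrow> ('a,'x,'b) cx \<Rightarrow> ('a,'x,'b) bm \<Rightarrow> ('a,'x,'b) bm \<Rightarrow> bool" where "beqd T U \<equiv> beq (p1 T) (q1 T) (p0 U) (q0 U)"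

lemma bm_eta[simp]: "\<lparr>mA = mA M, mX = mX M, mB = mB M\<rparr> = M"
  by (cases M) simp

lemma bsub_split: "bsub A C = badd (bsub A B) (bsub B C)"
  unfolding bsub_def badd_def by simp

lemma badd_bsub_id: "M = badd (bsub M N) N"
  unfolding bsub_def badd_def by simp

lemma nhtp_sandwich:
  assumes X: "nhtp U U (bsub X1 bid) (bsub X0 bid)" and f: "chain T U f1 f0" and g: "chain U S g1 g0"
  shows "nhtp T S (bsub (c1 U g1 (c1 U X1 f1)) (c1 U g1 f1)) (bsub (c0 U g0 (c0 U X0 f0)) (c0 U g0 f0))"
proof -
  have "nhtp T S (c1 U g1 (c1 U (bsub X1 bid) f1)) (c0 U g0 (c0 U (bsub X0 bid) f0))"
    by (rule nhtp_comp_l[OF nhtp_comp_r[OF X f] g])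
  moreover have "beq1 T S (c1 U g1 (c1 U (bsub X1 bid) f1)) (bsub (c1 U g1 (c1 U X1 f1)) (c1 U g1 f1))"
    unfolding comp_bsub_l comp_bsub_r
    by (rule beq_bsub[OF beq_refl cong_l[OF comp_bid_l]])
  moreover have "beq0 T S (c0 U g0 (c0 U (bsub X0 bid) f0)) (bsub (c0 U g0 (c0 U X0 f0)) (c0 U g0 f0))"
    unfolding comp_bsub_l comp_bsub_r
    by (rule beq_bsub[OF beq_refl cong_l[OF comp_bid_l]])
  ultimately show ?thesis by (rule nhtp_beq)
qed

lemma hiso_trans:
  assumes "hiso la ra T U" "hiso la ra U W" shows "hiso la ra T W"
proof -
  obtain f1 f0 g1 g0 where A: "chain T U f1 f0" "chain U T g1 g0"
    "nhtp T T (bsub (c1 U g1 f1) bid) (bsub (c0 U g0 f0) bid)"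
    "nhtp U U (bsub (c1 T f1 g1) bid) (bsub (c0 T f0 g0) bid)"
    using assms(1) unfolding hiso_def by blast
  obtain f1' f0' g1' g0' where B: "chain U W f1' f0'" "chain W U g1' g0'"
    "nhtp U U (bsub (c1 W g1' f1') bid) (bsub (c0 W g0' f0') bid)"
    "nhtp W W (bsub (c1 U f1' g1') bid) (bsub (c0 U f0' g0') bid)"
    using assms(2) unfolding hiso_def by blast
  have comp_TW: "chain T W (c1 U f1' f1) (c0 U f0' f0)" by (rule chain_comp[OF A(1) B(1)])
  have comp_WT: "chain W T (c1 U g1 g1') (c0 U g0 g0')" by (rule chain_comp[OF B(2) A(2)])
  have e1: "c1 W (c1 U g1 g1') (c1 U f1' f1) = c1 U g1 (c1 U (c1 W g1' f1') f1)"
    by (simp only: comp_assoc)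
  have e0: "c0 W (c0 U g0 g0') (c0 U f0' f0) = c0 U g0 (c0 U (c0 W g0' f0') f0)"
    by (simp only: comp_assoc)
  have H1: "nhtp T T (bsub (c1 W (c1 U g1 g1') (c1 U f1' f1)) bid) (bsub (c0 W (c0 U g0 g0') (c0 U f0' f0)) bid)"
    unfolding e1 e0
    by (subst (1 2) bsub_split, rule nhtp_badd[OF nhtp_sandwich[OF B(3) A(1) A(2)] A(3)])
  have H2: "nhtp W W (bsub (c1 T (c1 U f1' f1) (c1 U g1 g1')) bid) (bsub (c0 T (c0 U f0' f0) (c0 U g0 g0')) bid)"
  proof -
    have x1: "c1 T (c1 U f1' f1) (c1 U g1 g1') = c1 U f1' (c1 U (c1 T f1 g1) g1')" by (simp only: comp_assoc)
    have x0: "c0 T (c0 U f0' f0) (c0 U g0 g0') = c0 U f0' (c0 U (c0 T f0 g0) g0')" by (simp only: comp_assoc)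
    show ?thesis unfolding x1 x0
      by (subst (1 2) bsub_split, rule nhtp_badd[OF nhtp_sandwich[OF A(4) B(2) B(1)] B(4)])
  qed
  show ?thesis unfolding hiso_def using comp_TW comp_WT H1 H2 by blast
qed

lemma hiso_of_inverse_chain_maps:
  assumes ch: "chain T U F E"
    and i1: "beq1 T T (c1 U F' F) bid" "beq1 U U (c1 T F F') bid"
    and i0: "beq0 T T (c0 U E' E) bid" "beq0 U U (c0 T E E') bid"
  shows "hiso la ra T U"
proof -
  have ch': "beqd T U (c0 T E (dd T)) (c1 U (dd U) F)" using ch unfolding chain_map_def .
  have "beqd U T (c0 U E' (dd U)) (c0 U E' (c1 U (dd U) (c1 T F F')))"
    by (rule cong_l, rule beq_trans[OF beq_sym[OF comp_bid_r]], rule cong_l[OF beq_sym[OF i1(2)]])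
  also have "c0 U E' (c1 U (dd U) (c1 T F F')) = c1 T (c0 U E' (c1 U (dd U) F)) F'"
    by (simp only: comp_assoc)
  also have "beqd U T \<dots> (c1 T (c0 U E' (c0 T E (dd T))) F')"
    by (rule cong_r, rule cong_l, rule beq_sym[OF ch'])
  also have "c1 T (c0 U E' (c0 T E (dd T))) F' = c1 T (c0 T (c0 U E' E) (dd T)) F'"
    by (simp only: comp_assoc)
  also have "beqd U T \<dots> (c1 T (c0 T bid (dd T)) F')"
    by (rule cong_r, rule cong_r, rule i0(1))
  also have "beqd U T \<dots> (c1 T (dd T) F')"
    by (rule cong_r, rule comp_bid_l)
  finally have ch2: "chain U T F' E'" unfolding chain_map_def .
  have z1: "nhtp T T (bsub bid bid) (bsub bid bid)" by (simp only: bsub_self nhtp_zero)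
  have n1: "nhtp T T (bsub (c1 U F' F) bid) (bsub (c0 U E' E) bid)"
    by (rule nhtp_beq[OF z1]) (rule beq_bsub[OF beq_sym beq_refl], fact)+
  have z2: "nhtp U U (bsub bid bid) (bsub bid bid)" by (simp only: bsub_self nhtp_zero)
  have n2: "nhtp U U (bsub (c1 T F F') bid) (bsub (c0 T E E') bid)"
    by (rule nhtp_beq[OF z2]) (rule beq_bsub[OF beq_sym beq_refl], fact)+
  show ?thesis unfolding hiso_def using ch ch2 n1 n2 by blast
qed

section \<open>Zero complexes and trivial homotopies\<close>

lemma comp_empty: "comp 0 0 N M = bzero"
  by (rule bm_eqI; rule ext; rule ext) (simp_all add: comp_simps bzero_def)

lemma hiso_zcx_iff: "hiso la ra T zcx \<longleftrightarrow> nhtp T T bid bid"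
proof
  assume "hiso la ra T zcx"
  then obtain f1 f0 g1 g0 where "nhtp T T (bsub (c1 zcx g1 f1) bid) (bsub (c0 zcx g0 f0) bid)"
    unfolding hiso_def by blast
  then have "nhtp T T (bsub bzero bid) (bsub bzero bid)" by (simp add: zcx_def comp_empty)
  from nhtp_bsub[OF nhtp_zero this] show "nhtp T T bid bid"
    by (simp add: bsub_def bzero_def)
next
  assume a: "nhtp T T bid bid"
  have c1: "chain T zcx bzero bzero" unfolding chain_map_def beq_def by (simp add: zcx_def)
  have c2: "chain zcx T bzero bzero" unfolding chain_map_def beq_def by (simp add: zcx_def)
  have n1: "nhtp T T (bsub (c1 zcx bzero bzero) bid) (bsub (c0 zcx bzero bzero) bid)"
    using nhtp_bsub[OF nhtp_zero a] by (simp add: zcx_def comp_empty)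
  have n2: "nhtp zcx zcx (bsub (c1 T bzero bzero) bid) (bsub (c0 T bzero bzero) bid)"
    unfolding nullhtp_def beq_def by (simp add: zcx_def)
  show "hiso la ra T zcx" unfolding hiso_def using c1 c2 n1 n2 by blast
qed

text \<open>The sizes force every composite \<open>h d\<close> and \<open>d h\<close> with a homotopy \<open>h\<close> to be empty, so the only
  null-homotopic endomorphism is zero.\<close>
definition htp_trivial :: "('a,'x,'b) cx \<Rightarrow> bool" where
  "htp_trivial T \<longleftrightarrow> (p1 T = 0 \<or> p0 T = 0) \<and> (q1 T = 0 \<or> q0 T = 0) \<and> (p1 T = 0 \<or> q0 T = 0)"

lemma htp_trivial_hd: "htp_trivial T \<Longrightarrow> beq1 T T (c0 T h (dd T)) bzero"
  unfolding htp_trivial_def beq_def by (auto simp: comp_simps bzero_def)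

lemma htp_trivial_dh: "htp_trivial T \<Longrightarrow> beq0 T T (c1 T (dd T) h) bzero"
  unfolding htp_trivial_def beq_def by (auto simp: comp_simps bzero_def)

lemma htp_trivial_nhtp: assumes "htp_trivial T" "nhtp T T f1 f0" shows "beq1 T T f1 bzero" "beq0 T T f0 bzero"
proof -
  obtain h where h: "beq1 T T f1 (c0 T h (dd T))" "beq0 T T f0 (c1 T (dd T) h)"
    using assms(2) by (rule nhtpE)
  show "beq1 T T f1 bzero" using h(1) htp_trivial_hd[OF assms(1)] by (rule beq_trans)
  show "beq0 T T f0 bzero" using h(2) htp_trivial_dh[OF assms(1)] by (rule beq_trans)
qed

lemma htp_trivial_zcx: assumes "htp_trivial T" "hiso la ra T zcx"
  shows "p1 T = 0" "q1 T = 0" "p0 T = 0" "q0 T = 0"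
proof -
  have n: "nhtp T T bid bid" using assms(2) hiso_zcx_iff by blast
  note a = htp_trivial_nhtp[OF assms(1) n]
  show "p1 T = 0"
  proof (rule ccontr)
    assume "p1 T \<noteq> 0" then have "mA (bid::('a,'x,'b) bm) 0 0 = mA (bzero::('a,'x,'b) bm) 0 0" using a(1) unfolding beq_def by auto
    thus False by (simp add: bid_def bzero_def)
  qed
  show "q1 T = 0"
  proof (rule ccontr)
    assume "q1 T \<noteq> 0" then have "mB (bid::('a,'x,'b) bm) 0 0 = mB (bzero::('a,'x,'b) bm) 0 0" using a(1) unfolding beq_def by auto
    thus False by (simp add: bid_def bzero_def)
  qed
  show "p0 T = 0"
  proof (rule ccontr)
    assume "p0 T \<noteq> 0" then have "mA (bid::('a,'x,'b) bm) 0 0 = mA (bzero::('a,'x,'b) bm) 0 0" using a(2) unfolding beq_def by auto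
    thus False by (simp add: bid_def bzero_def)
  qed
  show "q0 T = 0"
  proof (rule ccontr)
    assume "q0 T \<noteq> 0" then have "mB (bid::('a,'x,'b) bm) 0 0 = mB (bzero::('a,'x,'b) bm) 0 0" using a(2) unfolding beq_def by auto
    thus False by (simp add: bid_def bzero_def)
  qed
qed

section \<open>Vanishing of \<open>Hom(T, U[1])\<close>\<close>

definition null_hom1 where "null_hom1 T U \<phi> \<longleftrightarrow> (\<exists>a b. beqd T U \<phi> (badd (c1 U (dd U) a) (c0 T b (dd T))))"

lemma hom1_zero_iff_null_hom1: "hom1_zero la ra T U \<longleftrightarrow> (\<forall>\<phi>. null_hom1 T U \<phi>)"
  unfolding hom1_zero_def null_hom1_def ..

lemma null_hom1_beq: "null_hom1 T U \<phi> \<Longrightarrow> beqd T U \<phi> \<psi> \<Longrightarrow> null_hom1 T U \<psi>"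
  unfolding null_hom1_def by (meson beq_sym beq_trans)

lemma bsub_swap4: "bsub (badd A B) (badd C D) = badd (bsub A C) (bsub B D)"
  unfolding badd_def bsub_def by (simp add: algebra_simps)

lemma null_hom1_bsub: "null_hom1 T U \<phi> \<Longrightarrow> null_hom1 T U \<psi> \<Longrightarrow> null_hom1 T U (bsub \<phi> \<psi>)"
  unfolding null_hom1_def
proof (elim exE)
  fix a b a' b'
  assume 1: "beqd T U \<phi> (badd (c1 U (dd U) a) (c0 T b (dd T)))"
     and 2: "beqd T U \<psi> (badd (c1 U (dd U) a') (c0 T b' (dd T)))"
  have "beqd T U (bsub \<phi> \<psi>) (badd (c1 U (dd U) (bsub a a')) (c0 T (bsub b b') (dd T)))"
    unfolding comp_bsub_l comp_bsub_r bsub_swap4[symmetric] by (rule beq_bsub[OF 1 2])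
  thus "\<exists>a b. beqd T U (bsub \<phi> \<psi>) (badd (c1 U (dd U) a) (c0 T b (dd T)))" by blast
qed

lemma null_hom1_dd_left: "null_hom1 T U (c1 U (dd U) a)"
  unfolding null_hom1_def by (rule exI[of _ a], rule exI[of _ bzero]) (simp add: badd_bzero)

lemma null_hom1_dd_right: "null_hom1 T U (c0 T b (dd T))"
  unfolding null_hom1_def by (rule exI[of _ bzero], rule exI[of _ b]) (simp add: bzero_badd)

lemma null_hom1_cancel_left:
  assumes H: "beq0 U U (bsub M bid) (c1 U (dd U) H)" and Z: "null_hom1 T U (c0 U M \<phi>)"
  shows "null_hom1 T U \<phi>"
proof -
  have "c0 U M \<phi> = badd (c0 U (bsub M bid) \<phi>) (c0 U bid \<phi>)"
    by (subst badd_bsub_id[of M bid]) (simp only: comp_badd_l)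
  also have "beqd T U \<dots> (badd (c0 U (c1 U (dd U) H) \<phi>) \<phi>)"
    by (rule beq_badd[OF cong_r[OF H] comp_bid_l])
  also have "badd (c0 U (c1 U (dd U) H) \<phi>) \<phi> = badd (c1 U (dd U) (c0 U H \<phi>)) \<phi>"
    by (simp only: comp_assoc)
  finally have e: "beqd T U (c0 U M \<phi>) (badd (c1 U (dd U) (c0 U H \<phi>)) \<phi>)" .
  have "null_hom1 T U (bsub (c0 U M \<phi>) (c1 U (dd U) (c0 U H \<phi>)))" by (rule null_hom1_bsub[OF Z null_hom1_dd_left])
  moreover have "beqd T U (bsub (c0 U M \<phi>) (c1 U (dd U) (c0 U H \<phi>))) \<phi>"
    using e unfolding beq_def bsub_def badd_def by simp
  ultimately show ?thesis by (rule null_hom1_beq)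
qed

lemma null_hom1_cancel_right:
  assumes H: "beq1 T T (bsub N bid) (c0 T H (dd T))" and Z: "null_hom1 T U (c1 T \<phi> N)"
  shows "null_hom1 T U \<phi>"
proof -
  have "c1 T \<phi> N = badd (c1 T \<phi> (bsub N bid)) (c1 T \<phi> bid)"
    by (subst badd_bsub_id[of N bid]) (simp only: comp_badd_r)
  also have "beqd T U \<dots> (badd (c1 T \<phi> (c0 T H (dd T))) \<phi>)"
    by (rule beq_badd[OF cong_l[OF H] comp_bid_r])
  also have "badd (c1 T \<phi> (c0 T H (dd T))) \<phi> = badd (c0 T (c1 T \<phi> H) (dd T)) \<phi>"
    by (simp only: comp_assoc)
  finally have e: "beqd T U (c1 T \<phi> N) (badd (c0 T (c1 T \<phi> H) (dd T)) \<phi>)" .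
  have "null_hom1 T U (bsub (c1 T \<phi> N) (c0 T (c1 T \<phi> H) (dd T)))" by (rule null_hom1_bsub[OF Z null_hom1_dd_right])
  moreover have "beqd T U (bsub (c1 T \<phi> N) (c0 T (c1 T \<phi> H) (dd T))) \<phi>"
    using e unfolding beq_def bsub_def badd_def by simp
  ultimately show ?thesis by (rule null_hom1_beq)
qed

lemma null_hom1_sandwich:
  assumes Z: "null_hom1 T U \<phi>" and f: "chain U U' f1 f0" and g: "chain T' T g1 g0"
  shows "null_hom1 T' U' (c0 U f0 (c1 T \<phi> g1))"
proof -
  obtain a b where ab: "beqd T U \<phi> (badd (c1 U (dd U) a) (c0 T b (dd T)))"
    using Z unfolding null_hom1_def by blast
  have f': "beq (p1 U) (q1 U) (p0 U') (q0 U') (c0 U f0 (dd U)) (c1 U' (dd U') f1)"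
    using f unfolding chain_map_def .
  have g': "beq (p1 T') (q1 T') (p0 T) (q0 T) (c1 T (dd T) g1) (c0 T' g0 (dd T'))"
    using g unfolding chain_map_def by (rule beq_sym)
  have "beqd T' U' (c0 U f0 (c1 T \<phi> g1)) (c0 U f0 (c1 T (badd (c1 U (dd U) a) (c0 T b (dd T))) g1))"
    by (rule cong_l, rule cong_r, rule ab)
  also have "c0 U f0 (c1 T (badd (c1 U (dd U) a) (c0 T b (dd T))) g1) =
     badd (c1 U (c0 U f0 (dd U)) (c1 T a g1)) (c0 U f0 (c0 T b (c1 T (dd T) g1)))"
    by (simp only: comp_badd_l comp_badd_r comp_assoc)
  also have "beqd T' U' \<dots> (badd (c1 U (c1 U' (dd U') f1) (c1 T a g1)) (c0 U f0 (c0 T b (c0 T' g0 (dd T')))))"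
    by (rule beq_badd, rule cong_r[OF f'], rule cong_l, rule cong_l, rule g')
  also have "badd (c1 U (c1 U' (dd U') f1) (c1 T a g1)) (c0 U f0 (c0 T b (c0 T' g0 (dd T')))) =
     badd (c1 U' (dd U') (c1 U f1 (c1 T a g1))) (c0 T' (c0 U f0 (c0 T b g0)) (dd T'))"
    by (simp only: comp_assoc)
  finally show ?thesis unfolding null_hom1_def by blast
qed

lemma hom1_hiso:
  assumes Z: "hom1_zero la ra T U" and TT: "hiso la ra T T'" and UU: "hiso la ra U U'"
  shows "hom1_zero la ra T' U'"
proof -
  obtain f1 f0 g1 g0 where A: "chain T T' f1 f0" "chain T' T g1 g0"
    "nhtp T' T' (bsub (c1 T f1 g1) bid) (bsub (c0 T f0 g0) bid)"
    using TT unfolding hiso_def by blast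
  obtain f1' f0' g1' g0' where B: "chain U U' f1' f0'" "chain U' U g1' g0'"
    "nhtp U' U' (bsub (c1 U f1' g1') bid) (bsub (c0 U f0' g0') bid)"
    using UU unfolding hiso_def by blast
  obtain H where H: "beq1 T' T' (bsub (c1 T f1 g1) bid) (c0 T' H (dd T'))" using A(3) by (rule nhtpE)
  obtain H' where H': "beq0 U' U' (bsub (c0 U f0' g0') bid) (c1 U' (dd U') H')" using B(3) by (rule nhtpE)
  show ?thesis unfolding hom1_zero_iff_null_hom1
  proof
    fix \<phi>
    have "null_hom1 T U (c0 U' g0' (c1 T' \<phi> f1))" using Z unfolding hom1_zero_iff_null_hom1 by blast
    from null_hom1_sandwich[OF this B(1) A(2)]
    have "null_hom1 T' U' (c0 U f0' (c1 T (c0 U' g0' (c1 T' \<phi> f1)) g1))" .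
    moreover have "c0 U f0' (c1 T (c0 U' g0' (c1 T' \<phi> f1)) g1) = c0 U' (c0 U f0' g0') (c1 T' \<phi> (c1 T f1 g1))"
      by (simp only: comp_assoc)
    ultimately have "null_hom1 T' U' (c0 U' (c0 U f0' g0') (c1 T' \<phi> (c1 T f1 g1)))" by simp
    from null_hom1_cancel_left[OF H' this] have "null_hom1 T' U' (c1 T' \<phi> (c1 T f1 g1))" .
    from null_hom1_cancel_right[OF H this] show "null_hom1 T' U' \<phi>" .
  qed
qed

lemma indec_hiso: "indec la ra T \<Longrightarrow> hiso la ra T T' \<Longrightarrow> indec la ra T'"
  unfolding indec_def by (meson hiso_sym hiso_trans)

section \<open>Direct sums and indecomposability\<close>

definition incl2 :: "nat \<Rightarrow> nat \<Rightarrow> ('a,'x,'b) bm" where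
  "incl2 p q = \<lparr>mA = (\<lambda>i j. if i = j + p then 1 else 0), mX = (\<lambda>i j. 0), mB = (\<lambda>i j. if i = j + q then 1 else 0)\<rparr>"
definition proj2 :: "nat \<Rightarrow> nat \<Rightarrow> ('a,'x,'b) bm" where
  "proj2 p q = \<lparr>mA = (\<lambda>i j. if j = i + p then 1 else 0), mX = (\<lambda>i j. 0), mB = (\<lambda>i j. if j = i + q then 1 else 0)\<rparr>"

lemmas dsum_block_simps = comp_simps dsum_def bdiag_def bid_def incl2_def proj2_def beq_def chain_map_def
  sum_delta_shift

lemma chain_incl1: "chain U (dsum U W) bid bid"
  by (simp add: dsum_block_simps)

lemma chain_proj1: "chain (dsum U W) U bid bid"
  by (simp add: dsum_block_simps)

lemma chain_incl2: "chain W (dsum U W) (incl2 (p1 U) (q1 U)) (incl2 (p0 U) (q0 U))"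
  by (simp add: dsum_block_simps)

lemma chain_proj2: "chain (dsum U W) W (proj2 (p1 U) (q1 U)) (proj2 (p0 U) (q0 U))"
  by (simp add: dsum_block_simps)

lemma proj1_incl1: "beq1 U U (c1 (dsum U W) bid bid) bid" "beq0 U U (c0 (dsum U W) bid bid) bid"
  by (simp_all add: dsum_block_simps)

lemma proj2_incl2: "beq1 W W (c1 (dsum U W) (proj2 (p1 U) (q1 U)) (incl2 (p1 U) (q1 U))) bid"
  "beq0 W W (c0 (dsum U W) (proj2 (p0 U) (q0 U)) (incl2 (p0 U) (q0 U))) bid"
  by (simp_all add: dsum_block_simps)

lemma incl_proj_sum: "beq1 (dsum U W) (dsum U W) (badd (c1 U bid bid) (c1 W (incl2 (p1 U) (q1 U)) (proj2 (p1 U) (q1 U)))) bid"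
  "beq0 (dsum U W) (dsum U W) (badd (c0 U bid bid) (c0 W (incl2 (p0 U) (q0 U)) (proj2 (p0 U) (q0 U)))) bid"
  by (auto simp add: dsum_block_simps badd_def)

lemma beq_bsub_zero: "beq ps qs pt qt (bsub M N) bzero \<Longrightarrow> beq ps qs pt qt M N"
  unfolding beq_def bsub_def bzero_def by simp

lemma beq_zero_bsub: "beq ps qs pt qt M N \<Longrightarrow> beq ps qs pt qt bzero (bsub M N)"
  unfolding beq_def bsub_def bzero_def by simp

lemma nhtp_retract_composite:
  assumes f: "chain T S f1 f0" and g: "chain S T g1 g0"
    and fg: "nhtp S S (bsub (c1 T f1 g1) bid) (bsub (c0 T f0 g0) bid)"
    and i: "chain V S i1 i0" and p: "chain S V PR1 PR0"
    and pi1: "beq1 V V (c1 S PR1 i1) bid" and pi0: "beq0 V V (c0 S PR0 i0) bid"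
  shows "nhtp V V (bsub (c1 T (c1 S PR1 f1) (c1 S g1 i1)) bid) (bsub (c0 T (c0 S PR0 f0) (c0 S g0 i0)) bid)"
proof -
  have a: "nhtp V V (bsub (c1 S PR1 (c1 S (c1 T f1 g1) i1)) (c1 S PR1 i1))
      (bsub (c0 S PR0 (c0 S (c0 T f0 g0) i0)) (c0 S PR0 i0))"
    by (rule nhtp_sandwich[OF fg i p])
  have z: "nhtp V V (bsub (c1 S PR1 i1) bid) (bsub (c0 S PR0 i0) bid)"
    by (rule nhtp_beq[OF nhtp_zero]) (rule beq_zero_bsub, fact)+
  have e1: "c1 T (c1 S PR1 f1) (c1 S g1 i1) = c1 S PR1 (c1 S (c1 T f1 g1) i1)" by (simp only: comp_assoc)
  have e0: "c0 T (c0 S PR0 f0) (c0 S g0 i0) = c0 S PR0 (c0 S (c0 T f0 g0) i0)" by (simp only: comp_assoc)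
  show ?thesis unfolding e1 e0 by (subst (1 2) bsub_split, rule nhtp_badd[OF a z])
qed

text \<open>A retract \<open>V\<close> of a complex \<open>S \<simeq> T\<close> gives the idempotent \<open>T \<rightarrow> S \<rightarrow> V \<rightarrow> S \<rightarrow> T\<close>; it is a
  genuine idempotent, not just one up to homotopy, because \<open>T\<close> admits no nonzero null-homotopic
  endomorphisms.\<close>
lemma summand_idempotent:
  assumes tT: "htp_trivial T"
    and f: "chain T S f1 f0" and g: "chain S T g1 g0"
    and fg: "nhtp S S (bsub (c1 T f1 g1) bid) (bsub (c0 T f0 g0) bid)"
    and i: "chain V S i1 i0" and p: "chain S V PR1 PR0"
    and pi1: "beq1 V V (c1 S PR1 i1) bid" and pi0: "beq0 V V (c0 S PR0 i0) bid"
  shows "chain T T (c1 V (c1 S g1 i1) (c1 S PR1 f1)) (c0 V (c0 S g0 i0) (c0 S PR0 f0))"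
    and "beq1 T T (c1 T (c1 V (c1 S g1 i1) (c1 S PR1 f1)) (c1 V (c1 S g1 i1) (c1 S PR1 f1))) (c1 V (c1 S g1 i1) (c1 S PR1 f1))"
    and "beq0 T T (c0 T (c0 V (c0 S g0 i0) (c0 S PR0 f0)) (c0 V (c0 S g0 i0) (c0 S PR0 f0))) (c0 V (c0 S g0 i0) (c0 S PR0 f0))"
proof -
  define fV1 where "fV1 = c1 S PR1 f1"
  define fV0 where "fV0 = c0 S PR0 f0"
  define gV1 where "gV1 = c1 S g1 i1"
  define gV0 where "gV0 = c0 S g0 i0"
  have cf: "chain T V fV1 fV0" unfolding fV1_def fV0_def by (rule chain_comp[OF f p])
  have cg: "chain V T gV1 gV0" unfolding gV1_def gV0_def by (rule chain_comp[OF i g])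
  show "chain T T (c1 V (c1 S g1 i1) (c1 S PR1 f1)) (c0 V (c0 S g0 i0) (c0 S PR0 f0))"
    using chain_comp[OF cf cg] unfolding fV1_def fV0_def gV1_def gV0_def .
  define P1 where "P1 = c1 T fV1 gV1"
  define P0 where "P0 = c0 T fV0 gV0"
  have K: "nhtp V V (bsub P1 bid) (bsub P0 bid)"
    unfolding P1_def P0_def fV1_def fV0_def gV1_def gV0_def by (rule nhtp_retract_composite; fact)
  have GKF: "beq1 T T (c1 V gV1 (c1 V (bsub P1 bid) fV1)) bzero" "beq0 T T (c0 V gV0 (c0 V (bsub P0 bid) fV0)) bzero"
    using htp_trivial_nhtp[OF tT nhtp_comp_l[OF nhtp_comp_r[OF K cf] cg]] by auto
  have "c1 T (c1 V gV1 fV1) (c1 V gV1 fV1) = c1 V gV1 (c1 V P1 fV1)" unfolding P1_def by (simp only: comp_assoc)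
  also have "\<dots> = badd (c1 V gV1 (c1 V (bsub P1 bid) fV1)) (c1 V gV1 (c1 V bid fV1))"
    by (subst badd_bsub_id[of P1 bid]) (simp only: comp_badd_l comp_badd_r)
  also have "beq1 T T \<dots> (badd bzero (c1 V gV1 fV1))"
    by (rule beq_badd[OF GKF(1)], rule cong_l, rule comp_bid_l)
  finally show "beq1 T T (c1 T (c1 V (c1 S g1 i1) (c1 S PR1 f1)) (c1 V (c1 S g1 i1) (c1 S PR1 f1))) (c1 V (c1 S g1 i1) (c1 S PR1 f1))"
    unfolding gV1_def fV1_def bzero_badd .
  have "c0 T (c0 V gV0 fV0) (c0 V gV0 fV0) = c0 V gV0 (c0 V P0 fV0)" unfolding P0_def by (simp only: comp_assoc)
  also have "\<dots> = badd (c0 V gV0 (c0 V (bsub P0 bid) fV0)) (c0 V gV0 (c0 V bid fV0))"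
    by (subst badd_bsub_id[of P0 bid]) (simp only: comp_badd_l comp_badd_r)
  also have "beq0 T T \<dots> (badd bzero (c0 V gV0 fV0))"
    by (rule beq_badd[OF GKF(2)], rule cong_l, rule comp_bid_l)
  finally show "beq0 T T (c0 T (c0 V (c0 S g0 i0) (c0 S PR0 f0)) (c0 V (c0 S g0 i0) (c0 S PR0 f0))) (c0 V (c0 S g0 i0) (c0 S PR0 f0))"
    unfolding gV0_def fV0_def bzero_badd .
qed

lemma summand_hiso_zcx_if_idempotent_zero:
  assumes f: "chain T S f1 f0" and g: "chain S T g1 g0"
    and fg: "nhtp S S (bsub (c1 T f1 g1) bid) (bsub (c0 T f0 g0) bid)"
    and i: "chain V S i1 i0" and p: "chain S V PR1 PR0"
    and pi1: "beq1 V V (c1 S PR1 i1) bid" and pi0: "beq0 V V (c0 S PR0 i0) bid"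
    and z1: "beq1 T T (c1 V (c1 S g1 i1) (c1 S PR1 f1)) bzero"
    and z0: "beq0 T T (c0 V (c0 S g0 i0) (c0 S PR0 f0)) bzero"
  shows "hiso la ra V zcx"
proof -
  define fV1 where "fV1 = c1 S PR1 f1"
  define fV0 where "fV0 = c0 S PR0 f0"
  define gV1 where "gV1 = c1 S g1 i1"
  define gV0 where "gV0 = c0 S g0 i0"
  define P1 where "P1 = c1 T fV1 gV1"
  define P0 where "P0 = c0 T fV0 gV0"
  have K: "nhtp V V (bsub P1 bid) (bsub P0 bid)"
    unfolding P1_def P0_def fV1_def fV0_def gV1_def gV0_def by (rule nhtp_retract_composite; fact)
  have cP: "chain V V P1 P0"
    unfolding P1_def P0_def fV1_def fV0_def gV1_def gV0_def
    by (rule chain_comp[OF chain_comp[OF i g] chain_comp[OF f p]])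
  have PP1: "beq1 V V (c1 V P1 P1) bzero"
  proof -
    have "c1 V P1 P1 = c1 T fV1 (c1 T (c1 V gV1 fV1) gV1)" unfolding P1_def by (simp only: comp_assoc)
    also have "beq1 V V \<dots> (c1 T fV1 (c1 T bzero gV1))"
      by (rule cong_l, rule cong_r, rule z1[folded gV1_def fV1_def])
    finally show ?thesis by simp
  qed
  have PP0: "beq0 V V (c0 V P0 P0) bzero"
  proof -
    have "c0 V P0 P0 = c0 T fV0 (c0 T (c0 V gV0 fV0) gV0)" unfolding P0_def by (simp only: comp_assoc)
    also have "beq0 V V \<dots> (c0 T fV0 (c0 T bzero gV0))"
      by (rule cong_l, rule cong_r, rule z0[folded gV0_def fV0_def])
    finally show ?thesis by simp
  qed
  have n1: "nhtp V V (c1 V P1 (bsub P1 bid)) (c0 V P0 (bsub P0 bid))"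
    by (rule nhtp_comp_l[OF K cP])
  have n2: "nhtp V V (bsub (c1 V P1 bid) bid) (bsub (c0 V P0 bid) bid)"
    by (rule nhtp_beq[OF K]) (rule beq_bsub[OF beq_sym[OF comp_bid_r] beq_refl])+
  have n3: "nhtp V V (bsub (c1 V P1 P1) bid) (bsub (c0 V P0 P0) bid)"
    using nhtp_badd[OF n1 n2] by (simp only: comp_bsub_r bsub_split[symmetric])
  have n4: "nhtp V V (bsub bzero bid) (bsub bzero bid)"
    by (rule nhtp_beq[OF n3]) (rule beq_bsub[OF _ beq_refl], fact)+
  have "nhtp V V bid bid"
    using nhtp_bsub[OF nhtp_zero n4] by (simp add: bsub_def bzero_def)
  then show ?thesis by (simp add: hiso_zcx_iff)
qed

lemma summand_idempotents_sum_id: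
  assumes "beq1 T T (c1 (dsum U W) g1 f1) bid" "beq0 T T (c0 (dsum U W) g0 f0) bid"
  shows "beq1 T T (badd (c1 U (c1 (dsum U W) g1 bid) (c1 (dsum U W) bid f1))
      (c1 W (c1 (dsum U W) g1 (incl2 (p1 U) (q1 U))) (c1 (dsum U W) (proj2 (p1 U) (q1 U)) f1))) bid"
    and "beq0 T T (badd (c0 U (c0 (dsum U W) g0 bid) (c0 (dsum U W) bid f0))
      (c0 W (c0 (dsum U W) g0 (incl2 (p0 U) (q0 U))) (c0 (dsum U W) (proj2 (p0 U) (q0 U)) f0))) bid"
proof -
  have "badd (c1 U (c1 (dsum U W) g1 bid) (c1 (dsum U W) bid f1))
      (c1 W (c1 (dsum U W) g1 (incl2 (p1 U) (q1 U))) (c1 (dsum U W) (proj2 (p1 U) (q1 U)) f1))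
    = c1 (dsum U W) g1 (c1 (dsum U W) (badd (c1 U bid bid) (c1 W (incl2 (p1 U) (q1 U)) (proj2 (p1 U) (q1 U)))) f1)"
    by (simp only: comp_badd_l comp_badd_r comp_assoc)
  also have "beq1 T T \<dots> (c1 (dsum U W) g1 (c1 (dsum U W) bid f1))"
    by (rule cong_l, rule cong_r, rule incl_proj_sum)
  also have "beq1 T T \<dots> (c1 (dsum U W) g1 f1)" by (rule cong_l, rule comp_bid_l)
  also have "beq1 T T \<dots> bid" by (rule assms(1))
  finally show "beq1 T T (badd (c1 U (c1 (dsum U W) g1 bid) (c1 (dsum U W) bid f1))
      (c1 W (c1 (dsum U W) g1 (incl2 (p1 U) (q1 U))) (c1 (dsum U W) (proj2 (p1 U) (q1 U)) f1))) bid" .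
  have "badd (c0 U (c0 (dsum U W) g0 bid) (c0 (dsum U W) bid f0))
      (c0 W (c0 (dsum U W) g0 (incl2 (p0 U) (q0 U))) (c0 (dsum U W) (proj2 (p0 U) (q0 U)) f0))
    = c0 (dsum U W) g0 (c0 (dsum U W) (badd (c0 U bid bid) (c0 W (incl2 (p0 U) (q0 U)) (proj2 (p0 U) (q0 U)))) f0)"
    by (simp only: comp_badd_l comp_badd_r comp_assoc)
  also have "beq0 T T \<dots> (c0 (dsum U W) g0 (c0 (dsum U W) bid f0))"
    by (rule cong_l, rule cong_r, rule incl_proj_sum)
  also have "beq0 T T \<dots> (c0 (dsum U W) g0 f0)" by (rule cong_l, rule comp_bid_l)
  also have "beq0 T T \<dots> bid" by (rule assms(2))
  finally show "beq0 T T (badd (c0 U (c0 (dsum U W) g0 bid) (c0 (dsum U W) bid f0))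
      (c0 W (c0 (dsum U W) g0 (incl2 (p0 U) (q0 U))) (c0 (dsum U W) (proj2 (p0 U) (q0 U)) f0))) bid" .
qed

text \<open>Splitting \<open>T \<simeq> U \<oplus> W\<close> yields complementary idempotents of \<open>T\<close>; if the idempotent of \<open>U\<close>
  is \<open>0\<close> then \<open>U \<simeq> 0\<close>, and if it is \<open>1\<close> then the one of \<open>W\<close> is \<open>0\<close>.\<close>
lemma indec_if_idempotents_trivial:
  assumes tT: "htp_trivial T" and nz: "\<not> hiso la ra T zcx"
    and E: "\<And>e1 e0. chain T T e1 e0 \<Longrightarrow> beq1 T T (c1 T e1 e1) e1 \<Longrightarrow> beq0 T T (c0 T e0 e0) e0 \<Longrightarrow>
       (beq1 T T e1 bzero \<and> beq0 T T e0 bzero) \<or> (beq1 T T e1 bid \<and> beq0 T T e0 bid)"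
  shows "indec la ra T"
  unfolding indec_def
proof (intro conjI allI impI nz)
  fix U W :: "('a,'x,'b) cx"
  assume "hiso la ra T (dsum U W)"
  then obtain f1 f0 g1 g0 where A: "chain T (dsum U W) f1 f0" "chain (dsum U W) T g1 g0"
    "nhtp T T (bsub (c1 (dsum U W) g1 f1) bid) (bsub (c0 (dsum U W) g0 f0) bid)"
    "nhtp (dsum U W) (dsum U W) (bsub (c1 T f1 g1) bid) (bsub (c0 T f0 g0) bid)"
    unfolding hiso_def by blast
  note RU = summand_idempotent[OF tT A(1) A(2) A(4) chain_incl1 chain_proj1 proj1_incl1]
    summand_hiso_zcx_if_idempotent_zero[OF A(1) A(2) A(4) chain_incl1 chain_proj1 proj1_incl1]
  note RW = summand_hiso_zcx_if_idempotent_zero[OF A(1) A(2) A(4) chain_incl2 chain_proj2 proj2_incl2]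
  have "beq1 T T (c1 (dsum U W) g1 f1) bid" "beq0 T T (c0 (dsum U W) g0 f0) bid"
    using htp_trivial_nhtp[OF tT A(3)] by (auto intro: beq_bsub_zero)
  note sum = summand_idempotents_sum_id[OF this]
  have "(beq1 T T (c1 U (c1 (dsum U W) g1 bid) (c1 (dsum U W) bid f1)) bzero
        \<and> beq0 T T (c0 U (c0 (dsum U W) g0 bid) (c0 (dsum U W) bid f0)) bzero)
      \<or> (beq1 T T (c1 U (c1 (dsum U W) g1 bid) (c1 (dsum U W) bid f1)) bid
        \<and> beq0 T T (c0 U (c0 (dsum U W) g0 bid) (c0 (dsum U W) bid f0)) bid)"
    using RU(1-3) by (rule E)
  then show "hiso la ra U zcx \<or> hiso la ra W zcx"
  proof
    assume "beq1 T T (c1 U (c1 (dsum U W) g1 bid) (c1 (dsum U W) bid f1)) bzero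
        \<and> beq0 T T (c0 U (c0 (dsum U W) g0 bid) (c0 (dsum U W) bid f0)) bzero"
    then show ?thesis using RU(4) by blast
  next
    assume "beq1 T T (c1 U (c1 (dsum U W) g1 bid) (c1 (dsum U W) bid f1)) bid
        \<and> beq0 T T (c0 U (c0 (dsum U W) g0 bid) (c0 (dsum U W) bid f0)) bid"
    with sum have "beq1 T T (c1 W (c1 (dsum U W) g1 (incl2 (p1 U) (q1 U))) (c1 (dsum U W) (proj2 (p1 U) (q1 U)) f1)) bzero"
      "beq0 T T (c0 W (c0 (dsum U W) g0 (incl2 (p0 U) (q0 U))) (c0 (dsum U W) (proj2 (p0 U) (q0 U)) f0)) bzero"
      unfolding beq_def badd_def bzero_def by auto
    then show ?thesis using RW by blast
  qed
qed

lemma hiso_of_eq_data: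
  assumes "p1 T = p1 U" "q1 T = q1 U" "p0 T = p0 U" "q0 T = q0 U" "beqd T T (dd T) (dd U)"
  shows "hiso la ra T U"
proof (rule hiso_of_inverse_chain_maps[of T U bid bid bid bid])
  show "chain T U bid bid" unfolding chain_map_def
    using assms by (metis beq_sym beq_trans comp_bid_l comp_bid_r)
qed (use assms in \<open>simp_all add: comp_bid_l\<close>)

lemma hiso_zcx_iff_sizes: "htp_trivial T \<Longrightarrow> hiso la ra T zcx \<longleftrightarrow> p1 T = 0 \<and> q1 T = 0 \<and> p0 T = 0 \<and> q0 T = 0"
  using htp_trivial_zcx[of T] hiso_of_eq_data[of T zcx] by (auto simp: zcx_def beq_def)

lemma not_hiso_deg1_concentrated:
  assumes "p0 U = 0" "q0 U = 0" "p1 T = 0" "0 < p0 T"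
  shows "\<not> hiso la ra T U"
proof
  assume "hiso la ra T U"
  then obtain f1 f0 g1 g0 where "nhtp T T (bsub (c1 U g1 f1) bid) (bsub (c0 U g0 f0) bid)"
    unfolding hiso_def by blast
  then obtain h where h: "beq0 T T (bsub (c0 U g0 f0) bid) (c1 T (dd T) h)" by (rule nhtpE)
  have "mA (bsub (c0 U g0 f0) bid) 0 0 = mA (c1 T (dd T) h) 0 0" using h assms(4) unfolding beq_def by auto
  then show False using assms(1-3) by (simp add: comp_simps bsub_def bid_def)
qed

lemma not_hiso_deg0_concentrated:
  assumes "p1 T = 0" "q1 T = 0" "q0 U = 0" "0 < q1 U"
  shows "\<not> hiso la ra T U"
proof
  assume "hiso la ra T U"
  then obtain f1 f0 g1 g0 where "nhtp U U (bsub (c1 T f1 g1) bid) (bsub (c0 T f0 g0) bid)"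
    unfolding hiso_def by blast
  then obtain h where h: "beq1 U U (bsub (c1 T f1 g1) bid) (c0 U h (dd U))" by (rule nhtpE)
  have "mB (bsub (c1 T f1 g1) bid) 0 0 = mB (c0 U h (dd U)) 0 0" using h assms(4) unfolding beq_def by auto
  then show False using assms(1-3) by (simp add: comp_simps bsub_def bid_def)
qed

lemma hom1_zero_retract:
  assumes S: "hom1_zero la ra S S"
    and iT: "chain T S iT1 iT0" and pT: "chain S T pT1 pT0" and piT: "beq1 T T (c1 S pT1 iT1) bid"
    and iU: "chain U S iU1 iU0" and pU: "chain S U pU1 pU0" and piU: "beq0 U U (c0 S pU0 iU0) bid"
  shows "hom1_zero la ra T U"
  unfolding hom1_zero_iff_null_hom1
proof
  fix \<phi>
  have "null_hom1 S S (c0 U iU0 (c1 T \<phi> pT1))" using S unfolding hom1_zero_iff_null_hom1 by blast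
  from null_hom1_sandwich[OF this pU iT] have "null_hom1 T U (c0 S pU0 (c1 S (c0 U iU0 (c1 T \<phi> pT1)) iT1))" .
  moreover have "c0 S pU0 (c1 S (c0 U iU0 (c1 T \<phi> pT1)) iT1) = c0 U (c0 S pU0 iU0) (c1 T \<phi> (c1 S pT1 iT1))"
    by (simp only: comp_assoc)
  moreover have "beqd T U (c0 U (c0 S pU0 iU0) (c1 T \<phi> (c1 S pT1 iT1))) (c0 U bid (c1 T \<phi> bid))"
    by (rule comp_cong[OF piU cong_l[OF piT]])
  moreover have "beqd T U (c0 U bid (c1 T \<phi> bid)) \<phi>"
    by (rule beq_trans[OF comp_bid_l comp_bid_r])
  ultimately show "null_hom1 T U \<phi>" by (metis null_hom1_beq beq_trans)
qed

lemma hom1_zero_dsum: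
  assumes "hom1_zero la ra (dsum T U) (dsum T U)"
  shows "hom1_zero la ra T T" "hom1_zero la ra U T" "hom1_zero la ra U U" "hom1_zero la ra T U"
  using hom1_zero_retract[OF assms chain_incl1 chain_proj1 proj1_incl1(1) chain_incl1 chain_proj1 proj1_incl1(2)]
    hom1_zero_retract[OF assms chain_incl2 chain_proj2 proj2_incl2(1) chain_incl1 chain_proj1 proj1_incl1(2)]
    hom1_zero_retract[OF assms chain_incl2 chain_proj2 proj2_incl2(1) chain_incl2 chain_proj2 proj2_incl2(2)]
    hom1_zero_retract[OF assms chain_incl1 chain_proj1 proj1_incl1(1) chain_incl2 chain_proj2 proj2_incl2(2)]
  by auto

lemma hiso_dsum_zcx: "hiso la ra (dsum T zcx) T"
  by (rule hiso_of_eq_data) (auto simp: dsum_def zcx_def beq_def bdiag_def)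

lemma presilting_pair_hom1_zero:
  assumes "presilting la ra (dsum_list [T, U])"
  shows "hom1_zero la ra T T" "hom1_zero la ra U T" "hom1_zero la ra U U" "hom1_zero la ra T U"
proof -
  have h: "hom1_zero la ra (dsum T (dsum U zcx)) (dsum T (dsum U zcx))"
    using assms unfolding presilting_def dsum_list_def by simp
  note H = hom1_zero_dsum[OF h]
  show "hom1_zero la ra T T" by (rule H(1))
  show "hom1_zero la ra U T" by (rule hom1_hiso[OF H(2) hiso_dsum_zcx hiso_refl])
  show "hom1_zero la ra U U" by (rule hom1_hiso[OF H(3) hiso_dsum_zcx hiso_dsum_zcx])
  show "hom1_zero la ra T U" by (rule hom1_hiso[OF H(4) hiso_refl hiso_dsum_zcx])
qed

section \<open>Complexes of the form \<open>P\<^sub>x\<close>\<close>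

definition Px_shape :: "('a,'x,'b) cx \<Rightarrow> bool" where "Px_shape T \<longleftrightarrow> p1 T = 0 \<and> q0 T = 0"

lemma Px_shape_htp_trivial: "Px_shape T \<Longrightarrow> htp_trivial T" unfolding Px_shape_def htp_trivial_def by simp

lemma chain_Px_shape:
  assumes "Px_shape T" "Px_shape U"
  shows "chain T U f1 f0 \<longleftrightarrow> (\<forall>i<p0 U. \<forall>j<q1 T.
     (\<Sum>k<p0 T. la (mA f0 i k) (mX (dd T) k j)) = (\<Sum>k<q1 U. ra (mX (dd U) i k) (mB f1 k j)))"
  using assms unfolding Px_shape_def chain_map_def beq_def by (simp add: comp_simps)

lemma beq1_Px_shape: "Px_shape T \<Longrightarrow> beq1 T T X Y \<longleftrightarrow> eqm (q1 T) (q1 T) (mB X) (mB Y)"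
  unfolding Px_shape_def beq_def eqm_def by simp

lemma beq0_Px_shape: "Px_shape T \<Longrightarrow> beq0 T T X Y \<longleftrightarrow> eqm (p0 T) (p0 T) (mA X) (mA Y)"
  unfolding Px_shape_def beq_def eqm_def by simp

lemma mB_c1: "mB (c1 U g f) = mm (q1 U) (mB g) (mB f)" unfolding mm_def by (intro ext) (simp add: comp_simps)
lemma mA_c0: "mA (c0 U g f) = mm (p0 U) (mA g) (mA f)" unfolding mm_def by (intro ext) (simp add: comp_simps)

lemma mA_bid: "mA bid = mI" unfolding bid_def mI_def by simp
lemma mB_bid: "mB bid = mI" unfolding bid_def mI_def by simp

definition diag_bm :: "(nat \<Rightarrow> nat \<Rightarrow> 'a) \<Rightarrow> (nat \<Rightarrow> nat \<Rightarrow> 'b) \<Rightarrow> ('a,'x,'b) bm" where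
  "diag_bm E F = \<lparr>mA = E, mX = (\<lambda>i j. 0), mB = F\<rparr>"

lemma diag_bm_simps[simp]: "mA (diag_bm E F) = E" "mX (diag_bm E F) = (\<lambda>i j. 0)" "mB (diag_bm E F) = F"
  unfolding diag_bm_def by simp_all

lemma hiso_Px_shape:
  assumes pT: "Px_shape T" and pU: "Px_shape U" and ch: "chain T U f1 f0"
    and F: "eqm (q1 T) (q1 T) (mm (q1 U) F' (mB f1)) mI" "eqm (q1 U) (q1 U) (mm (q1 T) (mB f1) F') mI"
    and E: "eqm (p0 T) (p0 T) (mm (p0 U) E' (mA f0)) mI" "eqm (p0 U) (p0 U) (mm (p0 T) (mA f0) E') mI"
  shows "hiso la ra T U"
proof (rule hiso_of_inverse_chain_maps[OF ch, of "diag_bm (\<lambda>i j. 0) F'" "diag_bm E' (\<lambda>i j. 0)"])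
  show "beq1 T T (c1 U (diag_bm (\<lambda>i j. 0) F') f1) bid" unfolding beq1_Px_shape[OF pT] mB_c1 mB_bid using F(1) by simp
  show "beq1 U U (c1 T f1 (diag_bm (\<lambda>i j. 0) F')) bid" unfolding beq1_Px_shape[OF pU] mB_c1 mB_bid using F(2) by simp
  show "beq0 T T (c0 U (diag_bm E' (\<lambda>i j. 0)) f0) bid" unfolding beq0_Px_shape[OF pT] mA_c0 mA_bid using E(1) by simp
  show "beq0 U U (c0 T f0 (diag_bm E' (\<lambda>i j. 0))) bid" unfolding beq0_Px_shape[OF pU] mA_c0 mA_bid using E(2) by simp
qed

lemma Px_shape_Px[simp]: "Px_shape (Px s t x)" unfolding Px_shape_def by simp
lemma Px_shape_P2sh[simp]: "Px_shape P2sh" unfolding Px_shape_def by simp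
lemma Px_shape_P1cx[simp]: "Px_shape P1cx" unfolding Px_shape_def by simp

lemma sum_ra_mI: "j < r \<Longrightarrow> (\<Sum>k<r. ra (g k) (mI k j)) = g j"
  unfolding mI_def by simp
lemma sum_la_mI: "i < l \<Longrightarrow> (\<Sum>k<l. la (mI i k) (h k)) = h i"
  unfolding mI_def by simp

definition xmul :: "nat \<Rightarrow> (nat \<Rightarrow> nat \<Rightarrow> 'x) \<Rightarrow> (nat \<Rightarrow> nat \<Rightarrow> 'b) \<Rightarrow> nat \<Rightarrow> nat \<Rightarrow> 'x" where
  "xmul n x M = (\<lambda>i j. \<Sum>k<n. ra (x i k) (M k j))"
definition mulx :: "nat \<Rightarrow> (nat \<Rightarrow> nat \<Rightarrow> 'a) \<Rightarrow> (nat \<Rightarrow> nat \<Rightarrow> 'x) \<Rightarrow> nat \<Rightarrow> nat \<Rightarrow> 'x" where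
  "mulx n E x = (\<lambda>i j. \<Sum>k<n. la (E i k) (x k j))"

lemma xmul_assoc: "xmul n (xmul m x M) N = xmul m x (mm n M N)"
  unfolding xmul_def mm_def by (intro ext) (simp add: lra_simps, rule sum.swap)

lemma mulx_assoc: "mulx n E (mulx m E' x) = mulx m (mm n E E') x"
  unfolding mulx_def mm_def by (intro ext) (simp add: lra_simps, rule sum.swap)

lemma xmul_cong: "(\<And>k. k < n \<Longrightarrow> x i k = x' i k) \<Longrightarrow> (\<And>k. k < n \<Longrightarrow> M k j = M' k j) \<Longrightarrow> xmul n x M i j = xmul n x' M' i j"
  unfolding xmul_def by simp

lemma mulx_cong: "(\<And>k. k < n \<Longrightarrow> E i k = E' i k) \<Longrightarrow> (\<And>k. k < n \<Longrightarrow> x k j = x' k j) \<Longrightarrow> mulx n E x i j = mulx n E' x' i j"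
  unfolding mulx_def by simp

lemma xmul_mI: "j < n \<Longrightarrow> xmul n x mI i j = x i j"
  unfolding xmul_def mI_def by simp

lemma mulx_mI: "i < n \<Longrightarrow> mulx n mI x i j = x i j"
  unfolding mulx_def mI_def by simp

lemma chain_Px_shape_mulx:
  assumes "Px_shape T" "Px_shape U"
  shows "chain T U f1 f0 \<longleftrightarrow> (\<forall>i<p0 U. \<forall>j<q1 T. mulx (p0 T) (mA f0) (mX (dd T)) i j = xmul (q1 U) (mX (dd U)) (mB f1) i j)"
  unfolding chain_Px_shape[OF assms] mulx_def xmul_def ..

lemma hiso_Px:
  assumes E: "invp s E E'" and F: "invp t F F'"
    and ch: "\<forall>i<s. \<forall>j<t. mulx s E x i j = xmul t y F i j"
  shows "hiso la ra (Px s t x :: ('a,'x,'b) cx) (Px s t y)"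
proof (rule hiso_Px_shape[of _ _ "diag_bm (\<lambda>i j. 0) F" "diag_bm E (\<lambda>i j. 0)" F' E'])
  show "chain (Px s t x) (Px s t y) (diag_bm (\<lambda>i j. 0) F) (diag_bm E (\<lambda>i j. 0))"
    unfolding chain_Px_shape_mulx[OF Px_shape_Px Px_shape_Px] using ch by simp
qed (use E F in \<open>simp_all add: invp_def\<close>)

lemma hiso_Px_of_Px_shape: "Px_shape V \<Longrightarrow> hiso la ra V (Px (p0 V) (q1 V) (mX (dd V)))"
  by (rule hiso_of_eq_data) (auto simp: Px_shape_def beq_def)

section \<open>Minimal generating sets\<close>

lemma fin_dim_finitely_generated:
  assumes fd: "fin_dim_k (\<lambda>c x. la (\<iota> c) x)" and ce: "\<forall>c x. la (\<iota> c) x = ra x (\<iota>' c)"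
  shows "\<exists>g n. right_gen ra g n" "\<exists>h n. left_gen la h n"
proof -
  obtain S where S: "finite S" "\<forall>v. \<exists>c. v = (\<Sum>s\<in>S. la (\<iota> (c s)) s)"
    using fd unfolding fin_dim_k_def by blast
  obtain e where e: "bij_betw e {0..<card S} S" using ex_bij_betw_nat_finite[OF S(1)] by blast
  have re: "(\<Sum>s\<in>S. F s) = (\<Sum>k<card S. F (e k))" for F :: "'x \<Rightarrow> 'x"
    using sum.reindex_bij_betw[OF e, of F] by (simp add: atLeast0LessThan)
  show "\<exists>h n. left_gen la h n"
  proof (intro exI)
    show "left_gen la e (card S)" unfolding left_gen_def
    proof
      fix x obtain c where "x = (\<Sum>s\<in>S. la (\<iota> (c s)) s)" using S(2) by blast
      then have "x = (\<Sum>k<card S. la (\<iota> (c (e k))) (e k))" by (simp add: re)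
      then show "\<exists>a. x = (\<Sum>i<card S. la (a i) (e i))" by (intro exI[of _ "\<lambda>k. \<iota> (c (e k))"])
    qed
  qed
  show "\<exists>g n. right_gen ra g n"
  proof (intro exI)
    show "right_gen ra e (card S)" unfolding right_gen_def
    proof
      fix x obtain c where "x = (\<Sum>s\<in>S. la (\<iota> (c s)) s)" using S(2) by blast
      then have "x = (\<Sum>k<card S. ra (e k) (\<iota>' (c (e k))))" by (simp add: re ce)
      then show "\<exists>b. x = (\<Sum>i<card S. ra (e i) (b i))" by (intro exI[of _ "\<lambda>k. \<iota>' (c (e k))"])
    qed
  qed
qed

text \<open>A unit coefficient in a relation would make one of the minimal generators redundant.\<close>
lemma minimal_right_gen_relation_nonunit:
  assumes g: "right_gen ra g r" and r: "r = rgen_num ra"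
    and Q: "\<forall>j<m. (\<Sum>k<r. ra (g k) (Q k j)) = 0" and ij: "i < r" "j < m"
  shows "nonunit (Q i j)"
proof
  assume u: "two_sided_unit (Q i j)"
  define w where "w = B.unit_inv (Q i j)"
  have w: "Q i j * w = 1" using B.unit_inv_inverse[OF u] unfolding w_def by auto
  have s0: "(\<Sum>k<r. ra (g k) (Q k j)) = 0" using Q ij by auto
  have gi: "g i = - (\<Sum>k<r - 1. ra (g (skip_idx i k)) (Q (skip_idx i k) j * w))"
  proof -
    have "ra (g i) (Q i j) + (\<Sum>k<r - 1. ra (g (skip_idx i k)) (Q (skip_idx i k) j)) = 0"
      using s0 sum_remove_skip_idx[OF ij(1), of "\<lambda>k. ra (g k) (Q k j)"] by simp
    then have "ra (g i) (Q i j) = - (\<Sum>k<r - 1. ra (g (skip_idx i k)) (Q (skip_idx i k) j))"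
      by (simp add: eq_neg_iff_add_eq_0)
    then have "ra (ra (g i) (Q i j)) w = ra (- (\<Sum>k<r - 1. ra (g (skip_idx i k)) (Q (skip_idx i k) j))) w" by simp
    then show ?thesis by (simp add: ra_mult[symmetric] w ra_neg_l ra_sum_l)
  qed
  have "right_gen ra (\<lambda>k. g (skip_idx i k)) (r - 1)" unfolding right_gen_def
  proof
    fix x
    obtain b where b: "x = (\<Sum>k<r. ra (g k) (b k))" using g unfolding right_gen_def by blast
    have "x = ra (g i) (b i) + (\<Sum>k<r - 1. ra (g (skip_idx i k)) (b (skip_idx i k)))"
      using b sum_remove_skip_idx[OF ij(1), of "\<lambda>k. ra (g k) (b k)"] by simp
    also have "\<dots> = (\<Sum>k<r - 1. ra (g (skip_idx i k)) (b (skip_idx i k) - Q (skip_idx i k) j * w * b i))"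
      unfolding gi by (simp add: ra_neg_l ra_sum_l ra_diff_r ra_mult sum_subtractf)
    finally show "\<exists>b. x = (\<Sum>k<r - 1. ra (g (skip_idx i k)) (b k))" by (intro exI[of _ "\<lambda>k. b (skip_idx i k) - Q (skip_idx i k) j * w * b i"])
  qed
  then have "rgen_num ra \<le> r - 1" unfolding rgen_num_def by (intro Least_le) blast
  with r ij show False by simp
qed

lemma minimal_left_gen_relation_nonunit:
  assumes h: "left_gen la h l" and l: "l = lgen_num la"
    and Q: "\<forall>j<m. (\<Sum>k<l. la (Q j k) (h k)) = 0" and ij: "i < l" "j < m"
  shows "nonunit (Q j i)"
proof
  assume u: "two_sided_unit (Q j i)"
  define w where "w = A.unit_inv (Q j i)"
  have w: "w * Q j i = 1" using A.unit_inv_inverse[OF u] unfolding w_def by auto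
  have s0: "(\<Sum>k<l. la (Q j k) (h k)) = 0" using Q ij by auto
  have hi: "h i = - (\<Sum>k<l - 1. la (w * Q j (skip_idx i k)) (h (skip_idx i k)))"
  proof -
    have "la (Q j i) (h i) + (\<Sum>k<l - 1. la (Q j (skip_idx i k)) (h (skip_idx i k))) = 0"
      using s0 sum_remove_skip_idx[OF ij(1), of "\<lambda>k. la (Q j k) (h k)"] by simp
    then have "la (Q j i) (h i) = - (\<Sum>k<l - 1. la (Q j (skip_idx i k)) (h (skip_idx i k)))"
      by (simp add: eq_neg_iff_add_eq_0)
    then have "la w (la (Q j i) (h i)) = la w (- (\<Sum>k<l - 1. la (Q j (skip_idx i k)) (h (skip_idx i k))))" by simp
    then show ?thesis by (simp add: la_mult[symmetric] w la_neg_r la_sum_r)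
  qed
  have "left_gen la (\<lambda>k. h (skip_idx i k)) (l - 1)" unfolding left_gen_def
  proof
    fix x
    obtain a where a: "x = (\<Sum>k<l. la (a k) (h k))" using h unfolding left_gen_def by blast
    have "x = la (a i) (h i) + (\<Sum>k<l - 1. la (a (skip_idx i k)) (h (skip_idx i k)))"
      using a sum_remove_skip_idx[OF ij(1), of "\<lambda>k. la (a k) (h k)"] by simp
    also have "\<dots> = (\<Sum>k<l - 1. la (a (skip_idx i k) - a i * w * Q j (skip_idx i k)) (h (skip_idx i k)))"
      unfolding hi by (simp add: la_neg_r la_sum_r la_diff_l la_mult sum_subtractf mult.assoc)
    finally show "\<exists>a. x = (\<Sum>k<l - 1. la (a k) (h (skip_idx i k)))" by (intro exI[of _ "\<lambda>k. a (skip_idx i k) - a i * w * Q j (skip_idx i k)"])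
  qed
  then have "lgen_num la \<le> l - 1" unfolding lgen_num_def by (intro Least_le) blast
  with l ij show False by simp
qed

lemma minimal_right_gen_stabilizer_invp:
  assumes g: "right_gen ra g r" and r: "r = rgen_num ra"
    and stable: "\<And>j. j < r \<Longrightarrow> (\<Sum>k<r. ra (g k) (Q k j)) = g j"
  shows "\<exists>W. invp r Q W"
proof (rule B.invp_if_nonunit_diff_mI)
  have "\<forall>j<r. (\<Sum>k<r. ra (g k) (Q k j - mI k j)) = 0"
    using stable by (simp add: ra_diff_r sum_subtractf sum_ra_mI)
  then show "nonunit (Q i j - mI i j)" if "i < r" "j < r" for i j
    by (rule minimal_right_gen_relation_nonunit[OF g r _ that])
qed

lemma minimal_left_gen_stabilizer_invp:
  assumes h: "left_gen la h l" and l: "l = lgen_num la"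
    and stable: "\<And>j. j < l \<Longrightarrow> (\<Sum>k<l. la (Q j k) (h k)) = h j"
  shows "\<exists>W. invp l Q W"
proof (rule A.invp_if_nonunit_diff_mI)
  have "\<forall>j<l. (\<Sum>k<l. la (Q j k - mI j k) (h k)) = 0"
    using stable by (simp add: la_diff_l sum_subtractf sum_la_mI)
  then show "nonunit (Q j i - mI j i)" if "j < l" "i < l" for i j
    by (rule minimal_left_gen_relation_nonunit[OF h l _ that(2,1)])
qed

section \<open>The silting complexes \<open>P\<^sub>g \<oplus> P\<^sub>2[1]\<close> and \<open>P\<^sub>1 \<oplus> P\<^sub>h\<close>\<close>

lemma indec_Px_right_gen:
  assumes g: "right_gen ra g r" and r: "r = rgen_num ra"
  shows "indec la ra (Px 1 r (\<lambda>i j. g j))"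
proof (rule indec_if_idempotents_trivial)
  let ?T = "Px 1 r (\<lambda>i j. g j) :: ('a,'x,'b) cx"
  show "htp_trivial ?T" by (simp add: Px_shape_htp_trivial)
  show "\<not> hiso la ra ?T zcx" by (simp add: hiso_zcx_iff_sizes Px_shape_htp_trivial)
  fix e1 e0
  assume ch: "chain ?T ?T e1 e0" and i1: "beq1 ?T ?T (c1 ?T e1 e1) e1" and i0: "beq0 ?T ?T (c0 ?T e0 e0) e0"
  have C: "\<forall>j<r. la (mA e0 0 0) (g j) = (\<Sum>k<r. ra (g k) (mB e1 k j))"
    using ch unfolding chain_Px_shape[OF Px_shape_Px Px_shape_Px] by simp
  have a: "mA e0 0 0 * mA e0 0 0 = mA e0 0 0"
    using i0 unfolding beq0_Px_shape[OF Px_shape_Px] mA_c0 eqm_def mm_def by simp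
  have bi: "eqm r r (mm r (mB e1) (mB e1)) (mB e1)"
    using i1 unfolding beq1_Px_shape[OF Px_shape_Px] mB_c1 by simp
  show "(beq1 ?T ?T e1 bzero \<and> beq0 ?T ?T e0 bzero) \<or> (beq1 ?T ?T e1 bid \<and> beq0 ?T ?T e0 bid)"
  proof (cases "mA e0 0 0 = 0")
    case True
    have "\<forall>j<r. (\<Sum>k<r. ra (g k) (mB e1 k j)) = 0" using C True by simp
    then have "nonunit (mB e1 i j)" if "i < r" "j < r" for i j using minimal_right_gen_relation_nonunit[OF g r] that by blast
    then have "eqm r r (mB e1) (\<lambda>i j. 0)" using B.idempotent_nonunit_matrix_zero[OF _ bi] by blast
    then have "beq1 ?T ?T e1 bzero" "beq0 ?T ?T e0 bzero"
      unfolding beq1_Px_shape[OF Px_shape_Px] beq0_Px_shape[OF Px_shape_Px] using True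
      by (simp_all add: bzero_def eqm_def)
    then show ?thesis by blast
  next
    case False
    then have a1: "mA e0 0 0 = 1" using A.idempotent_zero_or_one[OF a] by blast
    define b' where "b' = (\<lambda>i j. mI i j - mB e1 i j)"
    have "\<forall>j<r. (\<Sum>k<r. ra (g k) (b' k j)) = 0"
      using C a1 by (simp add: b'_def ra_diff_r sum_subtractf sum_ra_mI)
    then have "nonunit (b' i j)" if "i < r" "j < r" for i j using minimal_right_gen_relation_nonunit[OF g r] that by blast
    then have "eqm r r b' (\<lambda>i j. 0)" using B.idempotent_nonunit_matrix_zero[OF _ B.idempotent_complement[OF bi]] unfolding b'_def by blast
    then have "beq1 ?T ?T e1 bid" "beq0 ?T ?T e0 bid"
      unfolding beq1_Px_shape[OF Px_shape_Px] beq0_Px_shape[OF Px_shape_Px] using a1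
      by (simp_all add: bid_def eqm_def b'_def mI_def)
    then show ?thesis by blast
  qed
qed

lemma indec_Px_left_gen:
  assumes h: "left_gen la h l" and l: "l = lgen_num la"
  shows "indec la ra (Px l 1 (\<lambda>i j. h i))"
proof (rule indec_if_idempotents_trivial)
  let ?T = "Px l 1 (\<lambda>i j. h i) :: ('a,'x,'b) cx"
  show "htp_trivial ?T" by (simp add: Px_shape_htp_trivial)
  show "\<not> hiso la ra ?T zcx" by (simp add: hiso_zcx_iff_sizes Px_shape_htp_trivial)
  fix e1 e0
  assume ch: "chain ?T ?T e1 e0" and i1: "beq1 ?T ?T (c1 ?T e1 e1) e1" and i0: "beq0 ?T ?T (c0 ?T e0 e0) e0"
  have C: "\<forall>i<l. (\<Sum>k<l. la (mA e0 i k) (h k)) = ra (h i) (mB e1 0 0)"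
    using ch unfolding chain_Px_shape[OF Px_shape_Px Px_shape_Px] by simp
  have b: "mB e1 0 0 * mB e1 0 0 = mB e1 0 0"
    using i1 unfolding beq1_Px_shape[OF Px_shape_Px] mB_c1 eqm_def mm_def by simp
  have ai: "eqm l l (mm l (mA e0) (mA e0)) (mA e0)"
    using i0 unfolding beq0_Px_shape[OF Px_shape_Px] mA_c0 by simp
  show "(beq1 ?T ?T e1 bzero \<and> beq0 ?T ?T e0 bzero) \<or> (beq1 ?T ?T e1 bid \<and> beq0 ?T ?T e0 bid)"
  proof (cases "mB e1 0 0 = 0")
    case True
    have "\<forall>j<l. (\<Sum>k<l. la (mA e0 j k) (h k)) = 0" using C True by simp
    then have "nonunit (mA e0 j i)" if "i < l" "j < l" for i j using minimal_left_gen_relation_nonunit[OF h l] that by blast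
    then have "eqm l l (mA e0) (\<lambda>i j. 0)" using A.idempotent_nonunit_matrix_zero[OF _ ai] by blast
    then have "beq1 ?T ?T e1 bzero" "beq0 ?T ?T e0 bzero"
      unfolding beq1_Px_shape[OF Px_shape_Px] beq0_Px_shape[OF Px_shape_Px] using True
      by (simp_all add: bzero_def eqm_def)
    then show ?thesis by blast
  next
    case False
    then have b1: "mB e1 0 0 = 1" using B.idempotent_zero_or_one[OF b] by blast
    define a' where "a' = (\<lambda>i j. mI i j - mA e0 i j)"
    have "\<forall>j<l. (\<Sum>k<l. la (a' j k) (h k)) = 0"
      using C b1 by (simp add: a'_def la_diff_l sum_subtractf sum_la_mI)
    then have "nonunit (a' j i)" if "i < l" "j < l" for i j using minimal_left_gen_relation_nonunit[OF h l] that by blast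
    then have "eqm l l a' (\<lambda>i j. 0)" using A.idempotent_nonunit_matrix_zero[OF _ A.idempotent_complement[OF ai]] unfolding a'_def by blast
    then have "beq1 ?T ?T e1 bid" "beq0 ?T ?T e0 bid"
      unfolding beq1_Px_shape[OF Px_shape_Px] beq0_Px_shape[OF Px_shape_Px] using b1
      by (simp_all add: bid_def eqm_def a'_def mI_def)
    then show ?thesis by blast
  qed
qed

lemma indec_P2sh: "indec la ra P2sh"
proof (rule indec_if_idempotents_trivial)
  show "htp_trivial P2sh" by (simp add: Px_shape_htp_trivial)
  show "\<not> hiso la ra P2sh zcx" by (simp add: hiso_zcx_iff_sizes Px_shape_htp_trivial)
  fix e1 e0
  assume ch: "chain P2sh P2sh e1 e0" and i1: "beq1 P2sh P2sh (c1 P2sh e1 e1) e1" and i0: "beq0 P2sh P2sh (c0 P2sh e0 e0) e0"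
  have b: "mB e1 0 0 * mB e1 0 0 = mB e1 0 0"
    using i1 unfolding beq1_Px_shape[OF Px_shape_P2sh] mB_c1 eqm_def mm_def by simp
  show "(beq1 P2sh P2sh e1 bzero \<and> beq0 P2sh P2sh e0 bzero) \<or> (beq1 P2sh P2sh e1 bid \<and> beq0 P2sh P2sh e0 bid)"
    using B.idempotent_zero_or_one[OF b] unfolding beq1_Px_shape[OF Px_shape_P2sh] beq0_Px_shape[OF Px_shape_P2sh]
    by (auto simp: eqm_def bzero_def bid_def)
qed

lemma indec_P1cx: "indec la ra P1cx"
proof (rule indec_if_idempotents_trivial)
  show "htp_trivial P1cx" by (simp add: Px_shape_htp_trivial)
  show "\<not> hiso la ra P1cx zcx" by (simp add: hiso_zcx_iff_sizes Px_shape_htp_trivial)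
  fix e1 e0
  assume ch: "chain P1cx P1cx e1 e0" and i1: "beq1 P1cx P1cx (c1 P1cx e1 e1) e1" and i0: "beq0 P1cx P1cx (c0 P1cx e0 e0) e0"
  have a: "mA e0 0 0 * mA e0 0 0 = mA e0 0 0"
    using i0 unfolding beq0_Px_shape[OF Px_shape_P1cx] mA_c0 eqm_def mm_def by simp
  show "(beq1 P1cx P1cx e1 bzero \<and> beq0 P1cx P1cx e0 bzero) \<or> (beq1 P1cx P1cx e1 bid \<and> beq0 P1cx P1cx e0 bid)"
    using A.idempotent_zero_or_one[OF a] unfolding beq1_Px_shape[OF Px_shape_P1cx] beq0_Px_shape[OF Px_shape_P1cx]
    by (auto simp: eqm_def bzero_def bid_def)
qed

lemma hom1_zero_Px_shape:
  assumes pS: "Px_shape S"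
    and H: "\<And>\<phi>. \<exists>\<beta> \<alpha>. \<forall>i<p0 S. \<forall>j<q1 S. \<phi> i j =
       (\<Sum>k<q1 S. ra (mX (dd S) i k) (\<beta> k j)) + (\<Sum>k<p0 S. la (\<alpha> i k) (mX (dd S) k j))"
  shows "hom1_zero la ra S S"
  unfolding hom1_zero_def
proof
  fix \<Phi> :: "('a,'x,'b) bm"
  obtain \<beta> \<alpha> where ba: "\<forall>i<p0 S. \<forall>j<q1 S. mX \<Phi> i j =
       (\<Sum>k<q1 S. ra (mX (dd S) i k) (\<beta> k j)) + (\<Sum>k<p0 S. la (\<alpha> i k) (mX (dd S) k j))"
    using H by blast
  show "\<exists>a b. beqd S S \<Phi> (badd (c1 S (dd S) a) (c0 S b (dd S)))"
    by (rule exI[of _ "diag_bm (\<lambda>i j. 0) \<beta>"], rule exI[of _ "diag_bm \<alpha> (\<lambda>i j. 0)"])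
       (use pS ba in \<open>simp add: beq_def Px_shape_def comp_simps badd_def\<close>)
qed

lemma presilting_Pg_P2sh:
  assumes g: "right_gen ra g r"
  shows "presilting la ra (dsum_list [Px 1 r (\<lambda>i j. g j), P2sh])"
proof -
  obtain B where B: "\<forall>x. x = (\<Sum>i<r. ra (g i) (B x i))"
    using g unfolding right_gen_def by metis
  define S :: "('a,'x,'b) cx" where "S = dsum (Px 1 r (\<lambda>i j. g j)) (dsum P2sh zcx)"
  have pS: "Px_shape S" unfolding Px_shape_def S_def by simp
  have sz: "p0 S = 1" "q1 S = Suc r" unfolding S_def by simp_all
  have xi: "mX (dd S) 0 k = (if k < r then g k else 0)" for k
    unfolding S_def by (simp add: dsum_def bdiag_def)
  have "hom1_zero la ra S S"
  proof (rule hom1_zero_Px_shape[OF pS])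
    fix \<phi> :: "nat \<Rightarrow> nat \<Rightarrow> 'x"
    show "\<exists>\<beta> \<alpha>. \<forall>i<p0 S. \<forall>j<q1 S. \<phi> i j =
       (\<Sum>k<q1 S. ra (mX (dd S) i k) (\<beta> k j)) + (\<Sum>k<p0 S. la (\<alpha> i k) (mX (dd S) k j))"
    proof (intro exI allI impI)
      fix i j assume i: "i < p0 S" and "j < q1 S"
      then have i0: "i = 0" using sz by simp
      have "(\<Sum>k<q1 S. ra (mX (dd S) i k) ((\<lambda>k j. if k < r then B (\<phi> 0 j) k else 0) k j))
         = (\<Sum>k<r. ra (g k) (B (\<phi> 0 j) k))"
        unfolding sz i0 by (simp add: xi)
      also have "\<dots> = \<phi> 0 j" using B by metis
      finally show "\<phi> i j = (\<Sum>k<q1 S. ra (mX (dd S) i k) ((\<lambda>k j. if k < r then B (\<phi> 0 j) k else 0) k j))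
          + (\<Sum>k<p0 S. la ((\<lambda>i k. 0) i k) (mX (dd S) k j))"
        unfolding i0 by simp
    qed
  qed
  then show ?thesis unfolding presilting_def dsum_list_def S_def by simp
qed

lemma presilting_P1cx_Ph:
  assumes h: "left_gen la h l"
  shows "presilting la ra (dsum_list [P1cx, Px l 1 (\<lambda>i j. h i)])"
proof -
  obtain A where A: "\<forall>x. x = (\<Sum>i<l. la (A x i) (h i))"
    using h unfolding left_gen_def by metis
  define S :: "('a,'x,'b) cx" where "S = dsum P1cx (dsum (Px l 1 (\<lambda>i j. h i)) zcx)"
  have pS: "Px_shape S" unfolding Px_shape_def S_def by simp
  have sz: "p0 S = Suc l" "q1 S = 1" unfolding S_def by simp_all
  have xiS: "mX (dd S) (Suc k) 0 = (if k < l then h k else 0)" for k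
    unfolding S_def by (simp add: dsum_def bdiag_def)
  have "hom1_zero la ra S S"
  proof (rule hom1_zero_Px_shape[OF pS])
    fix \<phi> :: "nat \<Rightarrow> nat \<Rightarrow> 'x"
    show "\<exists>\<beta> \<alpha>. \<forall>i<p0 S. \<forall>j<q1 S. \<phi> i j =
       (\<Sum>k<q1 S. ra (mX (dd S) i k) (\<beta> k j)) + (\<Sum>k<p0 S. la (\<alpha> i k) (mX (dd S) k j))"
    proof (intro exI allI impI)
      fix i j assume "i < p0 S" and j: "j < q1 S"
      then have j0: "j = 0" using sz by simp
      have "(\<Sum>k<p0 S. la ((\<lambda>i k. if k = 0 then 0 else A (\<phi> i 0) (k - 1)) i k) (mX (dd S) k 0))
          = (\<Sum>k<l. la (A (\<phi> i 0) k) (h k))"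
        unfolding sz by (subst sum.lessThan_Suc_shift) (simp add: xiS)
      also have "\<dots> = \<phi> i 0" using A by metis
      finally show "\<phi> i j = (\<Sum>k<q1 S. ra (mX (dd S) i k) ((\<lambda>k j. 0) k j))
          + (\<Sum>k<p0 S. la ((\<lambda>i k. if k = 0 then 0 else A (\<phi> i 0) (k - 1)) i k) (mX (dd S) k j))"
        unfolding j0 by simp
    qed
  qed
  then show ?thesis unfolding presilting_def dsum_list_def S_def by simp
qed

lemma silting2_Pg_P2sh:
  assumes g: "right_gen ra g r" and r: "r = rgen_num ra"
  shows "silting2 la ra (Px 1 r (\<lambda>i j. g j)) P2sh"
proof -
  have "\<not> hiso la ra (Px 1 r (\<lambda>i j. g j)) P2sh" by (rule not_hiso_deg1_concentrated) simp_all
  then show ?thesis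
    unfolding silting2_def basic_presilting_def
    using indec_Px_right_gen[OF g r] indec_P2sh presilting_Pg_P2sh[OF g] hiso_sym
    by (auto simp: less_Suc_eq)
qed

lemma silting2_P1cx_Ph:
  assumes h: "left_gen la h l" and l: "l = lgen_num la"
  shows "silting2 la ra P1cx (Px l 1 (\<lambda>i j. h i))"
proof -
  have "\<not> hiso la ra P1cx (Px l 1 (\<lambda>i j. h i))" by (rule not_hiso_deg0_concentrated) simp_all
  then show ?thesis
    unfolding silting2_def basic_presilting_def
    using indec_Px_left_gen[OF h l] indec_P1cx presilting_P1cx_Ph[OF h] hiso_sym
    by (auto simp: less_Suc_eq)
qed

section \<open>Radical form of a two-term complex\<close>

lemma hiso_change_basis:
  assumes F: "beq1 V V (c1 V F F') bid" "beq1 V V (c1 V F' F) bid"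
    and E: "beq0 V V (c0 V E E') bid" "beq0 V V (c0 V E' E) bid"
  shows "hiso la ra V (V\<lparr>dd := c1 V (c0 V E (dd V)) F\<rparr>)"
proof -
  let ?V = "V\<lparr>dd := c1 V (c0 V E (dd V)) F\<rparr>"
  have ch: "chain V ?V F' E" unfolding chain_map_def
  proof -
    have "c1 ?V (dd ?V) F' = c0 V E (c1 V (dd V) (c1 V F F'))" by (simp add: comp_assoc)
    also have "beqd V V \<dots> (c0 V E (c1 V (dd V) bid))" by (rule cong_l, rule cong_l, rule F(1))
    also have "beqd V V \<dots> (c0 V E (dd V))" by (rule cong_l, rule comp_bid_r)
    finally show "beqd V ?V (c0 V E (dd V)) (c1 ?V (dd ?V) F')" by (simp add: beq_sym)
  qed
  show ?thesis by (rule hiso_of_inverse_chain_maps[OF ch]) (use F E in simp_all)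
qed

lemma comp_diag_bm: "comp p q (diag_bm E F) (diag_bm E' F') = diag_bm (mm p E E') (mm q F F')"
  unfolding diag_bm_def mm_def by (rule bm_eqI; rule ext; rule ext) (simp_all add: comp_simps)

lemma beq_diag_bm_bid: "eqm pt ps E mI \<Longrightarrow> eqm qt qs F mI \<Longrightarrow> beq ps qs pt qt (diag_bm E F) bid"
  unfolding beq_def eqm_def bid_def mI_def by simp

lemma beq_bsub_zero_of_badd:
  assumes a: "beq ps qs pt qt X X'" and b: "beq ps qs pt qt (badd X' Y) Z"
  shows "beq ps qs pt qt (bsub bzero X) (bsub Y Z)"
proof -
  have e: "bsub Y (badd X' Y) = bsub bzero X'" unfolding bsub_def badd_def bzero_def by (simp add: algebra_simps)
  have "beq ps qs pt qt (bsub bzero X) (bsub bzero X')" by (rule beq_bsub[OF beq_refl a])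
  also have "bsub bzero X' = bsub Y (badd X' Y)" by (rule e[symmetric])
  also have "beq ps qs pt qt \<dots> (bsub Y Z)" by (rule beq_bsub[OF beq_refl b])
  finally show ?thesis .
qed

lemma hiso_dsum_contractible:
  assumes U0: "hiso la ra U zcx"
  shows "hiso la ra (dsum U W) W"
proof -
  let ?S = "dsum U W"
  have nU: "nhtp U U bid bid" using U0 hiso_zcx_iff by blast
  have n1: "nhtp ?S ?S (c1 U bid (c1 U bid bid)) (c0 U bid (c0 U bid bid))"
    by (rule nhtp_comp_l[OF nhtp_comp_r[OF nU chain_proj1] chain_incl1])
  have n2: "nhtp ?S ?S (bsub bzero (c1 U bid (c1 U bid bid))) (bsub bzero (c0 U bid (c0 U bid bid)))"
    by (rule nhtp_bsub[OF nhtp_zero n1])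
  have n3: "nhtp ?S ?S (bsub (c1 W (incl2 (p1 U) (q1 U)) (proj2 (p1 U) (q1 U))) bid)
      (bsub (c0 W (incl2 (p0 U) (q0 U)) (proj2 (p0 U) (q0 U))) bid)"
    by (rule nhtp_beq[OF n2]; rule beq_bsub_zero_of_badd[OF cong_l[OF comp_bid_l] incl_proj_sum(1)] beq_bsub_zero_of_badd[OF cong_l[OF comp_bid_l] incl_proj_sum(2)])
  have n4: "nhtp W W (bsub (c1 ?S (proj2 (p1 U) (q1 U)) (incl2 (p1 U) (q1 U))) bid)
      (bsub (c0 ?S (proj2 (p0 U) (q0 U)) (incl2 (p0 U) (q0 U))) bid)"
    by (rule nhtp_beq[OF nhtp_zero]) (rule beq_zero_bsub, rule proj2_incl2)+
  show ?thesis unfolding hiso_def using chain_proj2 chain_incl2 n3 n4 by blast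
qed

lemma mA_comp: "mA (comp p q N M) = mm p (mA N) (mA M)" unfolding mm_def by (intro ext) (simp add: comp_simps)
lemma mB_comp: "mB (comp p q N M) = mm q (mB N) (mB M)" unfolding mm_def by (intro ext) (simp add: comp_simps)

lemma contractible_hiso_zcx: "hiso la ra \<lparr>p1 = kA, q1 = kB, p0 = kA, q0 = kB, dd = bid\<rparr> zcx"
  unfolding hiso_zcx_iff
  by (rule nhtpI[of _ _ _ bid]) (simp_all add: beq_sym comp_bid_l comp_bid_r)

lemma hiso_clear_X_rows:
  assumes kA: "kA \<le> p1 V"
    and A: "\<And>i k. i < p0 V \<Longrightarrow> k < p1 V \<Longrightarrow> i < kA \<or> k < kA \<Longrightarrow> mA (dd V) i k = mI i k"
  shows "hiso la ra V (V\<lparr>dd := (dd V)\<lparr>mX := \<lambda>i j. if i < kA then 0 else mX (dd V) i j\<rparr>\<rparr>)"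
proof -
  define x where "x = (\<lambda>i l. if i < kA then mX (dd V) i l else 0)"
  define F :: "('a,'x,'b) bm" where "F = \<lparr>mA = mI, mX = (\<lambda>i j. - x i j), mB = mI\<rparr>"
  define F' :: "('a,'x,'b) bm" where "F' = \<lparr>mA = mI, mX = x, mB = mI\<rparr>"
  have h: "hiso la ra V (V\<lparr>dd := c1 V (c0 V bid (dd V)) F\<rparr>)"
    by (rule hiso_change_basis[of _ _ F' _ bid]) (simp_all add: F_def F'_def beq_def comp_simps mI_def bid_def)
  have "mX (c1 V (c0 V bid (dd V)) F) i j = (if i < kA then 0 else mX (dd V) i j)"
    if "i < p0 V" "j < q1 V" for i j
  proof -
    have "mX (c1 V (c0 V bid (dd V)) F) i j = - (\<Sum>k<p1 V. la (mA (dd V) i k) (x k j)) + mX (dd V) i j"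
      using that by (simp add: comp_simps F_def bid_def mI_def la_neg_r sum_negf)
    also have "(\<Sum>k<p1 V. la (mA (dd V) i k) (x k j))
        = (\<Sum>k<p1 V. if k = i then (if i < kA then mX (dd V) i j else 0) else 0)"
      by (rule sum.cong) (use that A in \<open>auto simp: x_def mI_def\<close>)
    also have "\<dots> = (if i < kA then mX (dd V) i j else 0)" using kA by (subst sum.delta) auto
    finally show ?thesis by simp
  qed
  then have "hiso la ra (V\<lparr>dd := c1 V (c0 V bid (dd V)) F\<rparr>)
      (V\<lparr>dd := (dd V)\<lparr>mX := \<lambda>i j. if i < kA then 0 else mX (dd V) i j\<rparr>\<rparr>)"
    by (intro hiso_of_eq_data) (auto simp: beq_def comp_simps F_def bid_def mI_def)
  with h show ?thesis by (rule hiso_trans)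
qed

lemma hiso_clear_X_cols:
  assumes kB: "kB \<le> q0 V"
    and B: "\<And>k j. k < q0 V \<Longrightarrow> j < q1 V \<Longrightarrow> k < kB \<or> j < kB \<Longrightarrow> mB (dd V) k j = mI k j"
  shows "hiso la ra V (V\<lparr>dd := (dd V)\<lparr>mX := \<lambda>i j. if j < kB then 0 else mX (dd V) i j\<rparr>\<rparr>)"
proof -
  define y where "y = (\<lambda>i l. if l < kB then mX (dd V) i l else 0)"
  define E :: "('a,'x,'b) bm" where "E = \<lparr>mA = mI, mX = (\<lambda>i j. - y i j), mB = mI\<rparr>"
  define E' :: "('a,'x,'b) bm" where "E' = \<lparr>mA = mI, mX = y, mB = mI\<rparr>"
  have h: "hiso la ra V (V\<lparr>dd := c1 V (c0 V E (dd V)) bid\<rparr>)"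
    by (rule hiso_change_basis[of _ bid bid _ E']) (simp_all add: E_def E'_def beq_def comp_simps mI_def bid_def)
  have "mX (c1 V (c0 V E (dd V)) bid) i j = (if j < kB then 0 else mX (dd V) i j)"
    if "i < p0 V" "j < q1 V" for i j
  proof -
    have "mX (c1 V (c0 V E (dd V)) bid) i j = mX (dd V) i j - (\<Sum>k<q0 V. ra (y i k) (mB (dd V) k j))"
      using that by (simp add: comp_simps E_def bid_def mI_def ra_neg_l sum_negf)
    also have "(\<Sum>k<q0 V. ra (y i k) (mB (dd V) k j))
        = (\<Sum>k<q0 V. if k = j then (if j < kB then mX (dd V) i j else 0) else 0)"
      by (rule sum.cong) (use that kB B in \<open>auto simp: y_def mI_def\<close>)
    also have "\<dots> = (if j < kB then mX (dd V) i j else 0)" using kB by (subst sum.delta) auto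
    finally show ?thesis by simp
  qed
  then have "hiso la ra (V\<lparr>dd := c1 V (c0 V E (dd V)) bid\<rparr>)
      (V\<lparr>dd := (dd V)\<lparr>mX := \<lambda>i j. if j < kB then 0 else mX (dd V) i j\<rparr>\<rparr>)"
    by (intro hiso_of_eq_data) (auto simp: beq_def comp_simps E_def bid_def mI_def)
  with h show ?thesis by (rule hiso_trans)
qed

text \<open>Identity blocks of the differential split off as contractible summands.\<close>
lemma hiso_drop_identity_blocks:
  assumes k: "kA \<le> p0 V" "kA \<le> p1 V" "kB \<le> q0 V" "kB \<le> q1 V"
    and A: "\<And>i k. i < p0 V \<Longrightarrow> k < p1 V \<Longrightarrow> i < kA \<or> k < kA \<Longrightarrow> mA (dd V) i k = mI i k"
    and B: "\<And>k j. k < q0 V \<Longrightarrow> j < q1 V \<Longrightarrow> k < kB \<or> j < kB \<Longrightarrow> mB (dd V) k j = mI k j"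
  shows "hiso la ra V \<lparr>p1 = p1 V - kA, q1 = q1 V - kB, p0 = p0 V - kA, q0 = q0 V - kB,
    dd = \<lparr>mA = (\<lambda>i j. mA (dd V) (i + kA) (j + kA)), mX = (\<lambda>i j. mX (dd V) (i + kA) (j + kB)),
          mB = (\<lambda>i j. mB (dd V) (i + kB) (j + kB))\<rparr>\<rparr>" (is "hiso la ra V ?Vm")
proof -
  define V1 where "V1 = V\<lparr>dd := (dd V)\<lparr>mX := \<lambda>i j. if i < kA then 0 else mX (dd V) i j\<rparr>\<rparr>"
  define V2 where "V2 = V1\<lparr>dd := (dd V1)\<lparr>mX := \<lambda>i j. if j < kB then 0 else mX (dd V1) i j\<rparr>\<rparr>"
  have "hiso la ra V V1" unfolding V1_def by (rule hiso_clear_X_rows[OF k(2) A])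
  moreover have "hiso la ra V1 V2" unfolding V2_def by (rule hiso_clear_X_cols) (use k B in \<open>simp_all add: V1_def\<close>)
  moreover have "hiso la ra V2 (dsum \<lparr>p1 = kA, q1 = kB, p0 = kA, q0 = kB, dd = bid\<rparr> ?Vm)"
    using k by (intro hiso_of_eq_data) (auto simp: V1_def V2_def beq_def dsum_def bdiag_def bid_def A B mI_def)
  moreover have "hiso la ra (dsum \<lparr>p1 = kA, q1 = kB, p0 = kA, q0 = kB, dd = bid\<rparr> ?Vm) ?Vm"
    by (rule hiso_dsum_contractible[OF contractible_hiso_zcx])
  ultimately show ?thesis by (meson hiso_trans)
qed

lemma hiso_radical_form:
  "\<exists>Vm. hiso la ra V Vm \<and> (\<forall>i<p0 Vm. \<forall>j<p1 Vm. nonunit (mA (dd Vm) i j))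
     \<and> (\<forall>i<q0 Vm. \<forall>j<q1 Vm. nonunit (mB (dd Vm) i j))"
proof -
  let ?p1 = "p1 V" and ?q1 = "q1 V" and ?p0 = "p0 V" and ?q0 = "q0 V"
  obtain kA PA PA' QA QA' where GA: "kA \<le> ?p0" "kA \<le> ?p1" "invp ?p0 PA PA'" "invp ?p1 QA QA'"
    "\<forall>i<?p0. \<forall>j<?p1. (i < kA \<or> j < kA \<longrightarrow> mm ?p1 (mm ?p0 PA (mA (dd V))) QA i j = mI i j) \<and>
         (kA \<le> i \<and> kA \<le> j \<longrightarrow> nonunit (mm ?p1 (mm ?p0 PA (mA (dd V))) QA i j))"
    using A.local_matrix_normal_form[of ?p0 ?p1 "mA (dd V)"] by blast
  obtain kB PB PB' QB QB' where GB: "kB \<le> ?q0" "kB \<le> ?q1" "invp ?q0 PB PB'" "invp ?q1 QB QB'"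
    "\<forall>i<?q0. \<forall>j<?q1. (i < kB \<or> j < kB \<longrightarrow> mm ?q1 (mm ?q0 PB (mB (dd V))) QB i j = mI i j) \<and>
         (kB \<le> i \<and> kB \<le> j \<longrightarrow> nonunit (mm ?q1 (mm ?q0 PB (mB (dd V))) QB i j))"
    using B.local_matrix_normal_form[of ?q0 ?q1 "mB (dd V)"] by blast
  define V1 where "V1 = V\<lparr>dd := c1 V (c0 V (diag_bm PA PB) (dd V)) (diag_bm QA QB)\<rparr>"
  have h1: "hiso la ra V V1" unfolding V1_def
    by (rule hiso_change_basis[of _ _ "diag_bm QA' QB'" _ "diag_bm PA' PB'"])
       (use GA GB in \<open>simp_all add: comp_diag_bm beq_diag_bm_bid invp_def\<close>)
  have A1: "mA (dd V1) = mm ?p1 (mm ?p0 PA (mA (dd V))) QA" and B1: "mB (dd V1) = mm ?q1 (mm ?q0 PB (mB (dd V))) QB"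
    unfolding V1_def by (simp_all add: mA_comp mB_comp)
  have sz: "p1 V1 = ?p1" "q1 V1 = ?q1" "p0 V1 = ?p0" "q0 V1 = ?q0" unfolding V1_def by simp_all
  show ?thesis
  proof (intro exI conjI)
    show "hiso la ra V \<lparr>p1 = p1 V1 - kA, q1 = q1 V1 - kB, p0 = p0 V1 - kA, q0 = q0 V1 - kB,
      dd = \<lparr>mA = (\<lambda>i j. mA (dd V1) (i + kA) (j + kA)), mX = (\<lambda>i j. mX (dd V1) (i + kA) (j + kB)),
            mB = (\<lambda>i j. mB (dd V1) (i + kB) (j + kB))\<rparr>\<rparr>"
      using h1 by (rule hiso_trans, intro hiso_drop_identity_blocks) (use GA GB in \<open>auto simp: sz A1 B1\<close>)
  qed (use GA(5) GB(5) in \<open>auto simp: sz A1 B1\<close>)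
qed

section \<open>Uniqueness of the mutation\<close>

lemma indec_deg1_hiso:
  assumes "p0 T = 0" "q0 T = 0" "indec la ra T"
  shows "hiso la ra T P1sh \<or> hiso la ra T P2sh"
proof -
  have triv: "htp_trivial W" if "p0 W = 0" "q0 W = 0" for W :: "('a,'x,'b) cx" using that by (simp add: htp_trivial_def)
  have nz: "\<not> hiso la ra T zcx" using assms(3) unfolding indec_def by blast
  show ?thesis
  proof (cases "p1 T")
    case 0
    show ?thesis
    proof (cases "q1 T")
      case 0
      then have "hiso la ra T zcx" using \<open>p1 T = 0\<close> assms by (simp add: hiso_zcx_iff_sizes triv)
      with nz show ?thesis by blast
    next
      case (Suc n)
      define W :: "('a,'x,'b) cx" where "W = \<lparr>p1 = 0, q1 = n, p0 = 0, q0 = 0, dd = bzero\<rparr>"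
      have "hiso la ra T (dsum P2sh W)"
        by (rule hiso_of_eq_data) (use assms \<open>p1 T = 0\<close> Suc in \<open>simp_all add: W_def beq_def\<close>)
      then have "hiso la ra P2sh zcx \<or> hiso la ra W zcx" using assms(3) unfolding indec_def by blast
      then have "n = 0" by (auto simp: hiso_zcx_iff_sizes triv W_def)
      then have "hiso la ra T P2sh"
        by (intro hiso_of_eq_data) (use assms \<open>p1 T = 0\<close> Suc in \<open>simp_all add: beq_def\<close>)
      then show ?thesis by blast
    qed
  next
    case (Suc n)
    define W :: "('a,'x,'b) cx" where "W = \<lparr>p1 = n, q1 = q1 T, p0 = 0, q0 = 0, dd = bzero\<rparr>"
    have "hiso la ra T (dsum P1sh W)"
      by (rule hiso_of_eq_data) (use assms Suc in \<open>simp_all add: W_def beq_def\<close>)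
    then have "hiso la ra P1sh zcx \<or> hiso la ra W zcx" using assms(3) unfolding indec_def by blast
    then have "n = 0 \<and> q1 T = 0" by (auto simp: hiso_zcx_iff_sizes triv W_def)
    then have "hiso la ra T P1sh"
      by (intro hiso_of_eq_data) (use assms Suc in \<open>simp_all add: beq_def\<close>)
    then show ?thesis by blast
  qed
qed

lemma indec_deg0_hiso:
  assumes "p1 T = 0" "q1 T = 0" "indec la ra T"
  shows "hiso la ra T P1cx \<or> hiso la ra T P2cx"
proof -
  have triv: "htp_trivial W" if "p1 W = 0" "q1 W = 0" for W :: "('a,'x,'b) cx" using that by (simp add: htp_trivial_def)
  have nz: "\<not> hiso la ra T zcx" using assms(3) unfolding indec_def by blast
  show ?thesis
  proof (cases "p0 T")
    case 0
    show ?thesis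
    proof (cases "q0 T")
      case 0
      then have "hiso la ra T zcx" using \<open>p0 T = 0\<close> assms by (simp add: hiso_zcx_iff_sizes triv)
      with nz show ?thesis by blast
    next
      case (Suc n)
      define W :: "('a,'x,'b) cx" where "W = \<lparr>p1 = 0, q1 = 0, p0 = 0, q0 = n, dd = bzero\<rparr>"
      have "hiso la ra T (dsum P2cx W)"
        by (rule hiso_of_eq_data) (use assms \<open>p0 T = 0\<close> Suc in \<open>simp_all add: W_def beq_def\<close>)
      then have "hiso la ra P2cx zcx \<or> hiso la ra W zcx" using assms(3) unfolding indec_def by blast
      then have "n = 0" by (auto simp: hiso_zcx_iff_sizes triv W_def)
      then have "hiso la ra T P2cx"
        by (intro hiso_of_eq_data) (use assms \<open>p0 T = 0\<close> Suc in \<open>simp_all add: beq_def\<close>)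
      then show ?thesis by blast
    qed
  next
    case (Suc n)
    define W :: "('a,'x,'b) cx" where "W = \<lparr>p1 = 0, q1 = 0, p0 = n, q0 = q0 T, dd = bzero\<rparr>"
    have "hiso la ra T (dsum P1cx W)"
      by (rule hiso_of_eq_data) (use assms Suc in \<open>simp_all add: W_def beq_def\<close>)
    then have "hiso la ra P1cx zcx \<or> hiso la ra W zcx" using assms(3) unfolding indec_def by blast
    then have "n = 0 \<and> q0 T = 0" by (auto simp: hiso_zcx_iff_sizes triv W_def)
    then have "hiso la ra T P1cx"
      by (intro hiso_of_eq_data) (use assms Suc in \<open>simp_all add: beq_def\<close>)
    then show ?thesis by blast
  qed
qed

text \<open>The unipotent column operation \<open>[[I, 0], [N, I]]\<close> with \<open>N = S\<^sub>b\<^sub>o\<^sub>t V\<close> clears the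
  first \<open>r\<close> columns of all rows but the first; this is where invertibility of the top block of
  \<open>S\<close> is used.\<close>
lemma hiso_Px_split_first_row:
  fixes \<xi> :: "nat \<Rightarrow> nat \<Rightarrow> 'x" and S V :: "nat \<Rightarrow> nat \<Rightarrow> 'b"
  assumes rb: "r \<le> b" and c1: "1 \<le> c"
    and row0: "\<And>j. r \<le> j \<Longrightarrow> j < b \<Longrightarrow> \<xi> 0 j = 0"
    and S: "invp r S V"
    and kill: "\<And>i j. 0 < i \<Longrightarrow> i < c \<Longrightarrow> j < r \<Longrightarrow> xmul b \<xi> S i j = 0"
  shows "hiso la ra (Px c b \<xi> :: ('a,'x,'b) cx)
    (dsum (Px 1 r (\<lambda>i j. \<xi> 0 j)) (Px (c - 1) (b - r) (\<lambda>i j. \<xi> (Suc i) (r + j))))"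
proof -
  define T where "T = mm r (\<lambda>m k. S (r + m) k) V"
  define N :: "nat \<Rightarrow> nat \<Rightarrow> 'b" where "N = (\<lambda>i j. if r \<le> i \<and> j < r then T (i - r) j else 0)"
  define C where "C = (\<lambda>i j. mI i j + N i j)"
  define C' where "C' = (\<lambda>i j. mI i j - N i j)"
  have "mm b N N = (\<lambda>i j. 0)" unfolding mm_def N_def by (intro ext sum.neutral) auto
  then have invC: "invp b C C'"
    unfolding invp_def eqm_def C_def C'_def
    by (simp add: mm_add_left mm_add_right mm_diff_left mm_diff_right mm_I_left mm_I_right)
  define \<xi>' where "\<xi>' = xmul b \<xi> C"
  have h1: "hiso la ra (Px c b \<xi> :: ('a,'x,'b) cx) (Px c b \<xi>')"
  proof (rule hiso_Px[OF invp_I invp_sym[OF invC]], intro allI impI)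
    fix i j assume ij: "i < c" "j < b"
    have "xmul b \<xi>' C' i j = xmul b \<xi> mI i j"
      unfolding \<xi>'_def xmul_assoc by (rule xmul_cong) (use invC ij in \<open>auto simp: invp_def eqm_def\<close>)
    then show "mulx c mI \<xi> i j = xmul b \<xi>' C' i j" using ij by (simp add: xmul_mI mulx_mI)
  qed
  have \<xi>'_lower: "\<xi>' i j = \<xi> i j + (\<Sum>m<b - r. ra (\<xi> i (r + m)) (T m j))" if "j < r" for i j
  proof -
    have "xmul b \<xi> N i j = (\<Sum>m<b - r. ra (\<xi> i (r + m)) (T m j))"
      unfolding xmul_def using that by (subst sum_lessThan_split[OF rb]) (simp add: N_def)
    then show ?thesis using that rb unfolding \<xi>'_def C_def xmul_def by (simp add: ra_add_r sum.distrib mI_def)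
  qed
  have \<xi>'_upper: "\<xi>' i j = \<xi> i j" if "r \<le> j" "j < b" for i j
    using that unfolding \<xi>'_def C_def xmul_def by (simp add: ra_add_r sum.distrib mI_def N_def)
  have "\<xi> i j + (\<Sum>m<b - r. ra (\<xi> i (r + m)) (T m j)) = xmul r (xmul b \<xi> S) V i j" if "j < r" for i j
  proof -
    have "(\<Sum>k<r. ra (\<xi> i k) (mm r S V k j)) = (\<Sum>k<r. ra (\<xi> i k) (mI k j))"
      by (rule sum.cong) (use S that in \<open>auto simp: invp_def eqm_def\<close>)
    then have "(\<Sum>k<r. ra (\<xi> i k) (mm r S V k j)) = \<xi> i j" using that by (simp add: sum_ra_mI)
    moreover have "xmul b \<xi> (mm r S V) i j
        = (\<Sum>k<r. ra (\<xi> i k) (mm r S V k j)) + (\<Sum>m<b - r. ra (\<xi> i (r + m)) (mm r S V (r + m) j))"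
      unfolding xmul_def by (rule sum_lessThan_split[OF rb])
    ultimately show ?thesis by (simp add: xmul_assoc T_def mm_def)
  qed
  then have "\<xi>' i j = 0" if "0 < i" "i < c" "j < r" for i j
    using that kill by (simp add: \<xi>'_lower xmul_def)
  moreover have "\<xi>' 0 j = \<xi> 0 j" if "j < b" for j
    using that row0 rb by (cases "j < r") (simp_all add: \<xi>'_lower \<xi>'_upper)
  ultimately have "hiso la ra (Px c b \<xi>' :: ('a,'x,'b) cx)
      (dsum (Px 1 r (\<lambda>i j. \<xi> 0 j)) (Px (c - 1) (b - r) (\<lambda>i j. \<xi> (Suc i) (r + j))))"
    using c1 rb row0 by (intro hiso_of_eq_data) (auto simp: beq_def dsum_def bdiag_def \<xi>'_upper Suc_le_eq)
  with h1 show ?thesis by (rule hiso_trans)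
qed

text \<open>Write the first row of \<open>\<xi>\<close> as \<open>g F\<close> and choose \<open>F'\<close> with \<open>\<xi> F' = [g; 0]\<close>. Then \<open>F F'\<close> fixes
  \<open>g\<close>, so it is invertible by minimality, and normalising \<open>F\<close> by column operations splits
  \<open>P\<^sub>\<xi>\<close> as a row of minimal generators plus a remainder.\<close>
lemma right_generating_first_row:
  assumes g: "right_gen ra g r" and r: "r = rgen_num ra" and c1: "1 \<le> c"
    and gen: "\<forall>\<psi>::nat\<Rightarrow>'x. \<exists>\<eta>. \<forall>i<c. \<psi> i = (\<Sum>k<b. ra (\<xi> i k) (\<eta> k))"
  obtains F F' W where "\<And>j. xmul r (\<lambda>i k. g k) F 0 j = \<xi> 0 j"
    and "\<And>i k. i < c \<Longrightarrow> xmul b \<xi> F' i k = (if i = 0 then g k else 0)"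
    and "invp r (mm b F F') W"
proof -
  define G :: "nat \<Rightarrow> nat \<Rightarrow> 'x" where "G = (\<lambda>i k. g k)"
  obtain Fc where Fc: "\<forall>x. x = (\<Sum>k<r. ra (g k) (Fc x k))" using g unfolding right_gen_def by metis
  define F where "F = (\<lambda>k j. Fc (\<xi> 0 j) k)"
  have GF: "xmul r G F 0 j = \<xi> 0 j" for j unfolding xmul_def G_def F_def using Fc by metis
  have "\<forall>k. \<exists>\<eta>. \<forall>i<c. (if i = 0 then g k else 0) = (\<Sum>l<b. ra (\<xi> i l) (\<eta> l))"
    using gen by (intro allI) (rule spec[OF gen, of "\<lambda>i. if i = 0 then g _ else 0"])
  then have "\<exists>H. \<forall>k. \<forall>i<c. (if i = 0 then g k else 0) = (\<Sum>l<b. ra (\<xi> i l) (H k l))"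
    by (rule choice)
  then obtain H where H: "\<forall>k. \<forall>i<c. (if i = 0 then g k else 0) = (\<Sum>l<b. ra (\<xi> i l) (H k l))"
    by blast
  define F' where "F' = (\<lambda>l k. H k l)"
  have \<xi>F': "xmul b \<xi> F' i k = (if i = 0 then g k else 0)" if "i < c" for i k
    unfolding xmul_def F'_def by (subst H[rule_format, OF that]) simp
  have "xmul b (xmul r G F) F' 0 j = xmul b \<xi> F' 0 j" for j
    by (rule xmul_cong) (simp_all add: GF)
  then have "xmul r G (mm b F F') 0 j = g j" for j using \<xi>F'[of 0 j] c1 by (simp add: xmul_assoc)
  then have "\<exists>W. invp r (mm b F F') W"
    by (intro minimal_right_gen_stabilizer_invp[OF g r]) (simp add: xmul_def G_def)
  then show ?thesis using that GF \<xi>F' unfolding G_def by blast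
qed

lemma right_generating_Px_reduction:
  assumes g: "right_gen ra g r" and r: "r = rgen_num ra" and c1: "1 \<le> c"
    and gen: "\<forall>\<psi>::nat\<Rightarrow>'x. \<exists>\<eta>. \<forall>i<c. \<psi> i = (\<Sum>k<b. ra (\<xi> i k) (\<eta> k))"
  shows "\<exists>\<gamma> Z. r \<le> b \<and> hiso la ra (Px c b \<xi> :: ('a,'x,'b) cx) (dsum (Px 1 r \<gamma>) (Px (c - 1) (b - r) Z))
    \<and> hiso la ra (Px 1 r \<gamma> :: ('a,'x,'b) cx) (Px 1 r (\<lambda>i j. g j))"
proof -
  define G :: "nat \<Rightarrow> nat \<Rightarrow> 'x" where "G = (\<lambda>i k. g k)"
  obtain F F' W where GF: "\<And>j. xmul r G F 0 j = \<xi> 0 j"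
    and \<xi>F': "\<And>i k. i < c \<Longrightarrow> xmul b \<xi> F' i k = (if i = 0 then g k else 0)"
    and W: "invp r (mm b F F') W"
    using right_generating_first_row[OF g r c1 gen] unfolding G_def by blast
  obtain Q Q' P P' where NF: "r \<le> b" "invp b Q Q'" "invp r P P'"
    "\<forall>i<r. \<forall>j<b. mm b F Q i j = (if j < r then P' i j else 0)"
    using B.right_invertible_normal_form[OF W] by blast
  define \<xi>' where "\<xi>' = xmul b \<xi> Q"
  have h1: "hiso la ra (Px c b \<xi> :: ('a,'x,'b) cx) (Px c b \<xi>')"
  proof (rule hiso_Px[OF invp_I invp_sym[OF NF(2)]], intro allI impI)
    fix i j assume ij: "i < c" "j < b"
    have "xmul b \<xi>' Q' i j = xmul b \<xi> mI i j"
      unfolding \<xi>'_def xmul_assoc by (rule xmul_cong) (use NF(2) ij in \<open>auto simp: invp_def eqm_def\<close>)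
    then show "mulx c mI \<xi> i j = xmul b \<xi>' Q' i j" using ij by (simp add: xmul_mI mulx_mI)
  qed
  have row0: "\<xi>' 0 j = (if j < r then xmul r G P' 0 j else 0)" if "j < b" for j
  proof -
    have "\<xi>' 0 j = xmul r G (mm b F Q) 0 j"
      unfolding \<xi>'_def xmul_assoc[symmetric] by (rule xmul_cong) (simp_all add: GF)
    also have "\<dots> = (\<Sum>k<r. ra (g k) (if j < r then P' k j else 0))"
      unfolding xmul_def G_def by (rule sum.cong) (simp_all add: NF(4) that)
    finally show ?thesis by (simp add: xmul_def G_def)
  qed
  have kill: "xmul b \<xi>' (mm b Q' F') i j = (if i = 0 then g j else 0)" if "i < c" "j < r" for i j
  proof -
    have "eqm b r (mm b (mm b Q Q') F') F'"
      by (rule eqm_mm_left_mI) (use NF(2) in \<open>simp add: invp_def\<close>)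
    then have "xmul b \<xi> (mm b (mm b Q Q') F') i j = xmul b \<xi> F' i j"
      by (intro xmul_cong) (use that in \<open>auto simp: eqm_def\<close>)
    then show ?thesis using \<xi>F' that unfolding \<xi>'_def by (simp add: xmul_assoc mm_assoc)
  qed
  have "hiso la ra (Px c b \<xi>' :: ('a,'x,'b) cx)
      (dsum (Px 1 r (\<lambda>i j. \<xi>' 0 j)) (Px (c - 1) (b - r) (\<lambda>i j. \<xi>' (Suc i) (r + j))))"
    by (rule hiso_Px_split_first_row[OF NF(1) c1 _ B.right_inverse_top_block_invp[OF W NF]])
       (simp_all add: row0 kill)
  moreover have "hiso la ra (Px 1 r (\<lambda>i j. \<xi>' 0 j) :: ('a,'x,'b) cx) (Px 1 r (\<lambda>i j. g j))"
    by (rule hiso_Px[OF invp_I invp_sym[OF NF(3)]]) (use NF(1) in \<open>simp add: row0 mulx_mI xmul_def G_def\<close>)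
  ultimately show ?thesis using NF(1) hiso_trans[OF h1] by blast
qed

lemma indec_right_generating_hiso_Pg:
  assumes g: "right_gen ra g r" and r: "r = rgen_num ra" and c1: "1 \<le> c"
    and gen: "\<forall>\<psi>::nat\<Rightarrow>'x. \<exists>\<eta>. \<forall>i<c. \<psi> i = (\<Sum>k<b. ra (\<xi> i k) (\<eta> k))"
    and ind: "indec la ra (Px c b \<xi> :: ('a,'x,'b) cx)"
  shows "hiso la ra (Px c b \<xi> :: ('a,'x,'b) cx) (Px 1 r (\<lambda>i j. g j))"
proof -
  obtain \<gamma> Z where rb: "r \<le> b"
    and split: "hiso la ra (Px c b \<xi> :: ('a,'x,'b) cx) (dsum (Px 1 r \<gamma>) (Px (c - 1) (b - r) Z))"
    and \<gamma>: "hiso la ra (Px 1 r \<gamma> :: ('a,'x,'b) cx) (Px 1 r (\<lambda>i j. g j))"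
    using right_generating_Px_reduction[OF g r c1 gen] by blast
  have "hiso la ra (Px 1 r \<gamma> :: ('a,'x,'b) cx) zcx \<or> hiso la ra (Px (c - 1) (b - r) Z :: ('a,'x,'b) cx) zcx"
    using ind split unfolding indec_def by blast
  then have cb: "c = 1" "b = r" using c1 rb by (auto simp: hiso_zcx_iff_sizes Px_shape_htp_trivial)
  have "hiso la ra (dsum (Px 1 r \<gamma>) (Px (c - 1) (b - r) Z)) (Px 1 r \<gamma> :: ('a,'x,'b) cx)"
    by (rule hiso_of_eq_data) (auto simp: cb beq_def dsum_def bdiag_def)
  then show ?thesis using split \<gamma> by (meson hiso_trans)
qed

lemma hiso_Px_split_first_col:
  fixes \<xi> :: "nat \<Rightarrow> nat \<Rightarrow> 'x" and S V :: "nat \<Rightarrow> nat \<Rightarrow> 'a"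
  assumes lc: "l \<le> c" and b1: "1 \<le> b"
    and col0: "\<And>i. l \<le> i \<Longrightarrow> i < c \<Longrightarrow> \<xi> i 0 = 0"
    and S: "invp l S V"
    and kill: "\<And>i j. i < l \<Longrightarrow> 0 < j \<Longrightarrow> j < b \<Longrightarrow> mulx c S \<xi> i j = 0"
  shows "hiso la ra (Px c b \<xi> :: ('a,'x,'b) cx)
    (dsum (Px l 1 (\<lambda>i j. \<xi> i 0)) (Px (c - l) (b - 1) (\<lambda>i j. \<xi> (l + i) (Suc j))))"
proof -
  define T where "T = mm l V (\<lambda>k m. S k (l + m))"
  define N :: "nat \<Rightarrow> nat \<Rightarrow> 'a" where "N = (\<lambda>i j. if i < l \<and> l \<le> j then T i (j - l) else 0)"
  define C where "C = (\<lambda>i j. mI i j + N i j)"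
  define C' where "C' = (\<lambda>i j. mI i j - N i j)"
  have "mm c N N = (\<lambda>i j. 0)" unfolding mm_def N_def by (intro ext sum.neutral) auto
  then have invC: "invp c C C'"
    unfolding invp_def eqm_def C_def C'_def
    by (simp add: mm_add_left mm_add_right mm_diff_left mm_diff_right mm_I_left mm_I_right)
  define \<xi>' where "\<xi>' = mulx c C \<xi>"
  have h1: "hiso la ra (Px c b \<xi> :: ('a,'x,'b) cx) (Px c b \<xi>')"
    by (rule hiso_Px[OF invC invp_I]) (simp add: \<xi>'_def xmul_mI)
  have \<xi>'_upper: "\<xi>' i j = \<xi> i j + (\<Sum>m<c - l. la (T i m) (\<xi> (l + m) j))" if "i < l" for i j
  proof -
    have "mulx c N \<xi> i j = (\<Sum>m<c - l. la (T i m) (\<xi> (l + m) j))"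
      unfolding mulx_def using that by (subst sum_lessThan_split[OF lc]) (simp add: N_def)
    then show ?thesis using that lc unfolding \<xi>'_def C_def mulx_def by (simp add: la_add_l sum.distrib mI_def)
  qed
  have \<xi>'_lower: "\<xi>' i j = \<xi> i j" if "l \<le> i" "i < c" for i j
    using that unfolding \<xi>'_def C_def mulx_def by (simp add: la_add_l sum.distrib mI_def N_def)
  have "\<xi> i j + (\<Sum>m<c - l. la (T i m) (\<xi> (l + m) j)) = mulx l V (mulx c S \<xi>) i j" if "i < l" for i j
  proof -
    have "(\<Sum>k<l. la (mm l V S i k) (\<xi> k j)) = (\<Sum>k<l. la (mI i k) (\<xi> k j))"
      by (rule sum.cong) (use S that in \<open>auto simp: invp_def eqm_def\<close>)
    then have "(\<Sum>k<l. la (mm l V S i k) (\<xi> k j)) = \<xi> i j" using that by (simp add: sum_la_mI)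
    moreover have "mulx c (mm l V S) \<xi> i j
        = (\<Sum>k<l. la (mm l V S i k) (\<xi> k j)) + (\<Sum>m<c - l. la (mm l V S i (l + m)) (\<xi> (l + m) j))"
      unfolding mulx_def by (rule sum_lessThan_split[OF lc])
    ultimately show ?thesis by (simp add: mulx_assoc T_def mm_def)
  qed
  then have "\<xi>' i j = 0" if "i < l" "0 < j" "j < b" for i j
    using that kill by (simp add: \<xi>'_upper mulx_def)
  moreover have "\<xi>' i 0 = \<xi> i 0" if "i < c" for i
    using that col0 lc by (cases "i < l") (simp_all add: \<xi>'_upper \<xi>'_lower)
  ultimately have "hiso la ra (Px c b \<xi>' :: ('a,'x,'b) cx)
      (dsum (Px l 1 (\<lambda>i j. \<xi> i 0)) (Px (c - l) (b - 1) (\<lambda>i j. \<xi> (l + i) (Suc j))))"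
    using b1 lc col0 by (intro hiso_of_eq_data) (auto simp: beq_def dsum_def bdiag_def \<xi>'_lower Suc_le_eq)
  with h1 show ?thesis by (rule hiso_trans)
qed

lemma left_generating_first_col:
  assumes h: "left_gen la h l" and l: "l = lgen_num la" and b1: "1 \<le> b"
    and gen: "\<forall>\<psi>::nat\<Rightarrow>'x. \<exists>\<eta>. \<forall>j<b. \<psi> j = (\<Sum>k<c. la (\<eta> k) (\<xi> k j))"
  obtains F F' W where "\<And>i. mulx l F (\<lambda>k j. h k) i 0 = \<xi> i 0"
    and "\<And>k j. j < b \<Longrightarrow> mulx c F' \<xi> k j = (if j = 0 then h k else 0)"
    and "invp l (mm c F' F) W"
proof -
  define Hm :: "nat \<Rightarrow> nat \<Rightarrow> 'x" where "Hm = (\<lambda>k j. h k)"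
  obtain Ac where Ac: "\<forall>x. x = (\<Sum>k<l. la (Ac x k) (h k))" using h unfolding left_gen_def by metis
  define F where "F = (\<lambda>i k. Ac (\<xi> i 0) k)"
  have FH: "mulx l F Hm i 0 = \<xi> i 0" for i unfolding mulx_def Hm_def F_def using Ac by metis
  have "\<forall>k. \<exists>\<eta>. \<forall>j<b. (if j = 0 then h k else 0) = (\<Sum>i<c. la (\<eta> i) (\<xi> i j))"
    using gen by (intro allI) (rule spec[OF gen, of "\<lambda>j. if j = 0 then h _ else 0"])
  then have "\<exists>F'. \<forall>k. \<forall>j<b. (if j = 0 then h k else 0) = (\<Sum>i<c. la (F' k i) (\<xi> i j))"
    by (rule choice)
  then obtain F' where F': "\<forall>k. \<forall>j<b. (if j = 0 then h k else 0) = (\<Sum>i<c. la (F' k i) (\<xi> i j))"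
    by blast
  have F'\<xi>: "mulx c F' \<xi> k j = (if j = 0 then h k else 0)" if "j < b" for k j
    unfolding mulx_def by (subst F'[rule_format, OF that]) simp
  have "mulx c F' (mulx l F Hm) k 0 = mulx c F' \<xi> k 0" for k
    by (rule mulx_cong) (simp_all add: FH)
  then have "mulx l (mm c F' F) Hm k 0 = h k" for k using F'\<xi>[of 0 k] b1 by (simp add: mulx_assoc)
  then have "\<exists>W. invp l (mm c F' F) W"
    by (intro minimal_left_gen_stabilizer_invp[OF h l]) (simp add: mulx_def Hm_def)
  then show ?thesis using that FH F'\<xi> unfolding Hm_def by blast
qed

lemma left_generating_Px_reduction:
  assumes h: "left_gen la h l" and l: "l = lgen_num la" and b1: "1 \<le> b"
    and gen: "\<forall>\<psi>::nat\<Rightarrow>'x. \<exists>\<eta>. \<forall>j<b. \<psi> j = (\<Sum>k<c. la (\<eta> k) (\<xi> k j))"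
  shows "\<exists>\<gamma> Z. l \<le> c \<and> hiso la ra (Px c b \<xi> :: ('a,'x,'b) cx) (dsum (Px l 1 \<gamma>) (Px (c - l) (b - 1) Z))
    \<and> hiso la ra (Px l 1 \<gamma> :: ('a,'x,'b) cx) (Px l 1 (\<lambda>i j. h i))"
proof -
  define Hm :: "nat \<Rightarrow> nat \<Rightarrow> 'x" where "Hm = (\<lambda>k j. h k)"
  obtain F F' W where FH: "\<And>i. mulx l F Hm i 0 = \<xi> i 0"
    and F'\<xi>: "\<And>k j. j < b \<Longrightarrow> mulx c F' \<xi> k j = (if j = 0 then h k else 0)"
    and W: "invp l (mm c F' F) W"
    using left_generating_first_col[OF h l b1 gen] unfolding Hm_def by blast
  obtain P P' Q Q' where NF: "l \<le> c" "invp c P P'" "invp l Q Q'"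
    "\<forall>i<c. \<forall>j<l. mm c P F i j = (if i < l then Q' i j else 0)"
    using A.left_invertible_normal_form[OF W] by blast
  define \<xi>' where "\<xi>' = mulx c P \<xi>"
  have h1: "hiso la ra (Px c b \<xi> :: ('a,'x,'b) cx) (Px c b \<xi>')"
    by (rule hiso_Px[OF NF(2) invp_I]) (simp add: \<xi>'_def xmul_mI)
  have col0: "\<xi>' i 0 = (if i < l then mulx l Q' Hm i 0 else 0)" if "i < c" for i
  proof -
    have "\<xi>' i 0 = mulx l (mm c P F) Hm i 0"
      unfolding \<xi>'_def mulx_assoc[symmetric] by (rule mulx_cong) (simp_all add: FH)
    also have "\<dots> = (\<Sum>k<l. la (if i < l then Q' i k else 0) (h k))"
      unfolding mulx_def Hm_def by (rule sum.cong) (simp_all add: NF(4) that)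
    finally show ?thesis by (simp add: mulx_def Hm_def)
  qed
  have kill: "mulx c (mm c F' P') \<xi>' k j = (if j = 0 then h k else 0)" if "k < l" "j < b" for k j
  proof -
    have "eqm l c (mm c F' (mm c P' P)) F'"
      by (rule eqm_mm_right_mI) (use NF(2) in \<open>simp add: invp_def\<close>)
    then have "mulx c (mm c F' (mm c P' P)) \<xi> k j = mulx c F' \<xi> k j"
      by (intro mulx_cong) (use that in \<open>auto simp: eqm_def\<close>)
    then show ?thesis using F'\<xi> that unfolding \<xi>'_def by (simp add: mulx_assoc mm_assoc)
  qed
  have "hiso la ra (Px c b \<xi>' :: ('a,'x,'b) cx)
      (dsum (Px l 1 (\<lambda>i j. \<xi>' i 0)) (Px (c - l) (b - 1) (\<lambda>i j. \<xi>' (l + i) (Suc j))))"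
    by (rule hiso_Px_split_first_col[OF NF(1) b1 _ A.left_inverse_left_block_invp[OF W NF]])
       (simp_all add: col0 kill)
  moreover have "hiso la ra (Px l 1 (\<lambda>i j. \<xi>' i 0) :: ('a,'x,'b) cx) (Px l 1 (\<lambda>i j. h i))"
  proof (rule hiso_Px[OF NF(3) invp_I], intro allI impI)
    fix i j :: nat assume ij: "i < l" "j < 1"
    have "mulx l Q (\<lambda>i j. \<xi>' i 0) i j = mulx l (mm l Q Q') Hm i 0"
      unfolding mulx_assoc[symmetric] mulx_def[of l Q]
      by (rule sum.cong) (use NF(1) in \<open>simp_all add: col0\<close>)
    also have "\<dots> = mulx l mI Hm i 0"
      by (rule mulx_cong) (use NF(3) ij in \<open>auto simp: invp_def eqm_def\<close>)
    finally show "mulx l Q (\<lambda>i j. \<xi>' i 0) i j = xmul 1 (\<lambda>i j. h i) mI i j"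
      using ij by (simp add: mulx_mI xmul_mI Hm_def)
  qed
  ultimately show ?thesis using NF(1) hiso_trans[OF h1] by blast
qed

lemma indec_left_generating_hiso_Ph:
  assumes h: "left_gen la h l" and l: "l = lgen_num la" and b1: "1 \<le> b"
    and gen: "\<forall>\<psi>::nat\<Rightarrow>'x. \<exists>\<eta>. \<forall>j<b. \<psi> j = (\<Sum>k<c. la (\<eta> k) (\<xi> k j))"
    and ind: "indec la ra (Px c b \<xi> :: ('a,'x,'b) cx)"
  shows "hiso la ra (Px c b \<xi> :: ('a,'x,'b) cx) (Px l 1 (\<lambda>i j. h i))"
proof -
  obtain \<gamma> Z where lc: "l \<le> c"
    and split: "hiso la ra (Px c b \<xi> :: ('a,'x,'b) cx) (dsum (Px l 1 \<gamma>) (Px (c - l) (b - 1) Z))"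
    and \<gamma>: "hiso la ra (Px l 1 \<gamma> :: ('a,'x,'b) cx) (Px l 1 (\<lambda>i j. h i))"
    using left_generating_Px_reduction[OF h l b1 gen] by blast
  have "hiso la ra (Px l 1 \<gamma> :: ('a,'x,'b) cx) zcx \<or> hiso la ra (Px (c - l) (b - 1) Z :: ('a,'x,'b) cx) zcx"
    using ind split unfolding indec_def by blast
  then have cb: "c = l" "b = 1" using b1 lc by (auto simp: hiso_zcx_iff_sizes Px_shape_htp_trivial)
  have "hiso la ra (dsum (Px l 1 \<gamma>) (Px (c - l) (b - 1) Z)) (Px l 1 \<gamma> :: ('a,'x,'b) cx)"
    by (rule hiso_of_eq_data) (auto simp: cb beq_def dsum_def bdiag_def)
  then show ?thesis using split \<gamma> by (meson hiso_trans)
qed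

text \<open>A radical block in the differential obstructs null-homotopies of identity-like maps
  \<open>T\<^sup>-\<^sup>1 \<rightarrow> U\<^sup>0\<close>, which forces summands to vanish.\<close>
lemma hom1_zero_self_radical_A:
  assumes "hom1_zero la ra V V" and "\<forall>i<p0 V. \<forall>j<p1 V. nonunit (mA (dd V) i j)"
  shows "p1 V = 0 \<or> p0 V = 0"
proof (rule ccontr)
  assume "\<not> (p1 V = 0 \<or> p0 V = 0)"
  then have pp: "0 < p1 V" "0 < p0 V" by auto
  obtain a b where "beqd V V \<lparr>mA = (\<lambda>i j. 1), mX = (\<lambda>i j. 0), mB = (\<lambda>i j. 0)\<rparr>
      (badd (c1 V (dd V) a) (c0 V b (dd V)))"
    using assms(1) unfolding hom1_zero_def by blast
  then have "1 = mA (badd (c1 V (dd V) a) (c0 V b (dd V))) 0 0" using pp unfolding beq_def by auto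
  then have "(1::'a) = (\<Sum>k<p1 V. mA (dd V) 0 k * mA a k 0) + (\<Sum>k<p0 V. mA b 0 k * mA (dd V) k 0)"
    by (simp add: badd_def comp_simps)
  moreover have "nonunit ((\<Sum>k<p1 V. mA (dd V) 0 k * mA a k 0) + (\<Sum>k<p0 V. mA b 0 k * mA (dd V) k 0))"
    using assms(2) pp by (intro A.nonunit_add A.nonunit_sum A.nonunit_mult_left A.nonunit_mult_right) auto
  ultimately show False by simp
qed

lemma hom1_zero_self_radical_B:
  assumes "hom1_zero la ra V V" and "\<forall>i<q0 V. \<forall>j<q1 V. nonunit (mB (dd V) i j)"
  shows "q1 V = 0 \<or> q0 V = 0"
proof (rule ccontr)
  assume "\<not> (q1 V = 0 \<or> q0 V = 0)"
  then have pp: "0 < q1 V" "0 < q0 V" by auto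
  obtain a b where "beqd V V \<lparr>mA = (\<lambda>i j. 0), mX = (\<lambda>i j. 0), mB = (\<lambda>i j. 1)\<rparr>
      (badd (c1 V (dd V) a) (c0 V b (dd V)))"
    using assms(1) unfolding hom1_zero_def by blast
  then have "1 = mB (badd (c1 V (dd V) a) (c0 V b (dd V))) 0 0" using pp unfolding beq_def by auto
  then have "(1::'b) = (\<Sum>k<q1 V. mB (dd V) 0 k * mB a k 0) + (\<Sum>k<q0 V. mB b 0 k * mB (dd V) k 0)"
    by (simp add: badd_def comp_simps)
  moreover have "nonunit ((\<Sum>k<q1 V. mB (dd V) 0 k * mB a k 0) + (\<Sum>k<q0 V. mB b 0 k * mB (dd V) k 0))"
    using assms(2) pp by (intro B.nonunit_add B.nonunit_sum B.nonunit_mult_left B.nonunit_mult_right) auto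
  ultimately show False by simp
qed

lemma hom1_zero_P2sh_radical:
  assumes "hom1_zero la ra P2sh V" and "\<forall>i<q0 V. \<forall>j<q1 V. nonunit (mB (dd V) i j)"
  shows "q0 V = 0"
proof (rule ccontr)
  assume q0: "q0 V \<noteq> 0"
  obtain a b where "beqd P2sh V \<lparr>mA = (\<lambda>i j. 0), mX = (\<lambda>i j. 0), mB = (\<lambda>i j. 1)\<rparr>
      (badd (c1 V (dd V) a) (c0 P2sh b (dd P2sh)))"
    using assms(1) unfolding hom1_zero_def by blast
  then have "1 = mB (badd (c1 V (dd V) a) (c0 P2sh b (dd P2sh))) 0 0" using q0 unfolding beq_def by auto
  then have "(1::'b) = (\<Sum>k<q1 V. mB (dd V) 0 k * mB a k 0)" by (simp add: badd_def comp_simps)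
  moreover have "nonunit (\<Sum>k<q1 V. mB (dd V) 0 k * mB a k 0)"
    using assms(2) q0 by (intro B.nonunit_sum B.nonunit_mult_left) auto
  ultimately show False by simp
qed

lemma hom1_zero_P1cx_radical:
  assumes "hom1_zero la ra V P1cx" and "\<forall>i<p0 V. \<forall>j<p1 V. nonunit (mA (dd V) i j)"
  shows "p1 V = 0"
proof (rule ccontr)
  assume p1: "p1 V \<noteq> 0"
  obtain a b where "beqd V P1cx \<lparr>mA = (\<lambda>i j. 1), mX = (\<lambda>i j. 0), mB = (\<lambda>i j. 0)\<rparr>
      (badd (c1 P1cx (dd P1cx) a) (c0 V b (dd V)))"
    using assms(1) unfolding hom1_zero_def by blast
  then have "1 = mA (badd (c1 P1cx (dd P1cx) a) (c0 V b (dd V))) 0 0" using p1 unfolding beq_def by auto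
  then have "(1::'a) = (\<Sum>k<p0 V. mA b 0 k * mA (dd V) k 0)" by (simp add: badd_def comp_simps)
  moreover have "nonunit (\<Sum>k<p0 V. mA b 0 k * mA (dd V) k 0)"
    using assms(2) p1 by (intro A.nonunit_sum A.nonunit_mult_right) auto
  ultimately show False by simp
qed

lemma hom1_zero_P2sh_right_generating:
  assumes "hom1_zero la ra P2sh V" and "p1 V = 0"
  shows "\<forall>\<psi>::nat\<Rightarrow>'x. \<exists>\<eta>. \<forall>i<p0 V. \<psi> i = (\<Sum>k<q1 V. ra (mX (dd V) i k) (\<eta> k))"
proof
  fix \<psi> :: "nat \<Rightarrow> 'x"
  obtain a b where ab: "beqd P2sh V \<lparr>mA = (\<lambda>i j. 0), mX = (\<lambda>i j. \<psi> i), mB = (\<lambda>i j. 0)\<rparr>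
      (badd (c1 V (dd V) a) (c0 P2sh b (dd P2sh)))"
    using assms(1) unfolding hom1_zero_def by blast
  have "\<psi> i = (\<Sum>k<q1 V. ra (mX (dd V) i k) (mB a k 0))" if "i < p0 V" for i
  proof -
    have "\<psi> i = mX (badd (c1 V (dd V) a) (c0 P2sh b (dd P2sh))) i 0" using ab that unfolding beq_def by auto
    then show ?thesis using assms(2) by (simp add: badd_def comp_simps)
  qed
  then show "\<exists>\<eta>. \<forall>i<p0 V. \<psi> i = (\<Sum>k<q1 V. ra (mX (dd V) i k) (\<eta> k))"
    by (intro exI[of _ "\<lambda>k. mB a k 0"]) blast
qed

lemma hom1_zero_P1cx_left_generating:
  assumes "hom1_zero la ra V P1cx" and "q0 V = 0"
  shows "\<forall>\<psi>::nat\<Rightarrow>'x. \<exists>\<eta>. \<forall>j<q1 V. \<psi> j = (\<Sum>k<p0 V. la (\<eta> k) (mX (dd V) k j))"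
proof
  fix \<psi> :: "nat \<Rightarrow> 'x"
  obtain a b where ab: "beqd V P1cx \<lparr>mA = (\<lambda>i j. 0), mX = (\<lambda>i j. \<psi> j), mB = (\<lambda>i j. 0)\<rparr>
      (badd (c1 P1cx (dd P1cx) a) (c0 V b (dd V)))"
    using assms(1) unfolding hom1_zero_def by blast
  have "\<psi> j = (\<Sum>k<p0 V. la (mA b 0 k) (mX (dd V) k j))" if "j < q1 V" for j
  proof -
    have "\<psi> j = mX (badd (c1 P1cx (dd P1cx) a) (c0 V b (dd V))) 0 j" using ab that unfolding beq_def by auto
    then show ?thesis using assms(2) by (simp add: badd_def comp_simps)
  qed
  then show "\<exists>\<eta>. \<forall>j<q1 V. \<psi> j = (\<Sum>k<p0 V. la (\<eta> k) (mX (dd V) k j))"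
    by (intro exI[of _ "\<lambda>k. mA b 0 k"]) blast
qed

lemma mutation_partner_P2sh_unique:
  assumes g: "right_gen ra g r" and r: "r = rgen_num ra"
    and s: "silting2 la ra V P2sh" and n1: "\<not> hiso la ra V P1sh"
  shows "hiso la ra V (Px 1 r (\<lambda>i j. g j))"
proof -
  have indV: "indec la ra V" and n2: "\<not> hiso la ra V P2sh"
    and ps: "presilting la ra (dsum_list [V, P2sh])"
    using s unfolding silting2_def basic_presilting_def by (auto simp: All_less_Suc)
  obtain Vm where Vm: "hiso la ra V Vm" "\<forall>i<p0 Vm. \<forall>j<p1 Vm. nonunit (mA (dd Vm) i j)"
    "\<forall>i<q0 Vm. \<forall>j<q1 Vm. nonunit (mB (dd Vm) i j)" using hiso_radical_form[of V] by blast
  note H = presilting_pair_hom1_zero[OF ps]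
  have HVV: "hom1_zero la ra Vm Vm" by (rule hom1_hiso[OF H(1) Vm(1) Vm(1)])
  have HSV: "hom1_zero la ra P2sh Vm" by (rule hom1_hiso[OF H(2) hiso_refl Vm(1)])
  have indm: "indec la ra Vm" by (rule indec_hiso[OF indV Vm(1)])
  have q0: "q0 Vm = 0" by (rule hom1_zero_P2sh_radical[OF HSV Vm(3)])
  show ?thesis
  proof (cases "p0 Vm = 0")
    case True
    have "\<not> hiso la ra Vm P1sh" "\<not> hiso la ra Vm P2sh" using n1 n2 hiso_trans[OF Vm(1)] by blast+
    with indec_deg1_hiso[OF True q0 indm] show ?thesis by blast
  next
    case False
    then have p1: "p1 Vm = 0" and c1: "1 \<le> p0 Vm"
      using hom1_zero_self_radical_A[OF HVV Vm(2)] by auto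
    have hP: "hiso la ra Vm (Px (p0 Vm) (q1 Vm) (mX (dd Vm)))"
      by (rule hiso_Px_of_Px_shape) (simp add: Px_shape_def p1 q0)
    have "hiso la ra (Px (p0 Vm) (q1 Vm) (mX (dd Vm)) :: ('a,'x,'b) cx) (Px 1 r (\<lambda>i j. g j))"
      by (rule indec_right_generating_hiso_Pg[OF g r c1 hom1_zero_P2sh_right_generating[OF HSV p1]
            indec_hiso[OF indm hP]])
    then show ?thesis using Vm(1) hP by (meson hiso_trans)
  qed
qed

lemma mutation_partner_P1cx_unique:
  assumes h: "left_gen la h l" and l: "l = lgen_num la"
    and s: "silting2 la ra P1cx V" and n1: "\<not> hiso la ra V P2cx"
  shows "hiso la ra V (Px l 1 (\<lambda>i j. h i))"
proof -
  have indV: "indec la ra V" and n2: "\<not> hiso la ra P1cx V"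
    and ps: "presilting la ra (dsum_list [P1cx, V])"
    using s unfolding silting2_def basic_presilting_def by (auto simp: All_less_Suc)
  obtain Vm where Vm: "hiso la ra V Vm" "\<forall>i<p0 Vm. \<forall>j<p1 Vm. nonunit (mA (dd Vm) i j)"
    "\<forall>i<q0 Vm. \<forall>j<q1 Vm. nonunit (mB (dd Vm) i j)" using hiso_radical_form[of V] by blast
  note H = presilting_pair_hom1_zero[OF ps]
  have HVV: "hom1_zero la ra Vm Vm" by (rule hom1_hiso[OF H(3) Vm(1) Vm(1)])
  have HVC: "hom1_zero la ra Vm P1cx" by (rule hom1_hiso[OF H(2) Vm(1) hiso_refl])
  have indm: "indec la ra Vm" by (rule indec_hiso[OF indV Vm(1)])
  have p1: "p1 Vm = 0" by (rule hom1_zero_P1cx_radical[OF HVC Vm(2)])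
  show ?thesis
  proof (cases "q1 Vm = 0")
    case True
    have "\<not> hiso la ra Vm P2cx" "\<not> hiso la ra Vm P1cx"
      using n1 n2 hiso_trans[OF Vm(1)] hiso_sym by blast+
    with indec_deg0_hiso[OF p1 True indm] show ?thesis by blast
  next
    case False
    then have q0: "q0 Vm = 0" and b1: "1 \<le> q1 Vm"
      using hom1_zero_self_radical_B[OF HVV Vm(3)] by auto
    have hP: "hiso la ra Vm (Px (p0 Vm) (q1 Vm) (mX (dd Vm)))"
      by (rule hiso_Px_of_Px_shape) (simp add: Px_shape_def p1 q0)
    have "hiso la ra (Px (p0 Vm) (q1 Vm) (mX (dd Vm)) :: ('a,'x,'b) cx) (Px l 1 (\<lambda>i j. h i))"
      by (rule indec_left_generating_hiso_Ph[OF h l b1 hom1_zero_P1cx_left_generating[OF HVC q0]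
            indec_hiso[OF indm hP]])
    then show ?thesis using Vm(1) hP by (meson hiso_trans)
  qed
qed

section \<open>Mutations and the \<open>g\<close>-fan\<close>

lemma gfan_cone_Pg_P2sh:
  assumes "right_gen ra g (rgen_num ra)"
  shows "cone hull {(0::real, -1::real), (1, - real (rgen_num ra))} \<in> gfan la ra"
proof -
  have "basic_presilting la ra [Px 1 (rgen_num ra) (\<lambda>i j. g j), P2sh]"
    using silting2_Pg_P2sh[OF assms refl] unfolding silting2_def .
  moreover have "gvec ` set [Px 1 (rgen_num ra) (\<lambda>i j. g j), P2sh :: ('a,'x,'b) cx]
      = {(0::real, -1::real), (1, - real (rgen_num ra))}"
    by (auto simp: gvec_def)
  ultimately show ?thesis unfolding gfan_def by (metis (mono_tags, lifting) mem_Collect_eq)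
qed

lemma gfan_cone_P1cx_Ph:
  assumes "left_gen la h (lgen_num la)"
  shows "cone hull {(1::real, 0::real), (real (lgen_num la), -1)} \<in> gfan la ra"
proof -
  have "basic_presilting la ra [P1cx, Px (lgen_num la) 1 (\<lambda>i j. h i)]"
    using silting2_P1cx_Ph[OF assms refl] unfolding silting2_def .
  moreover have "gvec ` set [P1cx, Px (lgen_num la) 1 (\<lambda>i j. h i) :: ('a,'x,'b) cx]
      = {(1::real, 0::real), (real (lgen_num la), -1)}"
    by (auto simp: gvec_def)
  ultimately show ?thesis unfolding gfan_def by (metis (mono_tags, lifting) mem_Collect_eq)
qed

text \<open>\<open>P\<^sub>g \<oplus> P\<^sub>2[1] > P\<^sub>1[1] \<oplus> P\<^sub>2[1]\<close> holds because the target has nothing in degree 0.\<close>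
lemma mu_plus_P1sh_Pg:
  assumes g: "right_gen ra g (rgen_num ra)"
  shows "mu_plus la ra P1sh P2sh 1 (Px 1 (rgen_num ra) (\<lambda>i j. g j))"
proof -
  let ?U = "Px 1 (rgen_num ra) (\<lambda>i j. g j) :: ('a,'x,'b) cx"
  have "\<not> hiso la ra ?U P1sh" "\<not> hiso la ra (dsum ?U P2sh) (dsum P1sh P2sh)"
    by (rule not_hiso_deg1_concentrated; simp)+
  moreover have "hom1_zero la ra (dsum ?U P2sh) (dsum P1sh P2sh)" unfolding hom1_zero_def beq_def by simp
  ultimately show ?thesis
    unfolding mu_plus_def mut_ok_def mut_cx_def sgt_def
    using silting2_Pg_P2sh[OF g refl] mutation_partner_P2sh_unique[OF g refl] by simp
qed

lemma mu_minus_P2cx_Ph: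
  assumes h: "left_gen la h (lgen_num la)"
  shows "mu_minus la ra P1cx P2cx 2 (Px (lgen_num la) 1 (\<lambda>i j. h i))"
proof -
  let ?U = "Px (lgen_num la) 1 (\<lambda>i j. h i) :: ('a,'x,'b) cx"
  have "\<not> hiso la ra P2cx ?U" "\<not> hiso la ra (dsum P1cx P2cx) (dsum P1cx ?U)"
    by (rule not_hiso_deg0_concentrated; simp)+
  moreover have "hom1_zero la ra (dsum P1cx P2cx) (dsum P1cx ?U)" unfolding hom1_zero_def beq_def by simp
  ultimately show ?thesis
    unfolding mu_minus_def mut_ok_def mut_cx_def sgt_def
    using silting2_P1cx_Ph[OF h refl] mutation_partner_P1cx_unique[OF h refl] hiso_sym by auto
qed

end

theorem proposition3p10:
  fixes \<iota>A :: "'k::field \<Rightarrow> 'a::ring_1" and \<iota>B :: "'k \<Rightarrow> 'b::ring_1"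
    and la :: "'a \<Rightarrow> 'x::ab_group_add \<Rightarrow> 'x" and ra :: "'x \<Rightarrow> 'b \<Rightarrow> 'x"
  assumes "k_alg \<iota>A" and "k_alg \<iota>B"
    and "fin_dim_k (\<lambda>c a. \<iota>A c * a)" and "fin_dim_k (\<lambda>c b. \<iota>B c * b)"
    and "loc_ring TYPE('a)" and "loc_ring TYPE('b)"
    and "bimod la ra"
    and "\<forall>c x. la (\<iota>A c) x = ra x (\<iota>B c)"
    and "fin_dim_k (\<lambda>c x. la (\<iota>A c) x)"
  shows "cone hull {(0::real, -1::real), (1, - real (rgen_num ra))} \<in> gfan la ra
         \<and> cone hull {(1::real, 0::real), (real (lgen_num la), -1)} \<in> gfan la ra
         \<and> (\<forall>g. right_gen ra g (rgen_num ra) \<longrightarrow>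
              mu_plus la ra P1sh P2sh 1 (Px 1 (rgen_num ra) (\<lambda>i j. g j)))
         \<and> (\<forall>h. left_gen la h (lgen_num la) \<longrightarrow>
              mu_minus la ra P1cx P2cx 2 (Px (lgen_num la) 1 (\<lambda>i j. h i)))"
proof -
  interpret local_bimodule "TYPE('a)" "TYPE('b)" la ra
    by unfold_locales (use assms in auto)
  obtain g h where g: "right_gen ra g (rgen_num ra)" and h: "left_gen la h (lgen_num la)"
    using fin_dim_finitely_generated[OF assms(9,8)] rgen_num_attained lgen_num_attained by metis
  show ?thesis using gfan_cone_Pg_P2sh[OF g] gfan_cone_P1cx_Ph[OF h] mu_plus_P1sh_Pg mu_minus_P2cx_Ph by blast
qed

end
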